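(* Let $(B,\Lambda,\underline v)$ be a bow diagram of affine type A. The following are equivalent. (a) $\mathcal M_{0,0}(B,\Lambda,\underline v)\neq\varnothing$. (b) There exists $(\lambda,\theta)\in\mathbb C^{\mathcal I}\times\mathbb Z^{\mathcal I}$ such that $\mathcal M_{\lambda,\theta}(B,\Lambda,\underline v)\neq\varnothing$. (c) Every bow diagram Hanany--Witten equivalent to $(B,\Lambda,\underline v)$ originates from a brane diagram (i.e. has all dimensions $\ge 0$). (d) Every separated bow diagram Hanany--Witten equivalent to $(B,\Lambda,\underline v)$ satisfies the supersymmetry inequalities. (e) $(B,\Lambda,\underline v)$ is supersymmetric. (f) $(B,\Lambda,\underline v)$ satisfies the stratum condition.
   Context: $\mathbb N=\{0,1,2,\dots\}$. **Bow diagrams.** Fix $n,w\ge 0$ with $n+w\ge1$. An affine type A bow diagram $(B,\Lambda,\underline v)$ consists of an anticlockwise oriented circle carrying $n$ arrows (set $\mathcal E$) and a set $\Lambda$ of $w$ x-points. Between the head of an arrow and the tail of the next arrow (anticlockwise) there is a wavy line; $\mathcal I$ is the set of wavy lines (if $n=1$ there is one wavy line, from the head to the tail of the unique arrow; if $n=0$ there is one closed wavy line). The x-points lie on the wavy lines and divide them into segments; $\mathcal I^s$ is the set of segments, i.e. of the $n+w$ arcs between consecutive elements of $\mathcal E\sqcup\Lambda$. The dimension vector is $\underline v=(v_\zeta)\in\mathbb Z^{\mathcal I^s}$ (negative entries allowed). For an arrow $e$, $v_{t(e)},v_{h(e)}$ are the dimensions of the segments at its tail and head. For an x-point $x$, $\zeta_x^-,\zeta_x^+$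 are the segments just before and just after $x$ anticlockwise, with dimensions $v_x^\pm$. The diagram originates from a brane diagram if $\underline v\in\mathbb N^{\mathcal I^s}$. It is balanced if $v_{t(e)}=v_{h(e)}$ for every arrow $e$. **Hanany--Witten transitions.** Suppose an arrow and an x-point are consecutive, so that reading anticlockwise one sees dimensions $v_1\,|\,p\,|\,v_2\,|\,q\,|\,v_3$ with one of $p,q$ an arrow and the other an x-point. The transition swaps $p$ and $q$ and replaces $v_2$ by $v_1+v_3-v_2+1$, all other dimensions being unchanged. Two bow diagrams related by a finite sequence of such transitions are Hanany--Witten equivalent. **Separated diagrams and supersymmetry inequalities.** A bow diagram is separated if all x-points lie on the same wavy line. Label the arrows and x-points so that, reading anticlockwise, one sees $e_n,v_{n-1},e_{n-1},\dots,v_1,e_1,v_0,x_1,v_{-1},x_2,\dots,v_{-(w-1)},x_w,v_{-w}$, and then again $e_n$; so $v_s$ is the dimension at the tail of $e_s$ and $v_{-w}=v_n$. It satisfies the supersymmetry inequalities if for all $s\in\{0,\dots,n\}$, $k\in\{0,\dots,w\}$, $t\in\mathbb N\setminus\{0\}$: $$sk+(t-1)(sw+kn)+\tfrac{(t-1)(t-2)}2wn+v_s+v_{-k}+(t-1)v_{-w}-tv_0\ge0,$$ $$sk+(t-1)(sw+kn)+\tfrac{(t-1)(t-2)}2wn+v_{n-s}+v_{-(w-k)}+(t-1)v_0-tv_{-w}\ge0.$$ **Supersymmetry.** A brane diagram of affine type A is a graph with two types of vertices, NS5-branes and D5-branes, embedded at distinct points of a circle, whose edges (D3-branes) are immersed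 in the circle with their endpoints at vertices (an edge may wind around the circle and may have both ends at the same vertex). A D3-brane is fixed if its endpoints are of different types; it is oriented from its NS5 end to its D5 end (so it is clockwise or anticlockwise), and its winding number is the number of full loops it completes. The brane diagram is supersymmetric if for every $t\in\mathbb N$ and every pair (NS5-brane, D5-brane) there is at most one clockwise and at most one anticlockwise fixed D3-brane of winding number $t$ connecting them. Its associated bow diagram replaces NS5-branes by arrows and D5-branes by x-points, with $v_\zeta$ the total number of times D3-branes run through the arc $\zeta$. A bow diagram is supersymmetric if it is associated with some supersymmetric brane diagram. **Stratum condition.** A bow subdiagram of $(B,\Lambda,\underline v)$ is $(B,\Lambda,\underline v')$ with $v'_\zeta\le v_\zeta$ for all $\zeta$. A bow diagram satisfies the stratum condition if every Hanany--Witten equivalent separated bow diagram $(B,\Lambda',\underline u)$ admits a supersymmetric bow subdiagram $(B,\Lambda',\underline u')$ with $u'^-_x-u'^+_x=u_x^--u_x^+$ for every x-point $x$ and which is Hanany--Witten equivalent to a balanced bow diagram. **Bow varieties.** Let $\underline v\in\mathbb N^{\mathcal I^s}$. For $e\in\mathcal E$ let $\mathcal M^e$ be the space of pairs $(C_e,D_e)$, $C_e:\mathbb C^{v_{t(e)}}\to\mathbb C^{v_{h(e)}}$, $D_e:\mathbb C^{v_{h(e)}}\to\mathbb C^{v_{t(e)}}$ linear. For $x\in\Lambda$ let $\mathcal M^x$ be the space of tuples $(A_x,B_x^-,B_x^+,a_x,b_x)$ of linear maps $A_x:\mathbb C^{v_x^-}\to\mathbb C^{v_x^+}$, $B_x^\pm\in\mathrm{End}(\mathbb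 C^{v_x^\pm})$, $a_x:\mathbb C\to\mathbb C^{v_x^+}$, $b_x:\mathbb C^{v_x^-}\to\mathbb C$ with (i) $B_x^+A_x-A_xB_x^-+a_xb_x=0$; (ii) no nonzero $B_x^-$-invariant subspace is contained in $\ker A_x\cap\ker b_x$; (iii) no proper $B_x^+$-invariant subspace of $\mathbb C^{v_x^+}$ contains $\mathrm{Im}A_x+\mathrm{Im}\,a_x$. Put $\widetilde{\mathcal M}=\prod_x\mathcal M^x\times\bigoplus_e\mathcal M^e$, a symplectic affine variety with Hamiltonian base-change action of $\mathcal G=\prod_\zeta GL(v_\zeta)$. The moment map $\mu:\widetilde{\mathcal M}\to\bigoplus_\zeta\mathfrak{gl}(v_\zeta)$ has $\zeta$-component equal to the sum of the contributions of the two neighbours of $\zeta$: if the element just before $\zeta$ (anticlockwise) is an arrow $e$ it contributes $C_eD_e$, if it is an x-point $x$ it contributes $-B_x^+$; if the element just after $\zeta$ is an arrow $e$ it contributes $-D_eC_e$, if it is an x-point $x$ it contributes $B_x^-$. A deformation parameter $\lambda\in\mathbb C^{\mathcal I}$ is viewed in $\bigoplus_\zeta\mathfrak{gl}(v_\zeta)$ as $\lambda_\sigma\mathrm{Id}$ on the first segment $\zeta_\sigma$ of each wavy line $\sigma$ and $0$ on the other segments (if $n=0$, a fixed segment is designated as first). A stability parameter $\theta\in\mathbb Z^{\mathcal I}$ gives the character $\chi_\theta(g)=\prod_\sigma\det(g_{\zeta_\sigma})^{-\theta_\sigma}$. Then $\mathcal M_{\lambda,\theta}(B,\Lambda,\underline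 v)=\mu^{-1}(\lambda)/\!/_{\chi_\theta}\mathcal G$ (GIT quotient). If some $v_\zeta<0$, set $\mathcal M_{\lambda,\theta}=\varnothing$ for all $\lambda,\theta$. *)

theory Defs
  imports
    Complex_Main
    "HOL-Library.Multiset"
    "Jordan_Normal_Form.Determinant"
    "Jordan_Normal_Form.VS_Connect"
begin

section \<open>Bow diagrams\<close>

text \<open>
  The circle is cut open and read anticlockwise. With N = n + w, position i < N carries an arrow or
  an x-point, and segment i is the arc from element i to element i + 1 (indices modulo N).
  Hence segment i - 1 ends and segment i begins at element i; if element i is an arrow, its tail is
  at segment i - 1 and its head at segment i.
\<close>

datatype element = Arrow | XPoint

record bow =
  elts :: "element list"
  dims :: "int list"

definition is_bow :: "bow \<Rightarrow> bool" where
  "is_bow D \<longleftrightarrow> elts D \<noteq> [] \<and> length (dims D) = length (elts D)"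

definition len :: "bow \<Rightarrow> nat" where
  "len D = length (elts D)"

definition num_arrows :: "bow \<Rightarrow> nat" where
  "num_arrows D = length (filter (\<lambda>p. p = Arrow) (elts D))"

definition num_xpoints :: "bow \<Rightarrow> nat" where
  "num_xpoints D = length (filter (\<lambda>p. p = XPoint) (elts D))"

definition nxt :: "bow \<Rightarrow> nat \<Rightarrow> nat" where
  "nxt D i = (i + 1) mod len D"

definition prv :: "bow \<Rightarrow> nat \<Rightarrow> nat" where
  "prv D i = (i + len D - 1) mod len D"

definition originates_from_brane :: "bow \<Rightarrow> bool" where
  "originates_from_brane D \<longleftrightarrow> (\<forall>i<len D. dims D ! i \<ge> 0)"

definition balanced :: "bow \<Rightarrow> bool" where
  "balanced D \<longleftrightarrow>
     (\<forall>i<len D. elts D ! i = Arrow \<longrightarrow> dims D ! (prv D i) = dims D ! i)"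

text \<open>
  A wavy line is represented by the index of its first segment, which is the segment at the head of
  an arrow. Without arrows there is a single closed wavy line, and segment 0 is the one designated
  as first; since the circle may be cut anywhere, this is no restriction.
\<close>

definition wavy_lines :: "bow \<Rightarrow> nat set" where
  "wavy_lines D =
     (if num_arrows D = 0 then {0} else {i. i < len D \<and> elts D ! i = Arrow})"

definition lies_on :: "bow \<Rightarrow> nat \<Rightarrow> nat \<Rightarrow> bool" where
  "lies_on D i \<sigma> \<longleftrightarrow>
     (\<exists>m. (\<sigma> + m) mod len D = i \<and> (\<forall>j\<in>{1..m}. elts D ! ((\<sigma> + j) mod len D) \<noteq> Arrow))"

definition separated :: "bow \<Rightarrow> bool" where
  "separated D \<longleftrightarrow>
     (\<exists>\<sigma>\<in>wavy_lines D. \<forall>i<len D. elts D ! i = XPoint \<longrightarrow> lies_on D i \<sigma>)"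


section \<open>Hanany--Witten transitions\<close>

definition hw_transition :: "bow \<Rightarrow> bow \<Rightarrow> bool" where
  "hw_transition D D' \<longleftrightarrow>
     (\<exists>i<len D. elts D ! i \<noteq> elts D ! (nxt D i) \<and>
        D' = \<lparr>elts = (elts D)[i := elts D ! (nxt D i), nxt D i := elts D ! i],
              dims = (dims D)[i := dims D ! (prv D i) + dims D ! (nxt D i) - dims D ! i + 1]\<rparr>)"

definition hw_equivalent :: "bow \<Rightarrow> bow \<Rightarrow> bool" where
  "hw_equivalent = hw_transition\<^sup>*\<^sup>*"


section \<open>Supersymmetry inequalities\<close>

text \<open>
  A labelling of a separated diagram is given by the position r of the arrow labelled n
  (of the first x-point, if there are no arrows). The dimension with label s is then the one of
  segment r + n - 1 - s, for s from -w to n. The labelling is unique if there are both arrows and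
  x-points; otherwise the inequalities say, for any labelling, that all dimensions are nonnegative.
\<close>

definition is_labelling :: "bow \<Rightarrow> nat \<Rightarrow> bool" where
  "is_labelling D r \<longleftrightarrow> r < len D \<and>
     (\<forall>j<num_arrows D. elts D ! ((r + j) mod len D) = Arrow) \<and>
     (\<forall>j<num_xpoints D. elts D ! ((r + num_arrows D + j) mod len D) = XPoint)"

definition label_dim :: "bow \<Rightarrow> nat \<Rightarrow> int \<Rightarrow> int" where
  "label_dim D r s = dims D ! nat ((int r + int (num_arrows D) - 1 - s) mod int (len D))"

definition susy_inequalities_at :: "bow \<Rightarrow> nat \<Rightarrow> bool" where
  "susy_inequalities_at D r \<longleftrightarrow>
     (let n = int (num_arrows D); w = int (num_xpoints D); v = label_dim D r in
      \<forall>s\<in>{0..n}. \<forall>k\<in>{0..w}. \<forall>t\<ge>1.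
        s * k + (t - 1) * (s * w + k * n) + ((t - 1) * (t - 2) div 2) * w * n
          + v s + v (- k) + (t - 1) * v (- w) - t * v 0 \<ge> 0 \<and>
        s * k + (t - 1) * (s * w + k * n) + ((t - 1) * (t - 2) div 2) * w * n
          + v (n - s) + v (- (w - k)) + (t - 1) * v 0 - t * v (- w) \<ge> 0)"

definition susy_inequalities :: "bow \<Rightarrow> bool" where
  "susy_inequalities D \<longleftrightarrow> (\<exists>r. is_labelling D r \<and> susy_inequalities_at D r)"


section \<open>Brane diagrams and supersymmetry\<close>

text \<open>
  An immersed D3-brane is a pair (i, l): it leaves the vertex i, runs anticlockwise through the
  l > 0 consecutive arcs i, i + 1, ..., i + l - 1 (modulo N), and ends at the vertex i + l. This
  traversal is a parametrization only; a fixed D3-brane is oriented from its NS5 end to its D5 end,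
  so it is anticlockwise if the vertex i is an NS5-brane and clockwise if it is a D5-brane.
\<close>

datatype fivebrane = NS5 | D5

record brane =
  vertices :: "fivebrane list"
  d3branes :: "(nat \<times> nat) multiset"

definition is_brane :: "brane \<Rightarrow> bool" where
  "is_brane B \<longleftrightarrow> vertices B \<noteq> [] \<and>
     (\<forall>(i, l)\<in>#d3branes B. i < length (vertices B) \<and> l > 0)"

definition d3_end :: "brane \<Rightarrow> nat \<times> nat \<Rightarrow> nat" where
  "d3_end B = (\<lambda>(i, l). (i + l) mod length (vertices B))"

definition winding :: "brane \<Rightarrow> nat \<times> nat \<Rightarrow> nat" where
  "winding B = (\<lambda>(i, l). l div length (vertices B))"

definition anticlockwise_d3 :: "brane \<Rightarrow> nat \<Rightarrow> nat \<Rightarrow> nat \<Rightarrow> (nat \<times> nat) multiset" where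
  "anticlockwise_d3 B p q t =
     {#c \<in># d3branes B. fst c = p \<and> d3_end B c = q \<and> winding B c = t#}"

definition clockwise_d3 :: "brane \<Rightarrow> nat \<Rightarrow> nat \<Rightarrow> nat \<Rightarrow> (nat \<times> nat) multiset" where
  "clockwise_d3 B p q t =
     {#c \<in># d3branes B. fst c = q \<and> d3_end B c = p \<and> winding B c = t#}"

definition supersymmetric_brane :: "brane \<Rightarrow> bool" where
  "supersymmetric_brane B \<longleftrightarrow>
     (\<forall>t. \<forall>p<length (vertices B). \<forall>q<length (vertices B).
        vertices B ! p = NS5 \<and> vertices B ! q = D5 \<longrightarrow>
        size (clockwise_d3 B p q t) \<le> 1 \<and> size (anticlockwise_d3 B p q t) \<le> 1)"

definition passes :: "brane \<Rightarrow> nat \<Rightarrow> nat \<times> nat \<Rightarrow> nat" where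
  "passes B j = (\<lambda>(i, l). card {m. m < l \<and> (i + m) mod length (vertices B) = j})"

definition bow_of_brane :: "brane \<Rightarrow> bow" where
  "bow_of_brane B =
     \<lparr>elts = map (\<lambda>x. case x of NS5 \<Rightarrow> Arrow | D5 \<Rightarrow> XPoint) (vertices B),
      dims = map (\<lambda>j. int (\<Sum>c\<in>#d3branes B. passes B j c)) [0..<length (vertices B)]\<rparr>"

definition supersymmetric :: "bow \<Rightarrow> bool" where
  "supersymmetric D \<longleftrightarrow> (\<exists>B. is_brane B \<and> supersymmetric_brane B \<and> bow_of_brane B = D)"


section \<open>Stratum condition\<close>

definition bow_subdiagram :: "bow \<Rightarrow> bow \<Rightarrow> bool" where
  "bow_subdiagram D' D \<longleftrightarrow>
     is_bow D' \<and> elts D' = elts D \<and> (\<forall>i<len D. dims D' ! i \<le> dims D ! i)"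

definition same_jumps :: "bow \<Rightarrow> bow \<Rightarrow> bool" where
  "same_jumps D' D \<longleftrightarrow>
     (\<forall>i<len D. elts D ! i = XPoint \<longrightarrow>
        dims D' ! (prv D i) - dims D' ! i = dims D ! (prv D i) - dims D ! i)"

definition stratum_condition :: "bow \<Rightarrow> bool" where
  "stratum_condition D \<longleftrightarrow>
     (\<forall>U. hw_equivalent D U \<and> separated U \<longrightarrow>
        (\<exists>U'. bow_subdiagram U' U \<and> supersymmetric U' \<and> same_jumps U' U \<and>
              (\<exists>V. hw_equivalent U' V \<and> balanced V)))"


section \<open>Bow varieties\<close>

text \<open>
  A point assigns a matrix to every position and every kind of linear map. Kinds that do not occur
  at a position get the unique 0 by 0 matrix, so that they carry no information.
\<close>

datatype kind = MC | MD | MA | MBminus | MBplus | Ma | Mb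

type_synonym point = "kind \<Rightarrow> nat \<Rightarrow> complex mat"

definition vdim :: "bow \<Rightarrow> nat \<Rightarrow> nat" where
  "vdim Q i = nat (dims Q ! i)"

definition shape :: "bow \<Rightarrow> kind \<Rightarrow> nat \<Rightarrow> nat \<times> nat" where
  "shape Q K i =
     (if i < len Q then
        (case (elts Q ! i, K) of
           (Arrow, MC) \<Rightarrow> (vdim Q i, vdim Q (prv Q i))
         | (Arrow, MD) \<Rightarrow> (vdim Q (prv Q i), vdim Q i)
         | (XPoint, MA) \<Rightarrow> (vdim Q i, vdim Q (prv Q i))
         | (XPoint, MBminus) \<Rightarrow> (vdim Q (prv Q i), vdim Q (prv Q i))
         | (XPoint, MBplus) \<Rightarrow> (vdim Q i, vdim Q i)
         | (XPoint, Ma) \<Rightarrow> (vdim Q i, 1)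
         | (XPoint, Mb) \<Rightarrow> (1, vdim Q (prv Q i))
         | _ \<Rightarrow> (0, 0))
      else (0, 0))"

definition is_subspace :: "nat \<Rightarrow> complex vec set \<Rightarrow> bool" where
  "is_subspace m W \<longleftrightarrow> subspace class_ring W (module_vec TYPE(complex) m)"

definition invariant_under :: "complex mat \<Rightarrow> complex vec set \<Rightarrow> bool" where
  "invariant_under M W \<longleftrightarrow> (\<forall>u\<in>W. M *\<^sub>v u \<in> W)"

definition triangle_conditions :: "bow \<Rightarrow> point \<Rightarrow> nat \<Rightarrow> bool" where
  "triangle_conditions Q z i \<longleftrightarrow>
     (let m = vdim Q (prv Q i); p = vdim Q i in
      z MBplus i * z MA i - z MA i * z MBminus i + z Ma i * z Mb i = 0\<^sub>m p m \<and>
      \<not> (\<exists>W. is_subspace m W \<and> W \<noteq> {0\<^sub>v m} \<and> invariant_under (z MBminus i) W \<and>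
           (\<forall>u\<in>W. z MA i *\<^sub>v u = 0\<^sub>v p \<and> z Mb i *\<^sub>v u = 0\<^sub>v 1)) \<and>
      \<not> (\<exists>W. is_subspace p W \<and> W \<noteq> carrier_vec p \<and> invariant_under (z MBplus i) W \<and>
           (\<forall>u\<in>carrier_vec m. \<forall>c\<in>carrier_vec 1. z MA i *\<^sub>v u + z Ma i *\<^sub>v c \<in> W)))"

definition Mtilde :: "bow \<Rightarrow> point set" where
  "Mtilde Q =
     {z. (\<forall>K i. z K i \<in> carrier_mat (fst (shape Q K i)) (snd (shape Q K i))) \<and>
         (\<forall>i<len Q. elts Q ! i = XPoint \<longrightarrow> triangle_conditions Q z i)}"

definition moment_map :: "bow \<Rightarrow> point \<Rightarrow> nat \<Rightarrow> complex mat" where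
  "moment_map Q z i =
     (let j = nxt Q i in
      (case elts Q ! i of Arrow \<Rightarrow> z MC i * z MD i | XPoint \<Rightarrow> - z MBplus i) +
      (case elts Q ! j of Arrow \<Rightarrow> - (z MD j * z MC j) | XPoint \<Rightarrow> z MBminus j))"

text \<open>
  Deformation and stability parameters are functions on segment indices of which only the values on
  the first segments of wavy lines are ever used.
\<close>

definition moment_fibre :: "bow \<Rightarrow> (nat \<Rightarrow> complex) \<Rightarrow> point set" where
  "moment_fibre Q lam =
     {z \<in> Mtilde Q. \<forall>i<len Q.
        moment_map Q z i = (if i \<in> wavy_lines Q then lam i else 0) \<cdot>\<^sub>m 1\<^sub>m (vdim Q i)}"

definition gauge_group :: "bow \<Rightarrow> (nat \<Rightarrow> complex mat) set" where
  "gauge_group Q = {g. \<forall>i<len Q. g i \<in> Units (ring_mat TYPE(complex) (vdim Q i) ())}"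

definition gauge_inv :: "bow \<Rightarrow> (nat \<Rightarrow> complex mat) \<Rightarrow> nat \<Rightarrow> complex mat" where
  "gauge_inv Q g i = inv\<^bsub>ring_mat TYPE(complex) (vdim Q i) ()\<^esub> (g i)"

definition base_change :: "bow \<Rightarrow> (nat \<Rightarrow> complex mat) \<Rightarrow> point \<Rightarrow> point" where
  "base_change Q g z = (\<lambda>K i.
     if i < len Q then
       (let gm = g (prv Q i); gp = g i; gm' = gauge_inv Q g (prv Q i); gp' = gauge_inv Q g i in
        case (elts Q ! i, K) of
          (Arrow, MC) \<Rightarrow> gp * z MC i * gm'
        | (Arrow, MD) \<Rightarrow> gm * z MD i * gp'
        | (XPoint, MA) \<Rightarrow> gp * z MA i * gm'
        | (XPoint, MBminus) \<Rightarrow> gm * z MBminus i * gm'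
        | (XPoint, MBplus) \<Rightarrow> gp * z MBplus i * gp'
        | (XPoint, Ma) \<Rightarrow> gp * z Ma i
        | (XPoint, Mb) \<Rightarrow> z Mb i * gm'
        | _ \<Rightarrow> z K i)
     else z K i)"

definition character :: "bow \<Rightarrow> (nat \<Rightarrow> int) \<Rightarrow> (nat \<Rightarrow> complex mat) \<Rightarrow> complex" where
  "character Q th g = (\<Prod>\<sigma>\<in>wavy_lines Q. det (g \<sigma>) powi (- th \<sigma>))"

text \<open>
  The space of triangles is locally closed, not closed, in a space of matrices, so a regular
  function is a function that is locally a quotient of polynomials in the matrix entries.
\<close>

inductive_set poly_fun :: "bow \<Rightarrow> (point \<Rightarrow> complex) set" for Q where
  const: "(\<lambda>_. c) \<in> poly_fun Q"
| coord: "\<lbrakk>r < fst (shape Q K i); s < snd (shape Q K i)\<rbrakk> \<Longrightarrow> (\<lambda>z. z K i $$ (r, s)) \<in> poly_fun Q"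
| add: "\<lbrakk>f \<in> poly_fun Q; h \<in> poly_fun Q\<rbrakk> \<Longrightarrow> (\<lambda>z. f z + h z) \<in> poly_fun Q"
| mult: "\<lbrakk>f \<in> poly_fun Q; h \<in> poly_fun Q\<rbrakk> \<Longrightarrow> (\<lambda>z. f z * h z) \<in> poly_fun Q"

definition regular_fun :: "bow \<Rightarrow> point set \<Rightarrow> (point \<Rightarrow> complex) set" where
  "regular_fun Q X =
     {f. (\<forall>z. z \<notin> X \<longrightarrow> f z = 0) \<and>
         (\<forall>z\<in>X. \<exists>p\<in>poly_fun Q. \<exists>q\<in>poly_fun Q.
            q z \<noteq> 0 \<and> (\<forall>y\<in>X. q y \<noteq> 0 \<longrightarrow> f y = p y / q y))}"

definition semi_invariants ::
  "bow \<Rightarrow> point set \<Rightarrow> (nat \<Rightarrow> int) \<Rightarrow> nat \<Rightarrow> (point \<Rightarrow> complex) set" where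
  "semi_invariants Q X th k =
     {f \<in> regular_fun Q X.
        \<forall>g\<in>gauge_group Q. \<forall>z\<in>X. f (base_change Q g z) = character Q th g ^ k * f z}"

text \<open>
  Points of Proj of the graded ring with pieces R k: homogeneous prime ideals, given by their graded
  pieces P k, that do not contain the irrelevant ideal. All pieces consist of functions on one and
  the same set, and multiplication is pointwise.
\<close>

definition Proj :: "(nat \<Rightarrow> ('a \<Rightarrow> complex) set) \<Rightarrow> (nat \<Rightarrow> ('a \<Rightarrow> complex) set) set" where
  "Proj R =
     {P. (\<forall>k. P k \<subseteq> R k \<and> (\<lambda>_. 0) \<in> P k \<and> (\<forall>f\<in>P k. \<forall>h\<in>P k. (\<lambda>z. f z + h z) \<in> P k)) \<and>
         (\<forall>k l. \<forall>f\<in>R k. \<forall>h\<in>P l. (\<lambda>z. f z * h z) \<in> P (k + l)) \<and>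
         (\<forall>k l. \<forall>f\<in>R k. \<forall>h\<in>R l. (\<lambda>z. f z * h z) \<in> P (k + l) \<longrightarrow> f \<in> P k \<or> h \<in> P l) \<and>
         (\<exists>k>0. \<not> R k \<subseteq> P k)}"

text \<open>The bow variety, as the set of points of the GIT quotient.\<close>

definition bow_variety ::
  "bow \<Rightarrow> (nat \<Rightarrow> complex) \<Rightarrow> (nat \<Rightarrow> int) \<Rightarrow> (nat \<Rightarrow> (point \<Rightarrow> complex) set) set" where
  "bow_variety Q lam th =
     (if \<exists>i<len Q. dims Q ! i < 0 then {}
      else Proj (semi_invariants Q (moment_fibre Q lam) th))"

end

theory Submission
  imports Defs "Jordan_Normal_Form.Spectral_Radius"
begin

text \<open>
  All conditions are compared with one combinatorial condition, \<open>always_originates\<close>: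
  no sequence of Hanany--Witten transitions produces a negative dimension.

  Unroll the circle. A diagram with n arrows and w x-points, both present, becomes a lattice path
  in \<int> \<times> \<int> that makes a unit step in the first direction at an arrow and in the
  second direction at an x-point, and that is invariant under translation by (n, w). The segments
  are the lattice points of the path. A transition replaces one corner of the path by the opposite
  corner of a unit square, and its rule for the dimensions says that they extend to a function d
  on \<int> \<times> \<int>, the surface, with d(i + 1, j + 1) - d(i + 1, j) - d(i, j + 1) + d(i,
  j) = -1, which no transition changes. Periodic paths are connected by such flips and every
  lattice point lies on one of them. So a class of diagrams is a surface, and
  \<open>always_originates\<close> says that the surface is nonnegative. The supersymmetry
  inequalities of a separated diagram are exactly the values of d, written in terms of the values
  on one path.

  The key step (\<open>nonneg_surface_decomposition\<close>) is about a nonnegative surface.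
  Subtract from d the minimum F(i) of each column and then the minimum G(j) of each row. By the
  sign of the mixed difference the zeros of the remainder form a lattice path q, so the diagram of
  q has dimensions F(i) + G(j): it is decomposable. Such a diagram is as simple as possible. It is
  carried by D3-branes that join consecutive NS5-branes or consecutive D5-branes, and its moment
  map equations are solved by explicit nilpotent shift matrices. Both properties travel back along
  transitions: moving the ends of D3-branes and creating or destroying one fixed brane transforms
  supersymmetric brane diagrams (\<open>supersymmetric_hw_transition\<close>), and replacing the
  space in the middle by a kernel or cokernel transforms points of moment map fibres
  (\<open>hw_transition_fibre\<close>). Conversely both properties imply that the dimensions at
  hand are nonnegative, hence all those in the class. For the stratum condition, d - F is a
  nonnegative surface that is balanced on q, and adding to a surface a nonnegative function of i
  keeps it nonnegative.

  Passing from points to the quotient is formal: for trivial stability the functions that vanish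
  at a point of the fibre form a homogeneous prime ideal, and an empty fibre has no nonzero
  functions at all. Diagrams with only arrows or only x-points have no transitions and are treated
  directly.
\<close>

section \<open>Sequences indexed by the integers\<close>

lemma int_step_constant:
  fixes h :: "int \<Rightarrow> 'a"
  assumes "\<And>k. h k = h (k - 1)"
  shows "h k = h l"
proof -
  have "h k = h 0" for k
  proof (induction k rule: int_induct[where k = 0])
    case (step1 i) then show ?case using assms[of "i + 1"] by simp
  next
    case (step2 i) then show ?case using assms[of i] by simp
  qed simp
  then show ?thesis by metis
qed

lemma int_antidifference:
  fixes \<phi> :: "int \<Rightarrow> int"
  obtains F where "\<And>k. F k = F (k - 1) + \<phi> k"
proof -
  define F where "F k = sum \<phi> {1..k} - sum \<phi> {k+1..0}" for k :: int
  have "F k = F (k - 1) + \<phi> k" for k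
  proof (cases "k \<ge> 1")
    case True
    then have "{1..k} = insert k {1..k-1}" "{k+1..0} = {}" "{k-1+1..0} = {}" by auto
    then show ?thesis by (simp add: F_def)
  next
    case False
    then have "{k..0} = insert k {k+1..0}" "{1..k} = {}" "{1..k-1} = {}" by auto
    then show ?thesis by (simp add: F_def)
  qed
  then show ?thesis using that by blast
qed

lemma periodic_mult:
  fixes f :: "int \<Rightarrow> 'a" and N :: int
  assumes "\<And>x. f (x + N) = f x"
  shows "f (x + N * m) = f x"
proof (induction m rule: int_induct[where k = 0])
  case (step1 i) then show ?case using assms[of "x + N * i"] by (simp add: algebra_simps)
next
  case (step2 i) then show ?case using assms[of "x + N * (i - 1)"] by (simp add: algebra_simps)
qed simp

lemma periodic_mod:
  fixes f :: "int \<Rightarrow> 'a"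
  assumes "\<And>x. f (x + N) = f x"
  shows "f (x mod N) = f x"
  using periodic_mult[of f N, OF assms, of "x mod N" "x div N"] by (simp add: add.commute)

lemma periodic_dvd:
  fixes f :: "int \<Rightarrow> 'a"
  assumes "\<And>x. f (x + N) = f x" "N dvd x - y"
  shows "f x = f y"
proof -
  obtain m where "x = y + N * m" using assms(2) by (metis dvdE add.commute diff_add_cancel)
  then show ?thesis using periodic_mult[of f N, OF assms(1)] by simp
qed

section \<open>Bow diagrams as lattice paths on a surface\<close>

definition element_at :: "(int \<Rightarrow> int) \<Rightarrow> int \<Rightarrow> element" where
  "element_at p x = (if p x = p (x - 1) then XPoint else Arrow)"

definition dim_at :: "(int \<Rightarrow> int \<Rightarrow> int) \<Rightarrow> (int \<Rightarrow> int) \<Rightarrow> int \<Rightarrow> int" where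
  "dim_at d p x = d (p x) (x - p x)"

text \<open>
  A path p is described by the first coordinate of its point on each antidiagonal: the point with
  coordinate sum k is (p k, k - p k), and it stands for segment k of the unrolled circle.
\<close>

locale periodic_lattice =
  fixes n w :: nat
  assumes n_pos: "n \<ge> 1" and w_pos: "w \<ge> 1"
begin

abbreviation N :: int where "N \<equiv> int (n + w)"

lemma N_ge_2: "N \<ge> 2" using n_pos w_pos by linarith

definition lattice_path :: "(int \<Rightarrow> int) \<Rightarrow> bool" where
  "lattice_path p \<longleftrightarrow> (\<forall>k. p k = p (k - 1) \<or> p k = p (k - 1) + 1) \<and> (\<forall>k. p (k + N) = p k + int n)"

definition surface :: "(int \<Rightarrow> int \<Rightarrow> int) \<Rightarrow> bool" where
  "surface d \<longleftrightarrow>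
     (\<forall>i j. d (i + 1) (j + 1) = d (i + 1) j + d i (j + 1) - d i j - 1) \<and>
     (\<forall>i j. d (i + int n) (j + int w) = d i j)"

definition bow_on :: "(int \<Rightarrow> int \<Rightarrow> int) \<Rightarrow> (int \<Rightarrow> int) \<Rightarrow> bow" where
  "bow_on d p = \<lparr>elts = map (\<lambda>k. element_at p (int k)) [0..<n + w],
                 dims = map (\<lambda>k. dim_at d p (int k)) [0..<n + w]\<rparr>"

lemma path_step: "lattice_path p \<Longrightarrow> p k = p (k - 1) \<or> p k = p (k - 1) + 1"
  by (simp add: lattice_path_def)

lemma path_period: "lattice_path p \<Longrightarrow> p (k + N) = p k + int n"
  by (simp add: lattice_path_def)

lemma element_at_period: "lattice_path p \<Longrightarrow> element_at p (x + N) = element_at p x"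
  using path_period[of p x] path_period[of p "x - 1"] by (simp add: element_at_def algebra_simps)

lemma dim_at_period: "\<lbrakk>lattice_path p; surface d\<rbrakk> \<Longrightarrow> dim_at d p (x + N) = dim_at d p x"
  proof -
  assume "lattice_path p" "surface d"
  moreover have "x + N - (p x + int n) = x - p x + int w" by simp
  ultimately show ?thesis unfolding dim_at_def surface_def by (simp only: path_period)
qed

lemma len_bow_on [simp]: "len (bow_on d p) = n + w"
  by (simp add: len_def bow_on_def)

lemma int_nxt: "int (nxt (bow_on d p) i) = (int i + 1) mod N"
  by (simp add: nxt_def of_nat_mod add.commute)

lemma int_prv: "int (prv (bow_on d p) i) = (int i - 1) mod N"
proof -
  have "int (i + (n + w) - 1) = int i - 1 + N" using n_pos by simp
  then show ?thesis by (simp add: prv_def of_nat_mod del: of_nat_add)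
qed

lemma nxt_less: "nxt (bow_on d p) i < n + w" and prv_less: "prv (bow_on d p) i < n + w"
  using n_pos by (simp_all add: nxt_def prv_def)

lemma elts_bow_on [simp]: "i < n + w \<Longrightarrow> elts (bow_on d p) ! i = element_at p (int i)"
  and dims_bow_on [simp]: "i < n + w \<Longrightarrow> dims (bow_on d p) ! i = dim_at d p (int i)"
  by (simp_all add: bow_on_def)

lemma elts_bow_on_mod: "\<lbrakk>lattice_path p; i < n + w; int i = x mod N\<rbrakk> \<Longrightarrow> elts (bow_on d p) ! i = element_at p x"
  using periodic_mod[of "element_at p" N x] element_at_period by simp

lemma dims_bow_on_mod:
  "\<lbrakk>lattice_path p; surface d; i < n + w; int i = x mod N\<rbrakk> \<Longrightarrow> dims (bow_on d p) ! i = dim_at d p x"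
  using periodic_mod[of "dim_at d p" N x] dim_at_period by simp

lemma
  assumes p: "lattice_path p"
  shows elts_nxt: "elts (bow_on d p) ! nxt (bow_on d p) i = element_at p (int i + 1)"
  by (rule elts_bow_on_mod[OF p nxt_less int_nxt])

lemma
  assumes p: "lattice_path p" and d: "surface d"
  shows dims_nxt: "dims (bow_on d p) ! nxt (bow_on d p) i = dim_at d p (int i + 1)"
    and dims_prv: "dims (bow_on d p) ! prv (bow_on d p) i = dim_at d p (int i - 1)"
  by (rule dims_bow_on_mod[OF p d nxt_less int_nxt] dims_bow_on_mod[OF p d prv_less int_prv])+

text \<open>
  All translates of the corner k are flipped at once. The formula for the new corner covers both
  kinds of corners.
\<close>

definition flip :: "(int \<Rightarrow> int) \<Rightarrow> int \<Rightarrow> int \<Rightarrow> int" where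
  "flip p k x = (if N dvd x - k then p (x - 1) + p (x + 1) - p x else p x)"

lemma dvd_imp_not_dvd_pred: "N dvd x - k \<Longrightarrow> \<not> N dvd x - 1 - k"
proof
  assume "N dvd x - k" "N dvd x - 1 - k"
  then have "N dvd (x - k) - (x - 1 - k)" by (rule dvd_diff)
  then show False using N_ge_2 zdvd_imp_le[of N 1] by simp
qed

text \<open>
  The only steps that change are the two at a corner, and they are exchanged. Since N \<ge> 2, the
  corners being flipped are not adjacent.
\<close>

lemma flip_step:
  "flip p k x - flip p k (x - 1) =
     (if N dvd x - k then p (x + 1) - p x else if N dvd x - 1 - k then p (x - 1) - p (x - 2) else p x - p (x - 1))"
  using dvd_imp_not_dvd_pred[of x k] by (auto simp: flip_def)

lemma flip_path: assumes "lattice_path p" shows "lattice_path (flip p k)"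
  unfolding lattice_path_def
proof (intro conjI allI)
  fix x
  show "flip p k x = flip p k (x - 1) \<or> flip p k x = flip p k (x - 1) + 1"
    using flip_step[of p k x] path_step[OF assms, of x] path_step[OF assms, of "x + 1"]
      path_step[OF assms, of "x - 1"] by (auto split: if_splits)
  have "N dvd x + N - k \<longleftrightarrow> N dvd x - k"
    by (metis add_diff_eq add.commute dvd_add_triv_left_iff diff_add_eq)
  then show "flip p k (x + N) = flip p k x + int n"
    using path_period[OF assms, of x] path_period[OF assms, of "x + 1"] path_period[OF assms, of "x - 1"]
    by (simp add: flip_def algebra_simps)
qed

lemma element_at_flip:
  assumes "lattice_path p"
  shows "element_at (flip p k) x =
    (if N dvd x - k then element_at p (k + 1) else if N dvd x - 1 - k then element_at p k else element_at p x)"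
proof -
  have 1: "element_at p (x + 1) = element_at p (k + 1)" if "N dvd x - k"
    using periodic_dvd[of "element_at p" N "x + 1" "k + 1"] element_at_period[OF assms] that by simp
  have 2: "element_at p (x - 1) = element_at p k" if "N dvd x - 1 - k"
    using periodic_dvd[of "element_at p" N "x - 1" k] element_at_period[OF assms] that by simp
  show ?thesis
    using flip_step[of p k x] 1 2 by (auto simp: element_at_def split: if_splits)
qed

lemma dvd_residue: "\<lbrakk>0 \<le> x; x < N; 0 \<le> y; y < N\<rbrakk> \<Longrightarrow> N dvd x - y \<longleftrightarrow> x = y"
  by (metis mod_eq_dvd_iff mod_pos_pos_trivial)

text \<open>
  This is the mixed difference equation of the surface, solved for the corner that appears.
\<close>

lemma dim_at_flip:
  assumes "lattice_path p" "surface d" "element_at p k \<noteq> element_at p (k + 1)"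
  shows "dim_at d (flip p k) k = dim_at d p (k - 1) + dim_at d p (k + 1) - dim_at d p k + 1"
proof -
  have m: "d (i + 1) (j + 1) = d (i + 1) j + d i (j + 1) - d i j - 1" for i j
    using assms(2) by (simp add: surface_def)
  have f: "flip p k k = p (k - 1) + p (k + 1) - p k" by (simp add: flip_def)
  have "p k = p (k - 1) \<and> p (k + 1) = p k + 1 \<or> p k = p (k - 1) + 1 \<and> p (k + 1) = p k"
    using assms(3) path_step[OF assms(1), of k] path_step[OF assms(1), of "k + 1"]
    by (auto simp: element_at_def split: if_splits)
  then show ?thesis
  proof
    assume a: "p k = p (k - 1) \<and> p (k + 1) = p k + 1"
    then have p: "p (k - 1) = p k" "p (k + 1) = p k + 1" by auto
    show ?thesis unfolding dim_at_def f p using m[of "p k" "k - 1 - p k"] by (simp add: diff_diff_eq add.commute)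
  next
    assume a: "p k = p (k - 1) + 1 \<and> p (k + 1) = p k"
    then have p: "p (k - 1) = p k - 1" "p (k + 1) = p k" by auto
    show ?thesis unfolding dim_at_def f p using m[of "p k - 1" "k - p k"] by (simp add: algebra_simps)
  qed
qed

text \<open>
  The rotation of the list stays put while the path is flipped, so a flip at the last segment
  needs no special case: the first coordinate of the path does not have to start at 0.
\<close>

lemma bow_on_flip:
  assumes p: "lattice_path p" and d: "surface d" and i: "i < n + w"
    and ne: "element_at p (int i) \<noteq> element_at p (int i + 1)"
  defines "D \<equiv> bow_on d p"
  shows "bow_on d (flip p (int i)) =
     \<lparr>elts = (elts D)[i := elts D ! (nxt D i), nxt D i := elts D ! i],
      dims = (dims D)[i := dims D ! (prv D i) + dims D ! (nxt D i) - dims D ! i + 1]\<rparr>"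
proof -
  have j: "nxt D i < n + w" by (simp add: D_def nxt_less)
  have eqj: "N dvd int m - 1 - int i \<longleftrightarrow> m = nxt D i" if "m < n + w" for m
  proof -
    have "int m = int (nxt D i) \<longleftrightarrow> int m mod N = (int i + 1) mod N" using that by (simp add: D_def int_nxt)
    also have "\<dots> \<longleftrightarrow> N dvd int m - 1 - int i" by (simp add: mod_eq_dvd_iff algebra_simps)
    finally show ?thesis by simp
  qed
  have eqi: "N dvd int m - int i \<longleftrightarrow> m = i" if "m < n + w" for m
    using dvd_residue[of "int m" "int i"] that i by simp
  have ij: "nxt D i \<noteq> i"
    using eqj[OF i] N_ge_2 zdvd_imp_le[of N 1] by auto
  have "elts (bow_on d (flip p (int i))) = (elts D)[i := elts D ! (nxt D i), nxt D i := elts D ! i]"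
  proof (rule nth_equalityI)
    fix m assume "m < length (elts (bow_on d (flip p (int i))))"
    then have m: "m < n + w" by (simp add: bow_on_def)
    have L: "length (elts D) = n + w" by (simp add: D_def bow_on_def)
    show "elts (bow_on d (flip p (int i))) ! m = (elts D)[i := elts D ! (nxt D i), nxt D i := elts D ! i] ! m"
      using m i j ij eqi[OF m] eqj[OF m] elts_nxt[OF p] 
      by (auto simp: element_at_flip[OF p] nth_list_update L[unfolded D_def] D_def)
  qed (simp add: bow_on_def D_def)
  moreover have "dims (bow_on d (flip p (int i))) = (dims D)[i := dims D ! (prv D i) + dims D ! (nxt D i) - dims D ! i + 1]"
  proof (rule nth_equalityI)
    fix m assume "m < length (dims (bow_on d (flip p (int i))))"
    then have m: "m < n + w" by (simp add: bow_on_def)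
    have L: "length (dims D) = n + w" by (simp add: D_def bow_on_def)
    have "dim_at d (flip p (int i)) (int m) = dim_at d p (int m)" if "m \<noteq> i"
      using that eqi[OF m] by (simp add: dim_at_def flip_def)
    then show "dims (bow_on d (flip p (int i))) ! m = (dims D)[i := dims D ! (prv D i) + dims D ! (nxt D i) - dims D ! i + 1] ! m"
      using m i ne dims_nxt[OF p d] dims_prv[OF p d] dim_at_flip[OF p d, of "int i"]
      by (cases "m = i") (auto simp: nth_list_update L[unfolded D_def] D_def)
  qed (simp add: bow_on_def D_def)
  ultimately show ?thesis by (metis bow.surjective unit.exhaust bow.simps(1,2) old.unit.exhaust)
qed

lemma hw_transition_bow_on_iff:
  assumes p: "lattice_path p" and d: "surface d"
  shows "hw_transition (bow_on d p) U \<longleftrightarrow>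
    (\<exists>i<n + w. element_at p (int i) \<noteq> element_at p (int i + 1) \<and> U = bow_on d (flip p (int i)))"
  unfolding hw_transition_def len_bow_on
  using bow_on_flip[OF p d] elts_nxt[OF p] by (intro ex_cong1) auto

lemma hw_equivalent_stays_on_surface:
  assumes "hw_equivalent (bow_on d p) U" "lattice_path p" "surface d"
  shows "\<exists>q. lattice_path q \<and> U = bow_on d q"
  using assms(1) unfolding hw_equivalent_def
proof (induction rule: rtranclp_induct)
  case base then show ?case using assms(2) by blast
next
  case (step Y Z)
  then show ?case using hw_transition_bow_on_iff[OF _ assms(3)] flip_path by blast
qed

end

section \<open>Paths on a surface are connected by transitions\<close>

lemma hw_transition_sym:
  assumes "is_bow D" "hw_transition D E"
  shows "hw_transition E D" "is_bow E"
proof -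
  obtain i where i: "i < len D" and ne: "elts D ! i \<noteq> elts D ! (nxt D i)"
    and E: "E = \<lparr>elts = (elts D)[i := elts D ! (nxt D i), nxt D i := elts D ! i],
              dims = (dims D)[i := dims D ! (prv D i) + dims D ! (nxt D i) - dims D ! i + 1]\<rparr>"
    using assms(2) unfolding hw_transition_def by blast
  have L: "length (elts D) = len D" "length (dims D) = len D" "len D > 0"
    using assms(1) by (auto simp: is_bow_def len_def)
  have lE: "len E = len D" by (simp add: E len_def)
  have eE: "elts E = (elts D)[i := elts D ! (nxt D i), nxt D i := elts D ! i]"
    and dE: "dims E = (dims D)[i := dims D ! (prv D i) + dims D ! (nxt D i) - dims D ! i + 1]"
    by (simp_all add: E)
  have n: "nxt E = nxt D" and p: "prv E = prv D" by (rule ext, simp add: nxt_def prv_def lE)+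
  have j: "nxt D i < len D" "prv D i < len D" using L by (simp_all add: nxt_def prv_def)
  have ij: "nxt D i \<noteq> i" using ne by auto
  have "len D \<noteq> 1" using ij i by (auto simp: nxt_def)
  then have pi: "prv D i \<noteq> i"
  proof -
    assume "len D \<noteq> 1"
    then have "len D \<ge> 2" using L by linarith
    then show ?thesis using i by (cases "i = 0") (auto simp: prv_def mod_if)
  qed
  have 1: "elts D = (elts E)[i := elts E ! (nxt E i), nxt E i := elts E ! i]"
    unfolding n eE using i j ij L by (auto intro!: nth_equalityI simp: nth_list_update)
  have 2: "dims D = (dims E)[i := dims E ! (prv E i) + dims E ! (nxt E i) - dims E ! i + 1]"
    unfolding n p dE using i j ij pi L by (auto intro!: nth_equalityI simp: nth_list_update)
  have "elts E ! i \<noteq> elts E ! nxt E i"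
    using ne i j ij L unfolding n eE by (auto simp: nth_list_update)
  moreover have "D = \<lparr>elts = (elts E)[i := elts E ! (nxt E i), nxt E i := elts E ! i],
     dims = (dims E)[i := dims E ! (prv E i) + dims E ! (nxt E i) - dims E ! i + 1]\<rparr>"
    using 1 2 by (cases D) simp
  ultimately show "hw_transition E D" unfolding hw_transition_def using i lE by auto
  show "is_bow E" using assms(1) by (simp add: is_bow_def E)
qed

lemma hw_equivalent_sym:
  assumes "is_bow D" "hw_equivalent D E"
  shows "hw_equivalent E D" "is_bow E"
proof -
  have "hw_equivalent E D \<and> is_bow E" using assms(2) unfolding hw_equivalent_def
  proof (induction rule: rtranclp_induct)
    case (step Y Z)
    then show ?case using hw_transition_sym[of Y Z] by (meson converse_rtranclp_into_rtranclp)
  qed (use assms in auto)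
  then show "hw_equivalent E D" "is_bow E" by auto
qed

lemma hw_equivalent_trans: "\<lbrakk>hw_equivalent D E; hw_equivalent E F\<rbrakk> \<Longrightarrow> hw_equivalent D F"
  unfolding hw_equivalent_def by simp

context periodic_lattice
begin

lemma is_bow_on: "is_bow (bow_on d p)"
  using n_pos by (auto simp: is_bow_def bow_on_def)

lemma gap_period:
  "\<lbrakk>lattice_path p; lattice_path q\<rbrakk> \<Longrightarrow> q (x + N) - p (x + N) = q x - p x"
  by (simp add: path_period del: of_nat_add)

text \<open>
  Look at the points where q exceeds p most. Moving to the right from such a point while p makes
  no step keeps the excess maximal, and so does moving to the left while p makes steps. Both
  movements end because p is periodic and makes steps of both kinds, and where they end p has a
  corner.
\<close>

lemma upward_corner_below:
  assumes p: "lattice_path p" and q: "lattice_path q" and le: "\<And>x. p x \<le> q x" and ne: "p \<noteq> q"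
  obtains i where "i < n + w" "p (int i) = p (int i - 1)" "p (int i + 1) = p (int i) + 1" "p (int i) < q (int i)"
proof -
  define u where "u x = q x - p x" for x
  have per: "u (x + N) = u x" for x using gap_period[OF p q] by (simp add: u_def del: of_nat_add)
  define M where "M = Max (u ` {0..<N})"
  have fin: "finite (u ` {0..<N})" "u ` {0..<N} \<noteq> {}" using N_ge_2 by auto
  have uM: "u x \<le> M" for x
  proof -
    have "u x = u (x mod N)" using periodic_mod[of u N x] per by simp
    moreover have "x mod N \<in> {0..<N}" using N_ge_2 by simp
    ultimately show ?thesis unfolding M_def using fin by (metis Max_ge image_eqI)
  qed
  obtain x0 where x0: "u x0 = M" using Max_in[OF fin] unfolding M_def by force
  have Mpos: "M > 0"
  proof -
    obtain y where "p y \<noteq> q y" using ne by blast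
    then have "u y > 0" using le[of y] by (simp add: u_def)
    then show ?thesis using uM[of y] by linarith
  qed
  have "\<exists>k. u k = M \<and> p (k + 1) = p k + 1"
  proof (rule ccontr)
    assume H: "\<nexists>k. u k = M \<and> p (k + 1) = p k + 1"
    have "u (x0 + int m) = M \<and> p (x0 + int m) = p x0" for m
    proof (induction m)
      case (Suc m)
      define k where "k = x0 + int m"
      have k: "u k = M" "p k = p x0" using Suc by (auto simp: k_def)
      have st: "p (k + 1) = p k" using H k path_step[OF p, of "k + 1"] by auto
      then have "u (k + 1) \<ge> u k" using path_step[OF q, of "k + 1"] by (auto simp: u_def)
      then have "u (k + 1) = M" using uM[of "k + 1"] k by simp
      then show ?case using st k by (simp add: k_def algebra_simps)
    qed (simp add: x0)
    from this[of "n + w"] path_period[OF p, of x0] n_pos show False by simp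
  qed
  then obtain k1 where k1: "u k1 = M" "p (k1 + 1) = p k1 + 1" by blast
  have "\<exists>k. u k = M \<and> p k = p (k - 1) \<and> p (k + 1) = p k + 1"
  proof (rule ccontr)
    assume H: "\<nexists>k. u k = M \<and> p k = p (k - 1) \<and> p (k + 1) = p k + 1"
    have "u (k1 - int m) = M \<and> p (k1 - int m) = p k1 - int m \<and> p (k1 - int m + 1) = p (k1 - int m) + 1" for m
    proof (induction m)
      case (Suc m)
      define k where "k = k1 - int m"
      have k: "u k = M" "p k = p k1 - int m" "p (k + 1) = p k + 1" using Suc by (auto simp: k_def)
      have st: "p k = p (k - 1) + 1" using H k path_step[OF p, of k] by auto
      then have "u (k - 1) \<ge> u k" using path_step[OF q, of k] by (auto simp: u_def)
      then have "u (k - 1) = M" using uM[of "k - 1"] k by simp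
      moreover have "k1 - int (Suc m) = k - 1" by (simp add: k_def)
      moreover have "p (k - 1) = p k1 - int (Suc m) \<and> p (k - 1 + 1) = p (k - 1) + 1" using st k by simp
      ultimately show ?case by (simp only: simp_thms)
    qed (simp add: k1)
    from this[of "n + w"] path_period[OF p, of "k1 - N"] w_pos show False by simp
  qed
  then obtain k where k: "u k = M" "p k = p (k - 1)" "p (k + 1) = p k + 1" by blast
  define i where "i = nat (k mod N)"
  have i: "int i = k mod N" "i < n + w" using N_ge_2 by (auto simp: i_def nat_less_iff)
  have dv: "N dvd int i - k" using i(1) mod_eq_dvd_iff by (metis mod_mod_trivial)
  have s1: "p (x + N) - p (x + N - 1) = p x - p (x - 1)" for x
    using path_period[OF p, of x] path_period[OF p, of "x - 1"] by (simp add: algebra_simps)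
  have "p (int i) - p (int i - 1) = p k - p (k - 1)"
    using periodic_dvd[of "\<lambda>x. p x - p (x - 1)" N "int i" k] s1 dv by simp
  moreover have "p (int i + 1) - p (int i) = p (k + 1) - p k"
    using periodic_dvd[of "\<lambda>x. p x - p (x - 1)" N "int i + 1" "k + 1"] s1 dv by simp
  moreover have "u (int i) = u k" using periodic_dvd[of u N "int i" k] per dv by simp
  ultimately show ?thesis using that[of i] i k Mpos by (simp add: u_def)
qed

text \<open>
  Each flip of a corner that lies below q lowers the area between the paths by one.
\<close>

lemma hw_equivalent_upward:
  assumes d: "surface d" and "lattice_path p" and q: "lattice_path q" and "\<And>x. p x \<le> q x"
  shows "hw_equivalent (bow_on d p) (bow_on d q)"
  using assms(2,4)
proof (induction "nat (\<Sum>x\<in>{0..<N}. q x - p x)" arbitrary: p rule: less_induct)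
  case less
  note p = less.prems(1) and le = less.prems(2)
  show ?case
  proof (cases "p = q")
    case True then show ?thesis by (simp add: hw_equivalent_def)
  next
    case False
    obtain i where i: "i < n + w" and s: "p (int i) = p (int i - 1)" "p (int i + 1) = p (int i) + 1"
      and lt: "p (int i) < q (int i)" using upward_corner_below[OF p q le False] by blast
    define p' where "p' = flip p (int i)"
    have p': "lattice_path p'" unfolding p'_def by (rule flip_path[OF p])
    have val: "p' x = (if N dvd x - int i then p x + 1 else p x)" for x
    proof -
      have s1: "p (x + N) - p (x + N - 1) = p x - p (x - 1)" for x
        using path_period[OF p, of x] path_period[OF p, of "x - 1"] by (simp add: algebra_simps)
      have "p x - p (x - 1) = 0" "p (x + 1) - p x = 1" if "N dvd x - int i"
        using periodic_dvd[of "\<lambda>x. p x - p (x - 1)" N x "int i"] s1 that s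
          periodic_dvd[of "\<lambda>x. p x - p (x - 1)" N "x + 1" "int i + 1"] by auto
      then show ?thesis by (auto simp: p'_def flip_def)
    qed
    have le': "p' x \<le> q x" for x
    proof (cases "N dvd x - int i")
      case True
      have "q x - p x = q (int i) - p (int i)"
        using periodic_dvd[of "\<lambda>x. q x - p x" N x "int i"] gap_period[OF p q] True by simp
      then show ?thesis using lt by (simp add: val)
    qed (simp add: val le)
    have "(\<Sum>x\<in>{0..<N}. q x - p' x) = (\<Sum>x\<in>{0..<N}. (q x - p x) - (if x = int i then 1 else 0))"
      using dvd_residue i by (intro sum.cong) (auto simp: val)
    also have "\<dots> = (\<Sum>x\<in>{0..<N}. q x - p x) - 1" using i by (simp add: sum_subtractf)
    finally have "(\<Sum>x\<in>{0..<N}. q x - p' x) < (\<Sum>x\<in>{0..<N}. q x - p x)" by simp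
    moreover have "0 \<le> (\<Sum>x\<in>{0..<N}. q x - p' x)" using le' by (simp add: sum_nonneg)
    ultimately have "hw_equivalent (bow_on d p') (bow_on d q)"
      using less.hyps[OF _ p' le'] by (simp del: of_nat_add)
    moreover have "hw_transition (bow_on d p) (bow_on d p')"
      unfolding hw_transition_bow_on_iff[OF p d] p'_def using i s by (intro exI[of _ i]) (simp add: element_at_def)
    ultimately show ?thesis by (simp add: hw_equivalent_def)
  qed
qed

lemma lattice_path_max:
  assumes "lattice_path p" "lattice_path q"
  shows "lattice_path (\<lambda>x. max (p x) (q x))"
  unfolding lattice_path_def
proof (intro conjI allI)
  fix k
  show "max (p k) (q k) = max (p (k - 1)) (q (k - 1)) \<or> max (p k) (q k) = max (p (k - 1)) (q (k - 1)) + 1"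
    using path_step[OF assms(1), of k] path_step[OF assms(2), of k] by linarith
  show "max (p (k + N)) (q (k + N)) = max (p k) (q k) + int n"
    using path_period[OF assms(1), of k] path_period[OF assms(2), of k] by linarith
qed

text \<open>
  Both paths can be raised to their pointwise maximum.
\<close>

lemma hw_equivalent_bow_on:
  assumes d: "surface d" and p: "lattice_path p" and q: "lattice_path q"
  shows "hw_equivalent (bow_on d p) (bow_on d q)"
proof -
  note m = lattice_path_max[OF p q]
  have "hw_equivalent (bow_on d p) (bow_on d (\<lambda>x. max (p x) (q x)))"
    by (rule hw_equivalent_upward[OF d p m]) simp
  moreover have "hw_equivalent (bow_on d q) (bow_on d (\<lambda>x. max (p x) (q x)))"
    by (rule hw_equivalent_upward[OF d q m]) simp
  ultimately show ?thesis using hw_equivalent_sym[OF is_bow_on] hw_equivalent_trans by blast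
qed

text \<open>
  The digital line of slope n / (n + w), translated.
\<close>

lemma path_through:
  obtains p where "lattice_path p" "p (i + j) = i"
proof
  define q where "q x = (x * int n) div N" for x
  let ?p = "\<lambda>x. q (x - (i + j)) + i"
  have step: "q x = q (x - 1) \<or> q x = q (x - 1) + 1" for x
  proof -
    have e: "x * int n = (x - 1) * int n + int n" by (simp add: algebra_simps)
    have "q x \<ge> q (x - 1)" unfolding q_def by (rule zdiv_mono1) (use e N_ge_2 in auto)
    moreover have "q x \<le> ((x - 1) * int n + N) div N" unfolding q_def by (rule zdiv_mono1) (use e N_ge_2 in auto)
    moreover have "((x - 1) * int n + N) div N = q (x - 1) + 1" unfolding q_def using N_ge_2 by (subst div_add_self2) auto
    ultimately show ?thesis by linarith
  qed
  have per: "q (x + N) = q x + int n" for x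
  proof -
    have "(x + N) * int n = x * int n + int n * N" by (simp add: algebra_simps)
    moreover have "N \<noteq> 0" using N_ge_2 by linarith
    ultimately show ?thesis unfolding q_def by (simp only: div_mult_self1) simp
  qed
  show "lattice_path ?p" unfolding lattice_path_def
  proof (intro conjI allI)
    fix k
    show "?p k = ?p (k - 1) \<or> ?p k = ?p (k - 1) + 1" using step[of "k - (i + j)"] by (simp add: algebra_simps)
    have "k + N - (i + j) = k - (i + j) + N" by simp
    then show "?p (k + N) = ?p k + int n" using per[of "k - (i + j)"] by (simp only:)
  qed
  show "?p (i + j) = i" by (simp add: q_def)
qed

lemma originates_from_brane_bow_on:
  assumes p: "lattice_path p" and d: "surface d"
  shows "originates_from_brane (bow_on d p) \<longleftrightarrow> (\<forall>x. 0 \<le> dim_at d p x)"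
proof
  assume a: "originates_from_brane (bow_on d p)"
  show "\<forall>x. 0 \<le> dim_at d p x"
  proof
    fix x
    define i where "i = nat (x mod N)"
    have i: "int i = x mod N" "i < n + w" using N_ge_2 by (auto simp: i_def nat_less_iff)
    show "0 \<le> dim_at d p x" using a dims_bow_on_mod[OF p d i(2,1)] i(2)
      by (auto simp: originates_from_brane_def)
  qed
qed (simp add: originates_from_brane_def)

lemma all_equivalent_originate_iff:
  assumes p: "lattice_path p" and d: "surface d"
  shows "(\<forall>U. hw_equivalent (bow_on d p) U \<longrightarrow> originates_from_brane U) \<longleftrightarrow> (\<forall>i j. 0 \<le> d i j)"
proof
  assume a: "\<forall>U. hw_equivalent (bow_on d p) U \<longrightarrow> originates_from_brane U"
  show "\<forall>i j. 0 \<le> d i j"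
  proof (intro allI)
    fix i j
    obtain q where q: "lattice_path q" "q (i + j) = i" by (rule path_through)
    then have "0 \<le> dim_at d q (i + j)"
      using a hw_equivalent_bow_on[OF d p q(1)] originates_from_brane_bow_on[OF q(1) d] by blast
    then show "0 \<le> d i j" using q(2) by (simp add: dim_at_def)
  qed
next
  assume "\<forall>i j. 0 \<le> d i j"
  then show "\<forall>U. hw_equivalent (bow_on d p) U \<longrightarrow> originates_from_brane U"
    using hw_equivalent_stays_on_surface[OF _ p d] originates_from_brane_bow_on[OF _ d]
    by (fastforce simp: dim_at_def)
qed

section \<open>Nonnegative surfaces\<close>

lemma surface_mixed: "surface d \<Longrightarrow> d (i + 1) (j + 1) = d (i + 1) j + d i (j + 1) - d i j - 1"
  and surface_period: "surface d \<Longrightarrow> d (i + int n) (j + int w) = d i j"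
  by (simp_all add: surface_def)

text \<open>
  The mixed difference of d(i, j) + i j vanishes, so this function is a sum of a function of i and
  a function of j.
\<close>

lemma surface_separates:
  assumes d: "surface d"
  shows "d i j = d i j' + d i' j - d i' j' - (i - i') * (j - j')"
proof -
  define h where "h i j = d i j + i * j" for i j
  have h: "h (i + 1) (j + 1) = h (i + 1) j + h i (j + 1) - h i j" for i j
    using surface_mixed[OF d, of i j] by (simp add: h_def algebra_simps)
  have "h (i + 1) j - h i j = h (i + 1) (j - 1) - h i (j - 1)" for i j
    using h[of i "j - 1"] by simp
  from int_step_constant[of "\<lambda>j. h (_ + 1) j - h _ j", OF this]
  have c: "h (i + 1) j - h i j = h (i + 1) j' - h i j'" for i j j' .
  have "h i j - h i j' = h (i - 1) j - h (i - 1) j'" for i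
    using c[of "i - 1" j j'] by simp
  from int_step_constant[of "\<lambda>i. h i j - h i j'", OF this]
  have "h i j - h i j' = h i' j - h i' j'" .
  then show ?thesis by (simp add: h_def algebra_simps)
qed

lemma surface_period_mult:
  assumes d: "surface d"
  shows "d (i + m * int n) (j + m * int w) = d i j"
  using periodic_mult[of "\<lambda>m. d (i + m * int n) (j + m * int w)" 1 0 m]
    surface_period[OF d, of "i + _ * int n" "j + _ * int w"]
  by (simp add: algebra_simps)

lemma int_min_attained:
  fixes f :: "int \<Rightarrow> int"
  assumes "\<And>x. 0 \<le> f x"
  shows "\<exists>x. \<forall>y. f x \<le> f y"
proof -
  obtain x where "\<forall>y. nat (f x) \<le> nat (f y)" using ex_has_least_nat[of "\<lambda>_. True" 0 "\<lambda>x. nat (f x)"] by auto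
  then show ?thesis using assms by (metis nat_le_eq_zle)
qed

text \<open>
  For two zeros (i, j) and (i', j') with i < i' and j > j', the values at the other two corners of
  the rectangle would add up to -(i' - i)(j - j') < 0. So zeros form a chain, with at most one on
  each antidiagonal. From a zero (i, j) the chain continues with a unit step: otherwise the next
  zero met in row j + 1 and column i + 1 is (i + 1, j + 1), and then d(i + 1, j) + d(i, j + 1) = 1
  for two nonnegative integers. Periodicity gives the zeros in the other direction.
\<close>

lemma zeros_form_path:
  assumes d: "surface d" and nn: "\<And>i j. 0 \<le> d i j"
    and row: "\<And>j. \<exists>i. d i j = 0" and col: "\<And>i. \<exists>j. d i j = 0"
  obtains q where "lattice_path q" "\<And>k. d (q k) (k - q k) = 0"
proof -
  have chain: False if "d i j = 0" "d i' j' = 0" "i < i'" "j > j'" for i j i' j'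
  proof -
    have "d i j = d i j' + d i' j - d i' j' - (i - i') * (j - j')" by (rule surface_separates[OF d])
    moreover have "(i - i') * (j - j') < 0" using that by (simp add: mult_neg_pos)
    ultimately show False using that nn[of i j'] nn[of i' j] by simp
  qed
  have uniq: "i = i'" if "d i (k - i) = 0" "d i' (k - i') = 0" for i i' k
    using chain[of i "k - i" i' "k - i'"] chain[of i' "k - i'" i "k - i"] that by (cases i i' rule: linorder_cases) auto
  have succ: "d (i + 1) j = 0 \<or> d i (j + 1) = 0" if z: "d i j = 0" for i j
  proof (rule ccontr)
    assume H: "\<not> (d (i + 1) j = 0 \<or> d i (j + 1) = 0)"
    obtain i' where i': "d i' (j + 1) = 0" using row by blast
    obtain j' where j': "d (i + 1) j' = 0" using col by blast
    have "i' \<ge> i" using chain[OF i' z] by (cases "i' < i") auto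
    moreover have "i' \<noteq> i" using i' H by auto
    moreover have "j' \<ge> j" using chain[OF z j'] by (cases "j' < j") auto
    moreover have "j' \<noteq> j" using j' H by auto
    ultimately have "i' \<ge> i + 1" "j' \<ge> j + 1" by auto
    moreover have "\<not> (i' > i + 1 \<and> j' > j + 1)" using chain[OF j' i'] by auto
    ultimately have "i' = i + 1 \<or> j' = j + 1" by auto
    then have "d (i + 1) (j + 1) = 0" using i' j' by auto
    then have "d (i + 1) j + d i (j + 1) = 1" using surface_mixed[OF d, of i j] z by simp
    then show False using H nn[of "i + 1" j] nn[of i "j + 1"] by linarith
  qed
  obtain j0 where j0: "d 0 j0 = 0" using col by blast
  have up: "\<exists>i. d i (j0 + int m - i) = 0" for m
  proof (induction m)
    case 0 then show ?case using j0 by (intro exI[of _ 0]) simp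
  next
    case (Suc m)
    then obtain i where "d i (j0 + int m - i) = 0" by blast
    from succ[OF this] show ?case
    proof
      assume "d (i + 1) (j0 + int m - i) = 0"
      then show ?case by (intro exI[of _ "i + 1"]) (simp add: algebra_simps)
    next
      assume "d i (j0 + int m - i + 1) = 0"
      then show ?case by (intro exI[of _ i]) (simp add: algebra_simps)
    qed
  qed
  have ex: "\<exists>i. d i (k - i) = 0" for k
  proof -
    define a where "a = \<bar>j0 - k\<bar>"
    have "a * N \<ge> a * 1" using N_ge_2 by (intro mult_left_mono) (auto simp: a_def)
    then have "k + a * N \<ge> j0" by (simp add: a_def)
    then obtain m where "k + a * N = j0 + int m" by (metis zle_iff_zadd)
    then obtain i where "d i (k + a * N - i) = 0" using up[of m] by auto
    moreover have "d i (k + a * N - i) = d (i - a * int n) (k - (i - a * int n))"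
      using surface_period_mult[OF d, of "i - a * int n" a "k - (i - a * int n)"] by (simp add: algebra_simps)
    ultimately show ?thesis by auto
  qed
  define q where "q k = (SOME i. d i (k - i) = 0)" for k
  have q: "d (q k) (k - q k) = 0" for k unfolding q_def by (rule someI_ex[OF ex])
  have "lattice_path q" unfolding lattice_path_def
  proof (intro conjI allI)
    fix k
    from succ[OF q[of "k - 1"]] show "q k = q (k - 1) \<or> q k = q (k - 1) + 1"
    proof
      assume "d (q (k - 1) + 1) (k - 1 - q (k - 1)) = 0"
      then show ?thesis using uniq[OF q[of k], of "q (k - 1) + 1"] by (simp add: algebra_simps)
    next
      assume "d (q (k - 1)) (k - 1 - q (k - 1) + 1) = 0"
      then show ?thesis using uniq[OF q[of k], of "q (k - 1)"] by (simp add: algebra_simps)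
    qed
    have "d (q k + int n) (k + N - (q k + int n)) = 0"
      using surface_period[OF d, of "q k" "k - q k"] q[of k] by (simp add: algebra_simps)
    then show "q (k + N) = q k + int n" using uniq[OF q[of "k + N"]] by blast
  qed
  then show ?thesis using that q by blast
qed

text \<open>
  F is the minimum over each column and G the minimum over each row of d - F. The second
  subtraction leaves the zeros of the columns in place, so the remainder has zeros in every row
  and column. The functions F and G form a discrete pair of Legendre transforms up to the term i
  j.
\<close>

lemma nonneg_surface_decomposition:
  assumes d: "surface d" and nn: "\<And>i j. 0 \<le> d i j"
  shows "\<exists>F G q. lattice_path q \<and> (\<forall>k. d (q k) (k - q k) = F (q k) + G (k - q k)) \<and>
    (\<forall>i. 0 \<le> F i) \<and> (\<forall>j. 0 \<le> G j) \<and> (\<forall>i. F (i + int n) = F i) \<and> (\<forall>j. G (j + int w) = G j) \<and>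
    (\<forall>i j. F i \<le> d i j)"
proof -
  have "\<forall>i. \<exists>j. \<forall>j'. d i j \<le> d i j'" using int_min_attained nn by meson
  then obtain a where a: "\<And>i j. d i (a i) \<le> d i j" by metis
  define F where "F i = d i (a i)" for i
  have Fle: "F i \<le> d i j" for i j using a by (simp add: F_def)
  define e where "e i j = d i j - F i" for i j
  have e: "0 \<le> e i j" for i j using Fle by (simp add: e_def)
  have "\<forall>j. \<exists>i. \<forall>i'. e i j \<le> e i' j" using int_min_attained[of "\<lambda>i. e i _"] e by meson
  then obtain b where b: "\<And>i j. e (b j) j \<le> e i j" by metis
  define G where "G j = e (b j) j" for j
  have Gle: "G j \<le> e i j" for i j using b by (simp add: G_def)
  have F0: "0 \<le> F i" and G0: "0 \<le> G j" for i j using nn e by (simp_all add: F_def G_def)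
  have Fp: "F (i + int n) = F i" for i
  proof (rule antisym)
    show "F (i + int n) \<le> F i"
      using Fle[of "i + int n" "a i + int w"] surface_period[OF d, of i "a i"] by (simp add: F_def)
    show "F i \<le> F (i + int n)"
      using Fle[of i "a (i + int n) - int w"] surface_period[OF d, of i "a (i + int n) - int w"] by (simp add: F_def)
  qed
  have ep: "e (i + int n) (j + int w) = e i j" for i j
    using surface_period[OF d] Fp by (simp add: e_def)
  have Gp: "G (j + int w) = G j" for j
  proof (rule antisym)
    show "G (j + int w) \<le> G j"
      using Gle[of "j + int w" "b j + int n"] ep[of "b j" j] by (simp add: G_def)
    show "G j \<le> G (j + int w)"
      using Gle[of j "b (j + int w) - int n"] ep[of "b (j + int w) - int n" j] by (simp add: G_def)
  qed
  define d0 where "d0 i j = d i j - F i - G j" for i j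
  have s0: "surface d0"
    using surface_mixed[OF d] surface_period[OF d] Fp Gp by (simp add: surface_def d0_def)
  have nn0: "0 \<le> d0 i j" for i j using Gle[of j i] by (simp add: d0_def e_def)
  have row: "\<exists>i. d0 i j = 0" for j
    by (rule exI[of _ "b j"]) (simp add: d0_def G_def e_def)
  have col: "\<exists>j. d0 i j = 0" for i
  proof
    have "e i (a i) = 0" by (simp add: e_def F_def)
    then show "d0 i (a i) = 0" using Gle[of "a i" i] G0[of "a i"] by (simp add: d0_def e_def)
  qed
  obtain q where "lattice_path q" "\<And>k. d0 (q k) (k - q k) = 0" using zeros_form_path[OF s0 nn0 row col] by blast
  then show ?thesis using F0 G0 Fp Gp Fle
    by (intro exI[of _ F] exI[of _ G] exI[of _ q]) (simp add: d0_def algebra_simps)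
qed

section \<open>Every bow diagram lies on a surface\<close>

lemma path_const_between:
  assumes p: "lattice_path p" and le: "k \<le> l" and eq: "p k = p l" and "k \<le> x" "x \<le> l"
  shows "p x = p k"
proof -
  have mono: "p a \<le> p (a + int m)" for a m
  proof (induction m)
    case (Suc m) then show ?case using path_step[OF p, of "a + int (Suc m)"] by (simp add: algebra_simps) linarith
  qed simp
  have "p k \<le> p x" "p x \<le> p l"
    using mono[of k "nat (x - k)"] mono[of x "nat (l - x)"] assms by simp_all
  then show ?thesis using eq by simp
qed

lemma path_surj:
  assumes p: "lattice_path p" obtains k where "p k = i"
proof -
  have *: "\<exists>k. p k = p 0 + m" for m
  proof (induction m rule: int_induct[where k = 0])
    case base then show ?case by auto
  next
    case (step1 m)
    then obtain k where k: "p k = p 0 + m" by blast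
    have "\<exists>x. p x \<noteq> p k \<and> x > k" using path_period[OF p, of k] n_pos N_ge_2 by (intro exI[of _ "k + N"]) simp
    then obtain t where t: "p (k + int t) \<noteq> p k" by (metis zless_iff_Suc_zadd)
    define s where "s = (LEAST t. p (k + int t) \<noteq> p k)"
    have s: "p (k + int s) \<noteq> p k" unfolding s_def by (rule LeastI[of _ t]) (rule t)
    then obtain r where r: "s = Suc r" by (cases s) auto
    have "p (k + int r) = p k" using not_less_Least[of r "\<lambda>t. p (k + int t) \<noteq> p k"] r unfolding s_def by auto
    then have "p (k + int s) = p k + 1" using s path_step[OF p, of "k + int s"] r by auto
    then show ?case using k by (intro exI[of _ "k + int s"]) simp
  next
    case (step2 m)
    then obtain k where k: "p k = p 0 + m" by blast
    have "\<exists>x. p x \<noteq> p k \<and> x < k" using path_period[OF p, of "k - N"] n_pos N_ge_2 by (intro exI[of _ "k - N"]) simp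
    then obtain x where "p x \<noteq> p k" "x < k" by blast
    then have "p (k - int (nat (k - x))) \<noteq> p k" by simp
    then obtain t where t: "p (k - int t) \<noteq> p k" by blast
    define s where "s = (LEAST t. p (k - int t) \<noteq> p k)"
    have s: "p (k - int s) \<noteq> p k" unfolding s_def by (rule LeastI[of _ t]) (rule t)
    then obtain r where r: "s = Suc r" by (cases s) auto
    have "p (k - int r) = p k" using not_less_Least[of r "\<lambda>t. p (k - int t) \<noteq> p k"] r unfolding s_def by auto
    then have "p (k - int s) = p k - 1" using s path_step[OF p, of "k - int r"] r by (auto simp: algebra_simps)
    then show ?case using k by (intro exI[of _ "k - int s"]) simp
  qed
  from *[of "i - p 0"] show ?thesis using that by auto
qed

text \<open>
  Exchanging the roles of arrows and x-points.
\<close>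

lemma swap_path:
  assumes "lattice_path p"
  shows "periodic_lattice.lattice_path w n (\<lambda>k. k - p k)"
proof -
  interpret swap: periodic_lattice w n by unfold_locales (rule w_pos n_pos)+
  show ?thesis unfolding swap.lattice_path_def
  proof (intro conjI allI)
    fix k show "k - p k = k - 1 - p (k - 1) \<or> k - p k = k - 1 - p (k - 1) + 1"
      using path_step[OF assms, of k] by auto
    have e: "k + int (w + n) = k + N" by simp
    show "k + int (w + n) - p (k + int (w + n)) = k - p k + int w"
      unfolding e using path_period[OF assms, of k] by simp
  qed
qed

lemma determined_by_path:
  fixes F :: "int \<Rightarrow> int"
  assumes p: "lattice_path p" and F: "\<And>k. p k = p (k - 1) \<Longrightarrow> F k = F (k - 1)" and eq: "p k = p l"
  shows "F k = F l"
proof -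
  have *: "F k = F l" if "k \<le> l" "p k = p l" for k l
  proof -
    have "F (k + int m) = F k" if "m \<le> nat (l - k)" for m
      using that
    proof (induction m)
      case (Suc m)
      have "p (k + int (Suc m)) = p k" "p (k + int m) = p k"
        by (rule path_const_between[OF p \<open>k \<le> l\<close> \<open>p k = p l\<close>]; use Suc.prems \<open>k \<le> l\<close> in linarith)+
      then show ?case using F[of "k + int (Suc m)"] Suc by simp
    qed simp
    from this[of "nat (l - k)"] show ?thesis using \<open>k \<le> l\<close> by simp
  qed
  show ?thesis using *[of k l] *[of l k, OF _ eq[symmetric]] eq by linarith
qed

text \<open>
  Let V k be the prescribed value plus i j at point k. Its increments at arrows sum up to a
  function F that does not change along x-points, hence depends on i only; the other increments
  give a function of j. Their sum minus i j is the surface. Each of the two functions is periodic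
  up to a linear term and a constant, and the constants cancel because V itself has the right
  behaviour.
\<close>

lemma surface_through_values:
  assumes p: "lattice_path p" and v: "\<And>k. v (k + N) = v k"
  obtains d where "surface d" "\<And>k. dim_at d p k = v k"
proof -
  interpret swap: periodic_lattice w n by unfold_locales (rule w_pos n_pos)+
  define c where "c k = k - p k" for k
  have c: "swap.lattice_path c" unfolding c_def by (rule swap_path[OF p])
  define V where "V k = v k + p k * c k" for k
  obtain F where F: "\<And>k. F k = F (k - 1) + (if p k = p (k - 1) then 0 else V k - V (k - 1))"
    using int_antidifference[of "\<lambda>k. if p k = p (k - 1) then 0 else V k - V (k - 1)"] by blast
  define G where "G k = V k - F k" for k
  have Fs: "p k = p (k - 1) \<Longrightarrow> F k = F (k - 1)" for k using F[of k] by simp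
  have FF: "F k = F l" if "p k = p l" for k l
    by (rule determined_by_path[of p F, OF p Fs that])
  have cp: "c k = c (k - 1) \<longleftrightarrow> p k \<noteq> p (k - 1)" for k
    using path_step[OF p, of k] by (auto simp: c_def)
  have Gs: "c k = c (k - 1) \<Longrightarrow> G k = G (k - 1)" for k using F[of k] cp[of k] by (simp add: G_def)
  have GG: "G k = G l" if "c k = c l" for k l
    by (rule swap.determined_by_path[of c G, OF c Gs that])
  define f where "f i = F (SOME k. p k = i)" for i
  define g where "g j = G (SOME k. c k = j)" for j
  have f: "f (p k) = F k" for k unfolding f_def by (rule FF) (rule someI[of "\<lambda>x. p x = p k" k], simp)
  have g: "g (c k) = G k" for k unfolding g_def by (rule GG) (rule someI[of "\<lambda>x. c x = c k" k], simp)
  define d where "d i j = f i + g j - i * j" for i j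
  have val: "dim_at d p k = v k" for k
    using f[of k] g[of k] by (simp add: dim_at_def d_def c_def[symmetric] G_def V_def)
  have cN: "c (k + N) = c k + int w" for k using path_period[OF p, of k] by (simp add: c_def)
  have VN: "V (k + N) = V k + int n * c k + int w * p k + int n * int w" for k
    using path_period[OF p, of k] cN[of k] v[of k] by (simp add: V_def algebra_simps)
  have pc: "p (k + N) = p (k + N - 1) \<longleftrightarrow> p k = p (k - 1)" for k
    using path_period[OF p, of k] path_period[OF p, of "k - 1"] by (simp add: algebra_simps)
  have "F (k + N) - F k - int w * p k = F (k - 1 + N) - F (k - 1) - int w * p (k - 1)" for k
  proof (cases "p k = p (k - 1)")
    case True
    then have "F (k + N) = F (k + N - 1)" "F k = F (k - 1)" using F[of "k + N"] F[of k] pc[of k] by auto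
    then show ?thesis using True by (simp add: algebra_simps)
  next
    case False
    then have p1: "p k = p (k - 1) + 1" and c1: "c k = c (k - 1)" using path_step[OF p, of k] cp[of k] by auto
    have "F (k + N) = F (k + N - 1) + V (k + N) - V (k + N - 1)" "F k = F (k - 1) + V k - V (k - 1)"
      using F[of "k + N"] F[of k] pc[of k] False by auto
    moreover have "k + N - 1 = k - 1 + N" by simp
    ultimately have "F (k + N) - F (k - 1 + N) - (F k - F (k - 1)) = V (k + N) - V (k - 1 + N) - (V k - V (k - 1))"
      by (simp only:)
    also have "\<dots> = int w" using VN[of k] VN[of "k - 1"] p1 c1 by (simp add: algebra_simps)
    finally show ?thesis using p1 by (simp add: algebra_simps)
  qed
  from int_step_constant[of "\<lambda>k. F (k + N) - F k - int w * p k", OF this]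
  have FN: "F (k + N) - F k - int w * p k = F (0 + N) - F 0 - int w * p 0" for k .
  have fN: "f (i + int n) = f i + int w * i + (F N - F 0 - int w * p 0)" for i
  proof -
    obtain k where k: "p k = i" by (rule path_surj[OF p])
    then show ?thesis using FN[of k] f[of k] f[of "k + N"] path_period[OF p, of k] by simp
  qed
  have gN: "g (j + int w) = g j + int n * j + int n * int w - (F N - F 0 - int w * p 0)" for j
  proof -
    obtain k where k: "c k = j" by (rule swap.path_surj[OF c])
    then show ?thesis using FN[of k] g[of k] g[of "k + N"] cN[of k] VN[of k] by (simp add: G_def)
  qed
  have "surface d" unfolding surface_def
  proof (intro conjI allI)
    fix i j
    show "d (i + 1) (j + 1) = d (i + 1) j + d i (j + 1) - d i j - 1" by (simp add: d_def algebra_simps)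
    show "d (i + int n) (j + int w) = d i j" using fN[of i] gN[of j] by (simp add: d_def algebra_simps)
  qed
  then show ?thesis using that val by blast
qed

text \<open>
  Two diagrams with the same elements can be put on the same path, which is what comparing a
  diagram with its subdiagrams requires.
\<close>

lemma bow_on_surface:
  assumes p: "lattice_path p" and D: "is_bow D" "elts D = map (\<lambda>k. element_at p (int k)) [0..<n + w]"
  obtains d where "surface d" "D = bow_on d p"
proof -
  define v where "v k = dims D ! nat (k mod N)" for k
  have "v (k + N) = v k" for k by (simp add: v_def del: of_nat_add)
  from surface_through_values[of p v, OF p this] obtain d where d: "surface d" "\<And>k. dim_at d p k = v k" by blast
  have "length (dims D) = n + w" using D by (simp add: is_bow_def)
  then have "dims D = map (\<lambda>k. dim_at d p (int k)) [0..<n + w]"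
    by (auto intro!: nth_equalityI simp: d(2) v_def)
  then have "D = bow_on d p" using D(2) by (cases D) (simp add: bow_on_def)
  then show ?thesis using that d(1) by blast
qed

lemma path_of_elements:
  assumes "length es = n + w" "length (filter (\<lambda>p. p = Arrow) es) = n"
  obtains p where "lattice_path p" "es = map (\<lambda>k. element_at p (int k)) [0..<n + w]"
proof -
  define \<phi> :: "int \<Rightarrow> int" where "\<phi> k = (if es ! nat (k mod N) = Arrow then 1 else 0)" for k
  obtain p where p: "\<And>k. p k = p (k - 1) + \<phi> k" using int_antidifference by blast
  have step: "p k = p (k - 1) \<or> p k = p (k - 1) + 1" for k using p[of k] by (simp add: \<phi>_def)
  have \<phi>x: "\<phi> (int x) = (if es ! x = Arrow then 1 else 0)" if "x < n + w" for x
  proof -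
    have "int x mod N = int x" using that by (intro mod_pos_pos_trivial) auto
    then show ?thesis by (simp add: \<phi>_def del: of_nat_add)
  qed
  have "p (k + N) - p k = p (k - 1 + N) - p (k - 1)" for k
  proof -
    have e: "k + N - 1 = k - 1 + N" by simp
    show ?thesis using p[of "k + N", unfolded e] p[of k] by (simp add: \<phi>_def del: of_nat_add)
  qed
  from int_step_constant[of "\<lambda>k. p (k + N) - p k", OF this]
  have c: "p (k + N) - p k = p (-1 + N) - p (-1)" for k .
  have "p (int m - 1) = p (-1) + (\<Sum>x<m. \<phi> (int x))" for m
  proof (induction m)
    case (Suc m) then show ?case using p[of "int m"] by simp
  qed simp
  from this[of "n + w"] have "p (-1 + N) - p (-1) = (\<Sum>x<n + w. \<phi> (int x))" by (simp add: algebra_simps)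
  also have "\<dots> = (\<Sum>x<n + w. if es ! x = Arrow then 1 else 0)"
    using \<phi>x by (intro sum.cong) auto
  also have "\<dots> = int (card {i. i < n + w \<and> es ! i = Arrow})"
    by (simp add: sum.If_cases Int_def lessThan_def)
  also have "\<dots> = int n" using assms by (simp add: length_filter_conv_card)
  finally have "p (k + N) = p k + int n" for k using c[of k] by simp
  then have "lattice_path p" using step by (simp add: lattice_path_def)
  moreover have "es = map (\<lambda>k. element_at p (int k)) [0..<n + w]"
  proof (rule nth_equalityI)
    fix i assume "i < length es"
    then have i: "i < n + w" using assms by simp
    have "element_at p (int i) = es ! i"
      using p[of "int i"] \<phi>x[OF i] by (cases "es ! i") (auto simp: element_at_def)
    then show "es ! i = map (\<lambda>k. element_at p (int k)) [0..<n + w] ! i" using i by simp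
  qed (use assms in simp)
  ultimately show ?thesis using that by blast
qed

end

lemma len_split: "len D = num_arrows D + num_xpoints D"
proof -
  have "(\<lambda>p. p = XPoint) = (\<lambda>p. \<not> p = Arrow)" using element.exhaust by auto
  then show ?thesis unfolding len_def num_arrows_def num_xpoints_def
    using sum_length_filter_compl[of "\<lambda>p. p = Arrow" "elts D"] by simp
qed

lemma bow_on_exists:
  assumes D: "is_bow D" and "num_arrows D \<ge> 1" "num_xpoints D \<ge> 1"
  obtains d p where "periodic_lattice.lattice_path (num_arrows D) (num_xpoints D) p"
    "periodic_lattice.surface (num_arrows D) (num_xpoints D) d"
    "D = periodic_lattice.bow_on (num_arrows D) (num_xpoints D) d p"
proof -
  interpret periodic_lattice "num_arrows D" "num_xpoints D" by unfold_locales (use assms in auto)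
  have "length (elts D) = num_arrows D + num_xpoints D" using len_split[of D] by (simp only: len_def)
  moreover have "length (filter (\<lambda>p. p = Arrow) (elts D)) = num_arrows D" by (simp only: num_arrows_def)
  ultimately obtain p where p: "lattice_path p"
    "elts D = map (\<lambda>k. element_at p (int k)) [0..<num_arrows D + num_xpoints D]"
    by (rule path_of_elements)
  obtain d where "surface d" "D = bow_on d p" using bow_on_surface[OF p(1) D p(2)] by blast
  then show ?thesis using that p(1) by blast
qed

context periodic_lattice
begin

section \<open>Supersymmetry inequalities\<close>

text \<open>
  Along translates by (0, w) of a fixed point, d is a quadratic progression, because (0, w) and
  (-n, 0) differ by a period. Its first two terms are the values at (i, j) and (i, j + w). The
  rest follows from \<open>surface_separates\<close>. This is the left hand side of a
  supersymmetry inequality with t = a + 1.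
\<close>

lemma surface_quadrant:
  assumes d: "surface d" and a: "0 \<le> a"
  shows "d (i - s - a * int n) (j + k) =
     s * k + a * (s * int w + k * int n) + (a * (a - 1) div 2) * int w * int n
       + d (i - s) j + d i (j + k) + a * d i (j + int w) - (a + 1) * d i j"
proof -
  define e where "e a = d i (j + a * int w)" for a
  have sh: "d (x - b * int n) y = d x (y + b * int w)" for x y b
    using surface_period_mult[OF d, of "x - b * int n" b y] by simp
  have "e (int b) = d i j + int b * (d i (j + int w) - d i j) + (int b * (int b - 1) div 2) * int w * int n" for b
  proof (induction b)
    case 0 then show ?case by (simp add: e_def)
  next
    case (Suc b)
    have "e (int b + 1) = d (i - int n) (j + int b * int w)"
      using sh[of i 1 "j + int b * int w"] by (simp add: e_def algebra_simps)
    also have "\<dots> = d (i - int n) j + e (int b) - d i j + int n * (int b * int w)"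
      using surface_separates[OF d, of "i - int n" "j + int b * int w" j i] by (simp add: e_def)
    also have "d (i - int n) j = d i (j + int w)" using sh[of i 1 j] by simp
    finally have s: "e (int b + 1) = d i (j + int w) + e (int b) - d i j + int b * int w * int n" by (simp add: algebra_simps)
    have "(int b + 1) * int b = int b * (int b - 1) + int b * 2" by (simp add: algebra_simps)
    then have "(int b + 1) * int b div 2 = int b * (int b - 1) div 2 + int b" by simp
    then show ?case using s Suc by (simp add: algebra_simps)
  qed
  from this[of "nat a"] a
  have ea: "e a = d i j + a * (d i (j + int w) - d i j) + (a * (a - 1) div 2) * int w * int n" by simp
  have "d (i - s - a * int n) (j + k) = d (i - s) (j + (k + a * int w))" using sh[of "i - s" a "j + k"] by (simp add: algebra_simps)
  also have "\<dots> = d (i - s) j + d i (j + (k + a * int w)) - d i j + s * (k + a * int w)"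
    using surface_separates[OF d, of "i - s" "j + (k + a * int w)" j i] by simp
  also have "d i (j + (k + a * int w)) = d (i - a * int n) (j + k)" using sh[of i a "j + k"] by (simp add: algebra_simps)
  also have "\<dots> = d (i - a * int n) j + d i (j + k) - d i j + a * int n * k"
    using surface_separates[OF d, of "i - a * int n" "j + k" j i] by simp
  also have "d (i - a * int n) j = e a" using sh[of i a j] by (simp add: e_def)
  finally show ?thesis by (simp add: ea algebra_simps)
qed

text \<open>
  Point reflection exchanges the two families of inequalities.
\<close>

lemma surface_reflect:
  assumes "surface d" shows "surface (\<lambda>i j. d (- i) (- j))"
  unfolding surface_def
proof (intro conjI allI)
  fix i j
  show "d (- (i + 1)) (- (j + 1)) = d (- (i + 1)) (- j) + d (- i) (- (j + 1)) - d (- i) (- j) - 1"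
    using surface_mixed[OF assms, of "- i - 1" "- j - 1"] by simp
  show "d (- (i + int n)) (- (j + int w)) = d (- i) (- j)"
    using surface_period[OF assms, of "- i - int n" "- j - int w"] by simp
qed

text \<open>
  Modulo the period every point has its second coordinate in the strip between j0 and j0 + w.
  There it lies either to the left or to the right of i0.
\<close>

lemma nonneg_from_quadrants:
  assumes d: "surface d"
    and 1: "\<And>s k a. \<lbrakk>0 \<le> s; s \<le> int n; 0 \<le> k; k \<le> int w; 0 \<le> a\<rbrakk> \<Longrightarrow> 0 \<le> d (i0 - s - a * int n) (j0 + k)"
    and 2: "\<And>s k a. \<lbrakk>0 \<le> s; s \<le> int n; 0 \<le> k; k \<le> int w; 0 \<le> a\<rbrakk> \<Longrightarrow> 0 \<le> d (i0 + s + a * int n) (j0 + int w - k)"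
  shows "0 \<le> d i j"
proof -
  define k q where "k = (j - j0) mod int w" and "q = (j - j0) div int w"
  have k: "0 \<le> k" "k < int w" using w_pos by (simp_all add: k_def)
  have j: "j = j0 + k + q * int w" using div_mult_mod_eq[of "j - j0" "int w"] by (simp add: k_def q_def)
  have dq: "d i j = d (i - q * int n) (j0 + k)"
    using surface_period_mult[OF d, of "i - q * int n" q "j0 + k"] j by simp
  define m where "m = i - q * int n - i0"
  define s a where "s = \<bar>m\<bar> mod int n" and "a = \<bar>m\<bar> div int n"
  have s: "0 \<le> s" "s \<le> int n" "0 \<le> a" using n_pos by (auto simp: s_def a_def less_imp_le pos_imp_zdiv_nonneg_iff)
  have m: "\<bar>m\<bar> = s + a * int n" using div_mult_mod_eq[of "\<bar>m\<bar>" "int n"] by (simp add: s_def a_def)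
  show ?thesis
  proof (cases "m \<ge> 0")
    case True
    then have "i - q * int n = i0 + s + a * int n" using m by (simp add: m_def)
    then show ?thesis using 2[of s "int w - k" a] s k dq by (simp add: algebra_simps)
  next
    case False
    then have "i - q * int n = i0 - s - a * int n" using m by (simp add: m_def)
    then show ?thesis using 1[of s k a] s k dq by simp
  qed
qed

end

lemma card_rotate:
  fixes \<sigma> L :: nat
  assumes "\<sigma> < L"
  shows "card {m. m < L \<and> P ((\<sigma> + m) mod L)} = card {i. i < L \<and> P i}"
proof (rule bij_betw_same_card)
  have "L > 0" using assms by simp
  show "bij_betw (\<lambda>m. (\<sigma> + m) mod L) {m. m < L \<and> P ((\<sigma> + m) mod L)} {i. i < L \<and> P i}"
  proof (rule bij_betw_byWitness[where f' = "\<lambda>i. (i + L - \<sigma>) mod L"])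
    have 1: "((\<sigma> + m) mod L + L - \<sigma>) mod L = m" if "m < L" for m
      using that assms by (simp add: mod_if)
    have 2: "(\<sigma> + (i + L - \<sigma>) mod L) mod L = i" if "i < L" for i
      using that assms by (simp add: mod_simps)
    show "\<forall>a\<in>{m. m < L \<and> P ((\<sigma> + m) mod L)}. ((\<sigma> + a) mod L + L - \<sigma>) mod L = a" using 1 by simp
    show "\<forall>a'\<in>{i. i < L \<and> P i}. (\<sigma> + (a' + L - \<sigma>) mod L) mod L = a'" using 2 by simp
    show "(\<lambda>m. (\<sigma> + m) mod L) ` {m. m < L \<and> P ((\<sigma> + m) mod L)} \<subseteq> {i. i < L \<and> P i}"
      using \<open>L > 0\<close> by auto
    show "(\<lambda>i. (i + L - \<sigma>) mod L) ` {i. i < L \<and> P i} \<subseteq> {m. m < L \<and> P ((\<sigma> + m) mod L)}"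
      using \<open>L > 0\<close> 2 by auto
  qed
qed

lemma num_xpoints_0_iff: "num_xpoints D = 0 \<longleftrightarrow> (\<forall>i<len D. elts D ! i = Arrow)"
proof -
  have "e \<noteq> XPoint \<longleftrightarrow> e = Arrow" for e by (cases e) auto
  then show ?thesis by (simp add: num_xpoints_def len_def filter_empty_conv all_set_conv_all_nth)
qed

lemma num_arrows_0_iff: "num_arrows D = 0 \<longleftrightarrow> (\<forall>i<len D. elts D ! i = XPoint)"
proof -
  have "e \<noteq> Arrow \<longleftrightarrow> e = XPoint" for e by (cases e) auto
  then show ?thesis by (simp add: num_arrows_def len_def filter_empty_conv all_set_conv_all_nth)
qed

text \<open>
  The distances of the x-points from the arrow that starts their wavy line form a set that is
  closed under passing to smaller positive distances, so they are 1, ..., w.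
\<close>

lemma separated_has_labelling:
  assumes D: "is_bow D" and sep: "separated D"
  shows "\<exists>r. is_labelling D r"
proof (cases "num_arrows D = 0 \<or> num_xpoints D = 0")
  case True
  have "len D > 0" using D by (simp add: is_bow_def len_def)
  then have "is_labelling D 0"
    using True num_xpoints_0_iff[of D] num_arrows_0_iff[of D] len_split[of D] by (auto simp: is_labelling_def)
  then show ?thesis by blast
next
  case False
  define L where "L = len D"
  from sep False obtain \<sigma> where \<sigma>: "\<sigma> < L" "elts D ! \<sigma> = Arrow"
    and on: "\<And>i. i < L \<Longrightarrow> elts D ! i = XPoint \<Longrightarrow> lies_on D i \<sigma>"
    by (auto simp: separated_def wavy_lines_def L_def)
  have L0: "L > 0" using \<sigma> by simp
  define X where "X m \<longleftrightarrow> elts D ! ((\<sigma> + m) mod L) = XPoint" for m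
  define M where "M = {m. m < L \<and> X m}"
  have XL: "\<not> X 0" "\<not> X L" using \<sigma> by (simp_all add: X_def)
  have down: "X j" if "m \<in> M" "1 \<le> j" "j \<le> m" for m j
  proof -
    have m: "m < L" "X m" using that by (auto simp: M_def)
    then have "lies_on D ((\<sigma> + m) mod L) \<sigma>" using on L0 by (simp add: X_def)
    then obtain m' where m'1: "(\<sigma> + m') mod L = (\<sigma> + m) mod L"
      and na: "\<forall>j\<in>{1..m'}. elts D ! ((\<sigma> + j) mod L) \<noteq> Arrow"
      unfolding lies_on_def L_def by blast
    have m'2: "X j" if "j \<in> {1..m'}" for j
      using na that unfolding X_def by (cases "elts D ! ((\<sigma> + j) mod L)") auto
    note m' = m'1 m'2
    have "m' < L"
    proof (rule ccontr)
      assume "\<not> m' < L" then show False using m'(2)[of L] XL L0 by auto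
    qed
    have "m' = m"
    proof -
      have "(\<sigma> + m') mod L = (if \<sigma> + m' < L then \<sigma> + m' else \<sigma> + m' - L)"
        "(\<sigma> + m) mod L = (if \<sigma> + m < L then \<sigma> + m else \<sigma> + m - L)"
        using \<sigma> m \<open>m' < L\<close> by (auto simp: mod_if)
      then show ?thesis using m'(1) \<sigma> m \<open>m' < L\<close> by (auto split: if_splits)
    qed
    then show ?thesis using m'(2)[of j] that by auto
  qed
  have fin: "finite M" by (simp add: M_def)
  have cM: "card M = num_xpoints D"
    unfolding M_def X_def card_rotate[OF \<sigma>(1), of "\<lambda>i. elts D ! i = XPoint"]
    by (simp add: num_xpoints_def length_filter_conv_card L_def len_def)
  have "M \<noteq> {}" using cM False by auto
  define h where "h = Max M"
  have h: "h \<in> M" unfolding h_def by (rule Max_in[OF fin \<open>M \<noteq> {}\<close>])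
  have "M = {1..h}"
  proof (intro equalityI subsetI)
    fix x assume "x \<in> M"
    then have "x \<le> h" "x \<noteq> 0" using fin XL by (auto simp: h_def M_def intro: gr0I)
    then show "x \<in> {1..h}" by auto
  next
    fix x assume "x \<in> {1..h}"
    then show "x \<in> M" using down[OF h, of x] h by (auto simp: M_def)
  qed
  then have M: "M = {1..num_xpoints D}" using cM by simp
  have Lnw: "L = num_arrows D + num_xpoints D" by (simp add: L_def len_split)
  define r where "r = (\<sigma> + num_xpoints D + 1) mod L"
  have 1: "elts D ! ((r + j) mod L) = Arrow" if "j < num_arrows D" for j
  proof -
    have "\<not> X (num_xpoints D + 1 + j)"
    proof (cases "num_xpoints D + 1 + j = L")
      case False
      then have "num_xpoints D + 1 + j < L" using that Lnw by simp
      moreover have "num_xpoints D + 1 + j \<notin> M" by (simp add: M)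
      ultimately show ?thesis by (simp add: M_def)
    qed (metis XL(2))
    moreover have "(r + j) mod L = (\<sigma> + (num_xpoints D + 1 + j)) mod L" by (simp add: r_def mod_simps algebra_simps)
    ultimately show ?thesis unfolding X_def by (cases "elts D ! ((r + j) mod L)") auto
  qed
  have 2: "elts D ! ((r + num_arrows D + j) mod L) = XPoint" if "j < num_xpoints D" for j
  proof -
    have "1 + j \<in> M" using that by (simp add: M)
    moreover have "(r + num_arrows D + j) mod L = (\<sigma> + (1 + j)) mod L"
    proof -
      have "(r + (num_arrows D + j)) mod L = (\<sigma> + num_xpoints D + 1 + (num_arrows D + j)) mod L"
        by (simp only: r_def mod_add_left_eq)
      moreover have "\<sigma> + num_xpoints D + 1 + (num_arrows D + j) = (\<sigma> + (1 + j)) + L" by (simp add: Lnw)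
      ultimately have "(r + (num_arrows D + j)) mod L = (\<sigma> + (1 + j)) mod L" by (simp only: mod_add_self2)
      then show ?thesis by (simp add: add.assoc)
    qed
    ultimately show ?thesis by (simp add: M_def X_def)
  qed
  have "is_labelling D r" unfolding is_labelling_def using 1 2 L0 by (simp add: r_def L_def)
  then show ?thesis by blast
qed

text \<open>
  The dimensions are the sum of a part that only changes at arrows and a part that only changes at
  x-points.
\<close>

definition decomposable :: "bow \<Rightarrow> bool" where
  "decomposable D \<longleftrightarrow> (\<exists>\<alpha> \<beta> :: nat \<Rightarrow> nat. \<forall>k<len D. dims D ! k = int (\<alpha> k + \<beta> k) \<and>
     (elts D ! k = XPoint \<longrightarrow> \<alpha> (prv D k) = \<alpha> k) \<and> (elts D ! k = Arrow \<longrightarrow> \<beta> (prv D k) = \<beta> k))"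

context periodic_lattice
begin

lemma element_at_step: "lattice_path p \<Longrightarrow> p x = p (x - 1) + (if element_at p x = Arrow then 1 else 0)"
  using path_step[of p x] by (auto simp: element_at_def)

lemma num_arrows_bow_on [simp]:
  assumes p: "lattice_path p" shows "num_arrows (bow_on d p) = n"
proof -
  have "p (int m - 1) = p (-1) + (\<Sum>x<m. if element_at p (int x) = Arrow then 1 else 0)" for m
  proof (induction m)
    case (Suc m) then show ?case using element_at_step[OF p, of "int m"] by simp
  qed simp
  from this[of "n + w"] path_period[OF p, of "-1"]
  have "int n = (\<Sum>x<n + w. if element_at p (int x) = Arrow then 1 else 0)" by (simp add: algebra_simps)
  also have "\<dots> = int (card {i. i < n + w \<and> element_at p (int i) = Arrow})"
    by (simp add: sum.If_cases Int_def lessThan_def)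
  also have "card {i. i < n + w \<and> element_at p (int i) = Arrow} = num_arrows (bow_on d p)"
    by (auto simp: num_arrows_def length_filter_conv_card bow_on_def intro!: arg_cong[where f = card])
  finally show ?thesis by simp
qed

lemma num_xpoints_bow_on [simp]: "lattice_path p \<Longrightarrow> num_xpoints (bow_on d p) = w"
  using len_split[of "bow_on d p"] by simp

text \<open>
  In a separated diagram the path first makes all its n steps for arrows, then all w steps for
  x-points.
\<close>

lemma labelling_corner:
  assumes p: "lattice_path p" and r: "is_labelling (bow_on d p) r" and m: "m \<le> n + w"
  shows "p (int r - 1 + int m) = p (int r - 1) + int (min m n)"
  using m
proof (induction m)
  case (Suc m)
  have el: "element_at p (int r + int m) = (if m < n then Arrow else XPoint)"
  proof -
    have "element_at p (int r + int m) = elts (bow_on d p) ! ((r + m) mod (n + w))"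
      using elts_bow_on_mod[OF p, of "(r + m) mod (n + w)" "int r + int m"] n_pos by (simp add: of_nat_mod)
    also have "\<dots> = (if m < n then Arrow else XPoint)"
    proof (cases "m < n")
      case True then show ?thesis using r p by (simp add: is_labelling_def)
    next
      case False
      then show ?thesis using r p Suc.prems unfolding is_labelling_def
        by (auto dest!: spec[of _ "m - n"] simp: add.assoc)
    qed
    finally show ?thesis .
  qed
  have "p (int r - 1 + int (Suc m)) = p (int r - 1 + int m) + (if element_at p (int r + int m) = Arrow then 1 else 0)"
    using element_at_step[OF p, of "int r + int m"] by (simp add: algebra_simps)
  then show ?case using Suc el by auto
qed simp

lemma label_dims:
  assumes p: "lattice_path p" and d: "surface d" and r: "is_labelling (bow_on d p) r"
  defines "i0 \<equiv> p (int r - 1) + int n" and "j0 \<equiv> int r - 1 - p (int r - 1)"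
  shows "\<lbrakk>0 \<le> s; s \<le> int n\<rbrakk> \<Longrightarrow> label_dim (bow_on d p) r s = d (i0 - s) j0"
    and "\<lbrakk>0 \<le> k; k \<le> int w\<rbrakk> \<Longrightarrow> label_dim (bow_on d p) r (- k) = d i0 (j0 + k)"
proof -
  have *: "label_dim (bow_on d p) r s = dim_at d p (int r - 1 + int (nat (int n - s)))" if "s \<le> int n" for s
  proof -
    have "nat ((int r + int n - 1 - s) mod N) < n + w" using N_ge_2 by (simp add: nat_less_iff)
    moreover have "int (nat ((int r + int n - 1 - s) mod N)) = (int r + int n - 1 - s) mod N" using N_ge_2 by simp
    ultimately have "label_dim (bow_on d p) r s = dim_at d p (int r + int n - 1 - s)"
      unfolding label_dim_def num_arrows_bow_on[OF p] len_bow_on by (rule dims_bow_on_mod[OF p d])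
    then show ?thesis using that by (simp add: algebra_simps)
  qed
  show "label_dim (bow_on d p) r s = d (i0 - s) j0" if "0 \<le> s" "s \<le> int n"
  proof -
    have "nat (int n - s) \<le> n + w" using that by linarith
    from labelling_corner[OF p r this] have "p (int r - 1 + int (nat (int n - s))) = i0 - s"
      using that by (simp add: i0_def min_def)
    moreover have "int r - 1 + int (nat (int n - s)) - (i0 - s) = j0" using that by (simp add: i0_def j0_def)
    ultimately show ?thesis using *[OF that(2)] by (simp only: dim_at_def)
  qed
  show "label_dim (bow_on d p) r (- k) = d i0 (j0 + k)" if "0 \<le> k" "k \<le> int w"
  proof -
    have "nat (int n + k) \<le> n + w" using that by linarith
    from labelling_corner[OF p r this] have "p (int r - 1 + int (nat (int n + k))) = p (int r - 1) + int (min (nat (int n + k)) n)" .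
    moreover have "min (nat (int n + k)) n = n" using that by arith
    ultimately have "p (int r - 1 + int (nat (int n + k))) = i0" by (simp only: i0_def)
    moreover have "int r - 1 + int (nat (int n + k)) - i0 = j0 + k" using that by (simp add: i0_def j0_def)
    moreover have "label_dim (bow_on d p) r (- k) = dim_at d p (int r - 1 + int (nat (int n + k)))"
      using *[of "- k"] that by simp
    ultimately show ?thesis by (simp only: dim_at_def)
  qed
qed

text \<open>
  The two families of inequalities are the values of d in the two quadrants that are not adjacent
  to the path at its corner.
\<close>

lemma susy_inequalities_at_iff:
  assumes p: "lattice_path p" and d: "surface d" and r: "is_labelling (bow_on d p) r"
  shows "susy_inequalities_at (bow_on d p) r \<longleftrightarrow> (\<forall>i j. 0 \<le> d i j)"
proof -
  define i0 where "i0 = p (int r - 1) + int n"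
  define j0 where "j0 = int r - 1 - p (int r - 1)"
  define v where "v = label_dim (bow_on d p) r"
  have vs: "v s = d (i0 - s) j0" if "0 \<le> s" "s \<le> int n" for s
    using label_dims(1)[OF p d r] that by (simp add: v_def i0_def j0_def)
  have vk: "v (- k) = d i0 (j0 + k)" if "0 \<le> k" "k \<le> int w" for k
    using label_dims(2)[OF p d r] that by (simp add: v_def i0_def j0_def)
  let ?E1 = "\<lambda>s k t. s * k + (t - 1) * (s * int w + k * int n) + ((t - 1) * (t - 2) div 2) * int w * int n
          + v s + v (- k) + (t - 1) * v (- int w) - t * v 0"
  let ?E2 = "\<lambda>s k t. s * k + (t - 1) * (s * int w + k * int n) + ((t - 1) * (t - 2) div 2) * int w * int n
          + v (int n - s) + v (- (int w - k)) + (t - 1) * v 0 - t * v (- int w)"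
  have E1: "d (i0 - s - a * int n) (j0 + k) = ?E1 s k (a + 1)"
    if "0 \<le> s" "s \<le> int n" "0 \<le> k" "k \<le> int w" "0 \<le> a" for s k a
    using surface_quadrant[OF d that(5), of i0 s j0 k] vs[OF that(1,2)] vk[OF that(3,4)] vs[of 0] vk[of "int w"] that
    by simp
  have E2: "d (i0 + s + a * int n) (j0 + int w - k) = ?E2 s k (a + 1)"
    if "0 \<le> s" "s \<le> int n" "0 \<le> k" "k \<le> int w" "0 \<le> a" for s k a
  proof -
    have A: "v (int n - s) = d (i0 + s) (j0 + int w)"
      using vs[of "int n - s"] that surface_period[OF d, of "i0 + s - int n" j0] by (simp add: algebra_simps)
    have B: "v (- (int w - k)) = d i0 (j0 + int w - k)" using vk[of "int w - k"] that by (simp add: algebra_simps)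
    have C: "v 0 = d i0 j0" "v (- int w) = d i0 (j0 + int w)" using vs[of 0] vk[of "int w"] by auto
    have m: "- (- i0 - s - a * int n) = i0 + s + a * int n" "- (- (j0 + int w) + k) = j0 + int w - k"
      "- (- i0 - s) = i0 + s" "- (- i0) = i0" "- (- (j0 + int w)) = j0 + int w" "- (- (j0 + int w) + int w) = j0"
      "a + 1 - 1 = a" "a + 1 - 2 = a - 1" by simp_all
    show ?thesis
      unfolding A B C using surface_quadrant[OF surface_reflect[OF d] that(5), of "- i0" s "- (j0 + int w)" k]
      unfolding m .
  qed
  have "susy_inequalities_at (bow_on d p) r \<longleftrightarrow>
     (\<forall>s\<in>{0..int n}. \<forall>k\<in>{0..int w}. \<forall>t\<ge>1. ?E1 s k t \<ge> 0 \<and> ?E2 s k t \<ge> 0)"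
    unfolding susy_inequalities_at_def Let_def num_arrows_bow_on[OF p] num_xpoints_bow_on[OF p] v_def ..
  also have "\<dots> \<longleftrightarrow> (\<forall>i j. 0 \<le> d i j)"
  proof
    assume H: "\<forall>s\<in>{0..int n}. \<forall>k\<in>{0..int w}. \<forall>t\<ge>1. ?E1 s k t \<ge> 0 \<and> ?E2 s k t \<ge> 0"
    show "\<forall>i j. 0 \<le> d i j"
    proof (intro allI, rule nonneg_from_quadrants[OF d, of i0 j0])
      fix s k a :: int assume a: "0 \<le> s" "s \<le> int n" "0 \<le> k" "k \<le> int w" "0 \<le> a"
      then have "s \<in> {0..int n}" "k \<in> {0..int w}" "1 \<le> a + 1" by auto
      with H have "?E1 s k (a + 1) \<ge> 0 \<and> ?E2 s k (a + 1) \<ge> 0" by blast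
      then show "0 \<le> d (i0 - s - a * int n) (j0 + k)" "0 \<le> d (i0 + s + a * int n) (j0 + int w - k)"
        unfolding E1[OF a] E2[OF a] by blast+
    qed
  next
    assume H: "\<forall>i j. 0 \<le> d i j"
    show "\<forall>s\<in>{0..int n}. \<forall>k\<in>{0..int w}. \<forall>t\<ge>1. ?E1 s k t \<ge> 0 \<and> ?E2 s k t \<ge> 0"
    proof (intro ballI allI impI)
      fix s k t :: int assume a: "s \<in> {0..int n}" "k \<in> {0..int w}" "1 \<le> t"
      have "0 \<le> d (i0 - s - (t - 1) * int n) (j0 + k)" "0 \<le> d (i0 + s + (t - 1) * int n) (j0 + int w - k)" using H by auto
      then show "?E1 s k t \<ge> 0 \<and> ?E2 s k t \<ge> 0" using E1[of s k "t - 1"] E2[of s k "t - 1"] a by simp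
    qed
  qed
  finally show ?thesis .
qed

text \<open>
  Writing positions as N q + m, the path n q + min n m goes through all arrows first.
\<close>

lemma separated_path: obtains p where "lattice_path p" "\<And>d. separated (bow_on d p)"
proof -
  define h where "h y = int n * (y div N) + min (int n) (y mod N)" for y
  have h: "h (N * q + m) = int n * q + min (int n) m" if "0 \<le> m" "m \<le> N" for q m
  proof (cases "m = N")
    case True
    have e: "N * q + m = N * (q + 1)" unfolding True by (simp only: distrib_left mult_1_right)
    have "N * (q + 1) div N = q + 1" by (rule nonzero_mult_div_cancel_left) (use N_ge_2 in linarith)
    moreover have "N * (q + 1) mod N = 0" by (rule mod_mult_self1_is_0)
    ultimately have "h (N * q + m) = int n * (q + 1) + min (int n) 0" unfolding h_def e by (simp only:)
    then show ?thesis using True by (simp add: algebra_simps)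
  next
    case False
    then have "m < N" using that by simp
    have "(N * q + m) div N = q" using that \<open>m < N\<close> by (intro int_div_pos_eq) auto
    moreover have "(N * q + m) mod N = m" using that \<open>m < N\<close> by (intro int_mod_pos_eq) auto
    ultimately show ?thesis unfolding h_def by (simp only:)
  qed
  define p where "p k = h (k + 1)" for k
  have "lattice_path p" unfolding lattice_path_def
  proof (intro conjI allI)
    fix k
    define q m where "q = k div N" and "m = k mod N"
    have k: "k = N * q + m" by (simp add: q_def m_def del: of_nat_add)
    have m: "0 \<le> m" "m + 1 \<le> N" using pos_mod_bound[of N k] pos_mod_sign[of N k] N_ge_2 unfolding m_def by linarith+
    have pk: "p k = int n * q + min (int n) (m + 1)" using h[of "m + 1" q] m by (simp only: p_def k add.assoc)
    have "p (k - 1) = int n * q + min (int n) m" using h[of m q] m by (simp add: p_def k)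
    then show "p k = p (k - 1) \<or> p k = p (k - 1) + 1" using pk by auto
    have "k + N + 1 = N * (q + 1) + (m + 1)" unfolding k by (simp only: distrib_left mult_1_right)
    then have "p (k + N) = int n * (q + 1) + min (int n) (m + 1)" using h[of "m + 1" "q + 1"] m by (simp only: p_def)
    then show "p (k + N) = p k + int n" using pk by (simp add: algebra_simps)
  qed
  moreover have "separated (bow_on d p)" for d
  proof -
    have pv: "p (int i) = min (int n) (int i + 1)" "p (int i - 1) = min (int n) (int i)" if "i < n + w" for i
      using h[of "int i + 1" 0] h[of "int i" 0] that by (simp_all add: p_def)
    have el: "elts (bow_on d p) ! i = (if i < n then Arrow else XPoint)" if "i < n + w" for i
      using that pv[OF that] by (auto simp: element_at_def)
    have "n - 1 \<in> wavy_lines (bow_on d p)"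
      using n_pos \<open>lattice_path p\<close> el[of "n - 1"] by (simp add: wavy_lines_def del: elts_bow_on)
    moreover have "lies_on (bow_on d p) i (n - 1)" if i: "i < n + w" "elts (bow_on d p) ! i = XPoint" for i
      unfolding lies_on_def
    proof (intro exI[of _ "i + 1 - n"] conjI ballI)
      have ni: "n \<le> i" using i el[OF i(1)] by (simp split: if_splits)
      then show "(n - 1 + (i + 1 - n)) mod len (bow_on d p) = i" using n_pos i by simp
      fix j assume j: "j \<in> {1..i + 1 - n}"
      then have "n - 1 + j < n + w" "\<not> n - 1 + j < n" using i n_pos ni by auto
      then show "elts (bow_on d p) ! ((n - 1 + j) mod len (bow_on d p)) \<noteq> Arrow"
        using el[of "n - 1 + j"] by (simp del: elts_bow_on)
    qed
    ultimately show ?thesis unfolding separated_def by auto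
  qed
  ultimately show ?thesis using that by blast
qed

lemma nonneg_iff_susy_inequalities:
  assumes p: "lattice_path p" and d: "surface d"
  shows "(\<forall>i j. 0 \<le> d i j) \<longleftrightarrow>
     (\<forall>U. hw_equivalent (bow_on d p) U \<and> separated U \<longrightarrow> susy_inequalities U)"
proof
  assume nn: "\<forall>i j. 0 \<le> d i j"
  show "\<forall>U. hw_equivalent (bow_on d p) U \<and> separated U \<longrightarrow> susy_inequalities U"
  proof (intro allI impI)
    fix U assume U: "hw_equivalent (bow_on d p) U \<and> separated U"
    then obtain q where q: "lattice_path q" "U = bow_on d q" using hw_equivalent_stays_on_surface p d by blast
    then obtain r where "is_labelling U r" using U separated_has_labelling is_bow_on by blast
    then show "susy_inequalities U"
      using susy_inequalities_at_iff[OF q(1) d] nn q(2) unfolding susy_inequalities_def by blast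
  qed
next
  assume H: "\<forall>U. hw_equivalent (bow_on d p) U \<and> separated U \<longrightarrow> susy_inequalities U"
  obtain q where q: "lattice_path q" "\<And>d. separated (bow_on d q)" using separated_path by blast
  then have "susy_inequalities (bow_on d q)" using H hw_equivalent_bow_on[OF d p] by blast
  then show "\<forall>i j. 0 \<le> d i j" using susy_inequalities_at_iff[OF q(1) d] unfolding susy_inequalities_def by blast
qed

text \<open>
  Transfers a property from list indices to the unrolled circle.
\<close>

lemma periodic_forall:
  assumes p: "lattice_path p" and per: "\<And>x. f (x + N) = f x" and val: "\<And>i. i < n + w \<Longrightarrow> P (f (int i))"
  shows "P (f x)"
proof -
  have "nat (x mod N) < n + w" "int (nat (x mod N)) = x mod N" using N_ge_2 by (simp_all add: nat_less_iff)
  then show ?thesis using val[of "nat (x mod N)"] periodic_mod[of f N x, OF per] by (simp only:)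
qed

section \<open>Subdiagrams with the same jumps\<close>

text \<open>
  The difference of the two surfaces has no mixed difference, and equal jumps make it constant in
  j along the path. So it depends on i only. It is nonnegative since the path meets every i.
\<close>

lemma nonneg_of_subdiagram:
  assumes p: "lattice_path p" and d: "surface d" and d': "surface d'"
    and nn: "\<And>i j. 0 \<le> d' i j"
    and sub: "bow_subdiagram (bow_on d' p) (bow_on d p)" and jumps: "same_jumps (bow_on d' p) (bow_on d p)"
  shows "0 \<le> d i j"
proof -
  define e where "e i j = d i j - d' i j" for i j
  have e: "e i j = e i j' + e i' j - e i' j'" for i j i' j'
    using surface_separates[OF d, of i j j' i'] surface_separates[OF d', of i j j' i'] by (simp add: e_def)
  define E where "E x = e (p x) (x - p x)" for x
  have E: "E x = dim_at d p x - dim_at d' p x" for x by (simp add: E_def e_def dim_at_def)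
  have perE: "E (x + N) = E x" for x using dim_at_period[OF p d] dim_at_period[OF p d'] by (simp only: E)
  have E0: "0 \<le> E x" for x
    by (rule periodic_forall[of p E "\<lambda>y. 0 \<le> y", OF p perE]) (use sub in \<open>simp add: bow_subdiagram_def E\<close>)
  have "element_at p x = XPoint \<longrightarrow> E x = E (x - 1)" for x
  proof -
    have "x + N - 1 = x - 1 + N" for x by simp
    then have per: "(element_at p (x + N), E (x + N) - E (x + N - 1)) = (element_at p x, E x - E (x - 1))" for x
      using perE[of x] perE[of "x - 1"] element_at_period[OF p, of x] by (simp only:)
    have "(\<lambda>(a, y). a = XPoint \<longrightarrow> y = 0) (element_at p x, E x - E (x - 1))"
      by (rule periodic_forall[of p "\<lambda>x. (element_at p x, E x - E (x - 1))" "\<lambda>(a, y). a = XPoint \<longrightarrow> y = 0", OF p per])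
        (use jumps dims_prv[OF p d] dims_prv[OF p d'] in \<open>auto simp: same_jumps_def E prv_def\<close>)
    then show ?thesis by simp
  qed
  then have Ex: "E x = E (x - 1)" if "p x = p (x - 1)" for x using that by (simp add: element_at_def)
  obtain k where k: "p k = i" by (rule path_surj[OF p])
  interpret swap: periodic_lattice w n by unfold_locales (rule w_pos n_pos)+
  obtain l where l: "l - p l = j" by (rule swap.path_surj[OF swap_path[OF p]])
  have "e i (x - p x) = e i (x - 1 - p (x - 1))" for x
  proof (cases "p x = p (x - 1)")
    case True
    have "e i (x - p x) - e i (x - 1 - p (x - 1)) = E x - E (x - 1)"
      using e[of i "x - p x" "x - 1 - p x" "p x"] True by (simp add: E_def)
    then show ?thesis using Ex[OF True] by simp
  next
    case False
    then have "p x = p (x - 1) + 1" using path_step[OF p, of x] by simp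
    then show ?thesis by (simp add: algebra_simps)
  qed
  from int_step_constant[of "\<lambda>x. e i (x - p x)" l k, OF this]
  have "e i j = e i (k - p k)" using l by simp
  also have "\<dots> = E k" using k by (simp add: E_def)
  finally show ?thesis using E0[of k] nn[of i j] by (simp add: e_def)
qed

text \<open>
  With d = F + G on the path q, the surface d - F has the value G(j) on q, which does not change
  at arrows.
\<close>

lemma nonneg_surface_subdiagram:
  assumes p: "lattice_path p" and d: "surface d" and nn: "\<And>i j. 0 \<le> d i j"
  obtains d' q where "surface d'" "\<forall>i j. 0 \<le> d' i j" "lattice_path q"
    "bow_subdiagram (bow_on d' p) (bow_on d p)" "same_jumps (bow_on d' p) (bow_on d p)"
    "balanced (bow_on d' q)" "decomposable (bow_on d q)"
proof -
  obtain F G q where q: "lattice_path q" and dq: "\<And>k. d (q k) (k - q k) = F (q k) + G (k - q k)"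
    and F0: "\<And>i. 0 \<le> F i" and G0: "\<And>j. 0 \<le> G j" and Fp: "\<And>i. F (i + int n) = F i" and Gp: "\<And>j. G (j + int w) = G j"
    and Fle: "\<And>i j. F i \<le> d i j"
    using nonneg_surface_decomposition[OF d nn] by force
  define d' where "d' i j = d i j - F i" for i j
  have s: "surface d'" using d Fp by (simp add: surface_def d'_def)
  have d'q: "dim_at d' q k = G (k - q k)" for k using dq[of k] by (simp add: dim_at_def d'_def)
  have 1: "bow_subdiagram (bow_on d' p) (bow_on d p)"
    unfolding bow_subdiagram_def
  proof (intro conjI allI impI)
    show "elts (bow_on d' p) = elts (bow_on d p)" by (simp add: bow_on_def)
  qed (use F0 in \<open>simp_all add: is_bow_on dim_at_def d'_def\<close>)
  have 2: "same_jumps (bow_on d' p) (bow_on d p)"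
  proof -
    have "prv (bow_on d p) = prv (bow_on d' p)" by (rule ext) (simp add: prv_def)
    then have "dims (bow_on d' p) ! prv (bow_on d p) i = dim_at d' p (int i - 1)" for i
      using dims_prv[OF p s, of i] by simp
    then show ?thesis unfolding same_jumps_def
      by (auto simp: dims_prv[OF p d] dim_at_def d'_def element_at_def[of p] split: if_splits)
  qed
  have 3: "balanced (bow_on d' q)"
    unfolding balanced_def
  proof (intro allI impI)
    fix i assume i: "i < len (bow_on d' q)" "elts (bow_on d' q) ! i = Arrow"
    then have "q (int i) = q (int i - 1) + 1" using element_at_step[OF q, of "int i"] by simp
    then show "dims (bow_on d' q) ! prv (bow_on d' q) i = dims (bow_on d' q) ! i"
      using i dims_prv[OF q s] by (simp add: d'q algebra_simps)
  qed
  have qp: "q (x + N) = q x + int n" for x by (rule path_period[OF q])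
  have per: "F (q (x + N)) = F (q x)" "G (x + N - q (x + N)) = G (x - q x)" for x
  proof -
    show "F (q (x + N)) = F (q x)" by (simp only: qp Fp)
    have "x + N - (q x + int n) = x - q x + int w" by simp
    then show "G (x + N - q (x + N)) = G (x - q x)" by (simp only: qp Gp)
  qed
  have 4: "decomposable (bow_on d q)"
    unfolding decomposable_def
  proof (rule exI[of _ "\<lambda>k. nat (F (q (int k)))"], rule exI[of _ "\<lambda>k. nat (G (int k - q (int k)))"], intro allI impI conjI)
    fix k assume k: "k < len (bow_on d q)"
    show "dims (bow_on d q) ! k = int (nat (F (q (int k))) + nat (G (int k - q (int k))))"
      using k F0 G0 dq[of "int k"] by (simp add: dim_at_def)
    have Fm: "F (q (int (prv (bow_on d q) k))) = F (q (int k - 1))"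
      using periodic_mod[of "\<lambda>x. F (q x)" N "int k - 1", OF per(1)] by (simp only: int_prv)
    have Gm: "G (int (prv (bow_on d q) k) - q (int (prv (bow_on d q) k))) = G (int k - 1 - q (int k - 1))"
      using periodic_mod[of "\<lambda>x. G (x - q x)" N "int k - 1", OF per(2)] by (simp only: int_prv)
    show "nat (F (q (int (prv (bow_on d q) k)))) = nat (F (q (int k)))" if "elts (bow_on d q) ! k = XPoint"
      unfolding Fm using that k element_at_step[OF q, of "int k"] by simp
    show "nat (G (int (prv (bow_on d q) k) - q (int (prv (bow_on d q) k)))) = nat (G (int k - q (int k)))"
      if "elts (bow_on d q) ! k = Arrow"
      unfolding Gm using that k element_at_step[OF q, of "int k"] by (simp add: algebra_simps)
  qed
  have nn': "\<forall>i j. 0 \<le> d' i j" using Fle by (simp add: d'_def)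
  show ?thesis by (rule that[OF s nn' q 1 2 3 4])
qed

end

section \<open>Classes of diagrams with nonnegative dimensions\<close>

definition always_originates :: "bow \<Rightarrow> bool" where
  "always_originates Q \<longleftrightarrow> (\<forall>U. hw_equivalent Q U \<longrightarrow> originates_from_brane U)"

lemma one_type_hw_equivalent:
  assumes "num_arrows D = 0 \<or> num_xpoints D = 0"
  shows "hw_equivalent D U \<longleftrightarrow> U = D"
proof
  have "\<not> hw_transition D E" for E
  proof
    assume "hw_transition D E"
    then obtain i where i: "i < len D" "elts D ! i \<noteq> elts D ! nxt D i" unfolding hw_transition_def by blast
    then have "nxt D i < len D" by (simp add: nxt_def)
    then show False using i assms num_arrows_0_iff[of D] num_xpoints_0_iff[of D] by auto
  qed
  then show "hw_equivalent D U \<Longrightarrow> U = D" unfolding hw_equivalent_def by (metis converse_rtranclpE)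
qed (simp add: hw_equivalent_def)

lemma one_type_separated:
  assumes "is_bow D" "num_arrows D = 0 \<or> num_xpoints D = 0"
  shows "separated D"
proof (cases "num_arrows D = 0")
  case True
  then have X: "\<forall>i<len D. elts D ! i = XPoint" by (simp add: num_arrows_0_iff)
  have "lies_on D i 0" if "i < len D" for i
    unfolding lies_on_def using X that by (intro exI[of _ i]) auto
  then show ?thesis using True by (auto simp: separated_def wavy_lines_def)
next
  case False
  then have X: "\<forall>i<len D. elts D ! i = Arrow" using assms(2) by (simp add: num_xpoints_0_iff[symmetric])
  moreover have "len D > 0" using assms(1) by (simp add: is_bow_def len_def)
  ultimately have "0 \<in> wavy_lines D" "\<forall>i<len D. elts D ! i = XPoint \<longrightarrow> lies_on D i 0"
    using False unfolding wavy_lines_def by auto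
  then show ?thesis unfolding separated_def by (rule bexI[rotated])
qed

text \<open>
  Without x-points the labels 0 and -w denote the same dimension, and without arrows they denote
  dimensions of the same segment. The terms with t cancel, and a single dimension remains.
\<close>

lemma one_type_susy_inequalities_at:
  assumes D: "is_bow D" and one: "num_arrows D = 0 \<or> num_xpoints D = 0"
  shows "susy_inequalities_at D r \<longleftrightarrow> originates_from_brane D"
proof -
  define n w where "n = int (num_arrows D)" and "w = int (num_xpoints D)"
  define v where "v = label_dim D r"
  have L: "int (len D) = n + w" using len_split[of D] by (simp add: n_def w_def)
  have "0 < int (len D)" using D by (simp add: is_bow_def len_def)
  then have Lpos: "n + w > 0" unfolding L .
  have v: "v s = dims D ! nat ((int r + n - 1 - s) mod (n + w))" for s by (simp add: v_def label_dim_def n_def L)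
  have v0: "v (- w) = v 0" if "n = 0" using that by (simp add: v)
  have S: "susy_inequalities_at D r \<longleftrightarrow> (\<forall>s\<in>{0..n}. \<forall>k\<in>{0..w}. \<forall>t\<ge>1.
        s * k + (t - 1) * (s * w + k * n) + ((t - 1) * (t - 2) div 2) * w * n
          + v s + v (- k) + (t - 1) * v (- w) - t * v 0 \<ge> 0 \<and>
        s * k + (t - 1) * (s * w + k * n) + ((t - 1) * (t - 2) div 2) * w * n
          + v (n - s) + v (- (w - k)) + (t - 1) * v 0 - t * v (- w) \<ge> 0)" (is "_ \<longleftrightarrow> ?R")
    unfolding susy_inequalities_at_def Let_def n_def w_def v_def ..
  show ?thesis
  proof
    assume "originates_from_brane D"
    then have nn: "0 \<le> v s" for s using Lpos L unfolding v originates_from_brane_def by (simp add: nat_less_iff)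
    show "susy_inequalities_at D r" unfolding S
    proof (intro ballI allI impI)
      fix s k t :: int assume a: "s \<in> {0..n}" "k \<in> {0..w}" "1 \<le> t"
      show "s * k + (t - 1) * (s * w + k * n) + ((t - 1) * (t - 2) div 2) * w * n
          + v s + v (- k) + (t - 1) * v (- w) - t * v 0 \<ge> 0 \<and>
        s * k + (t - 1) * (s * w + k * n) + ((t - 1) * (t - 2) div 2) * w * n
          + v (n - s) + v (- (w - k)) + (t - 1) * v 0 - t * v (- w) \<ge> 0"
      proof (cases "n = 0")
        case True
        then have "s = 0" using a by simp
        then show ?thesis using True nn v0 by (simp add: algebra_simps)
      next
        case False
        then have "w = 0" using one by (auto simp: n_def w_def)
        moreover from this have "k = 0" using a by simp
        ultimately show ?thesis using nn by (simp add: algebra_simps)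
      qed
    qed
  next
    assume H: "susy_inequalities_at D r"
    have H1: "s * k + v s + v (- k) - v 0 \<ge> 0" if "s \<in> {0..n}" "k \<in> {0..w}" for s k
      using H[unfolded S, rule_format, OF that, of 1] by simp
    show "originates_from_brane D" unfolding originates_from_brane_def
    proof (intro allI impI)
      fix i assume i: "i < len D"
      define y where "y = (int r + n - 1 - int i) mod (n + w)"
      have y: "0 \<le> y" "y < n + w" using Lpos by (simp_all add: y_def)
      have "(int r + n - 1 - y) mod (n + w) = int i"
        using i L by (simp add: y_def mod_simps)
      then have vy: "v y = dims D ! i" by (simp add: v)
      show "0 \<le> dims D ! i"
      proof (cases "n = 0")
        case True
        have "v (- (w - y)) = v y"
        proof -
          have "int r + n - 1 - - (w - y) = int r + n - 1 - y + (n + w)" using True by simp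
          then show ?thesis unfolding v by (simp only: mod_add_self2)
        qed
        then show ?thesis using H1[of 0 "w - y"] y True vy by simp
      next
        case False
        then have "w = 0" using one by (auto simp: n_def w_def)
        then show ?thesis using H1[of y 0] y vy by simp
      qed
    qed
  qed
qed

lemma always_originates_iff_susy_inequalities:
  assumes Q: "is_bow Q"
  shows "always_originates Q \<longleftrightarrow> (\<forall>U. hw_equivalent Q U \<and> separated U \<longrightarrow> susy_inequalities U)"
proof (cases "num_arrows Q = 0 \<or> num_xpoints Q = 0")
  case True
  have "\<exists>r. is_labelling Q r" by (rule separated_has_labelling[OF Q one_type_separated[OF Q True]])
  then have "susy_inequalities Q \<longleftrightarrow> originates_from_brane Q"
    unfolding susy_inequalities_def one_type_susy_inequalities_at[OF Q True] by blast
  then show ?thesis unfolding always_originates_def one_type_hw_equivalent[OF True]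
    using one_type_separated[OF Q True] by blast
next
  case False
  then interpret periodic_lattice "num_arrows Q" "num_xpoints Q" by unfold_locales auto
  have "1 \<le> num_arrows Q" "1 \<le> num_xpoints Q" using False by auto
  then obtain d p where p: "lattice_path p" and d: "surface d" and e: "Q = bow_on d p"
    by (rule bow_on_exists[OF Q])
  show ?thesis unfolding always_originates_def
    using trans[OF all_equivalent_originate_iff[OF p d] nonneg_iff_susy_inequalities[OF p d]] unfolding e[symmetric] .
qed

lemma always_originates_decomposable:
  assumes Q: "is_bow Q" and c: "always_originates Q"
  shows "\<exists>U. hw_equivalent Q U \<and> decomposable U"
proof (cases "num_arrows Q = 0 \<or> num_xpoints Q = 0")
  case True
  have nn: "\<forall>i<len Q. 0 \<le> dims Q ! i"
    using c one_type_hw_equivalent[OF True] by (simp add: always_originates_def originates_from_brane_def)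
  have "decomposable Q"
  proof (cases "num_arrows Q = 0")
    case True
    then show ?thesis unfolding decomposable_def using nn
      by - (rule exI[of _ "\<lambda>_. 0"], rule exI[of _ "\<lambda>k. nat (dims Q ! k)"], auto simp: num_arrows_0_iff)
  next
    case False
    then have "\<forall>i<len Q. elts Q ! i = Arrow" using True by (simp add: num_xpoints_0_iff[symmetric])
    then show ?thesis unfolding decomposable_def using nn
      by - (rule exI[of _ "\<lambda>k. nat (dims Q ! k)"], rule exI[of _ "\<lambda>_. 0"], auto)
  qed
  then show ?thesis using one_type_hw_equivalent[OF True] by blast
next
  case False
  then interpret periodic_lattice "num_arrows Q" "num_xpoints Q" by unfold_locales auto
  have "1 \<le> num_arrows Q" "1 \<le> num_xpoints Q" using False by auto
  then obtain d p where p: "lattice_path p" and d: "surface d" and e: "Q = bow_on d p"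
    by (rule bow_on_exists[OF Q])
  have nn: "0 \<le> d i j" for i j
    using c all_equivalent_originate_iff[OF p d] unfolding always_originates_def e[symmetric] by blast
  obtain q where "lattice_path q" "decomposable (bow_on d q)"
    using nonneg_surface_subdiagram[OF p d nn] by metis
  then show ?thesis using hw_equivalent_bow_on[OF d p] unfolding e[symmetric] by blast
qed

text \<open>
  Without x-points there are no jumps to preserve, and the zero diagram serves as subdiagram.
\<close>

lemma always_originates_subdiagram:
  assumes Q: "is_bow Q" and c: "always_originates Q" and U: "hw_equivalent Q U"
  shows "\<exists>U' V. bow_subdiagram U' U \<and> same_jumps U' U \<and> always_originates U' \<and> hw_equivalent U' V \<and> balanced V"
proof (cases "num_arrows Q = 0 \<or> num_xpoints Q = 0")
  case True
  then have UQ: "U = Q" using U one_type_hw_equivalent by blast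
  have nn: "\<forall>i<len Q. 0 \<le> dims Q ! i"
    using c one_type_hw_equivalent[OF True] by (simp add: always_originates_def originates_from_brane_def)
  show ?thesis
  proof (cases "num_arrows Q = 0")
    case True
    then have "balanced Q" by (simp add: balanced_def num_arrows_0_iff)
    then show ?thesis unfolding UQ using Q c
      by (intro exI[of _ Q]) (simp add: bow_subdiagram_def same_jumps_def hw_equivalent_def)
  next
    case False
    then have w0: "num_xpoints Q = 0" using True by simp
    define Z where "Z = \<lparr>elts = elts Q, dims = replicate (len Q) 0\<rparr>"
    have lZ: "len Z = len Q" "num_xpoints Z = 0" using w0 by (simp_all add: Z_def len_def num_xpoints_def)
    have dZ: "dims Z ! i = 0" if "i < len Q" for i using that by (simp add: Z_def)
    have pZ: "prv Z i < len Q" if "i < len Q" for i using that lZ by (simp add: prv_def)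
    have "bow_subdiagram Z Q" using Q nn by (auto simp: bow_subdiagram_def Z_def is_bow_def len_def)
    moreover have "same_jumps Z Q" using w0 by (simp add: same_jumps_def num_xpoints_0_iff)
    moreover have "balanced Z" unfolding balanced_def lZ using dZ pZ by simp
    moreover have "always_originates Z"
      using one_type_hw_equivalent[of Z] lZ dZ by (simp add: always_originates_def originates_from_brane_def)
    ultimately show ?thesis unfolding UQ by (intro exI[of _ Z]) (simp add: hw_equivalent_def)
  qed
next
  case False
  then interpret periodic_lattice "num_arrows Q" "num_xpoints Q" by unfold_locales auto
  have "1 \<le> num_arrows Q" "1 \<le> num_xpoints Q" using False by auto
  then obtain d p where p: "lattice_path p" and d: "surface d" and e: "Q = bow_on d p"
    by (rule bow_on_exists[OF Q])
  have nn: "0 \<le> d i j" for i j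
    using c all_equivalent_originate_iff[OF p d] unfolding always_originates_def e[symmetric] by blast
  obtain p' where p': "lattice_path p'" and U': "U = bow_on d p'"
    using hw_equivalent_stays_on_surface[OF _ p d] U unfolding e[symmetric] by blast
  obtain d' q where d': "surface d'" and nn': "\<forall>i j. 0 \<le> d' i j" and q: "lattice_path q"
    and sub: "bow_subdiagram (bow_on d' p') (bow_on d p')" "same_jumps (bow_on d' p') (bow_on d p')"
    and bal: "balanced (bow_on d' q)"
    using nonneg_surface_subdiagram[OF p' d nn] by metis
  have "always_originates (bow_on d' p')"
    unfolding always_originates_def using all_equivalent_originate_iff[OF p' d'] nn' by blast
  then show ?thesis unfolding U' using sub bal hw_equivalent_bow_on[OF d' p' q] by blast
qed

lemma always_originates_of_subdiagrams:
  assumes Q: "is_bow Q"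
    and H: "\<And>U. hw_equivalent Q U \<Longrightarrow> separated U \<Longrightarrow>
      \<exists>U'. bow_subdiagram U' U \<and> same_jumps U' U \<and> always_originates U'"
  shows "always_originates Q"
proof (cases "num_arrows Q = 0 \<or> num_xpoints Q = 0")
  case True
  obtain U' where U': "bow_subdiagram U' Q" "always_originates U'"
    using H[of Q] one_type_separated[OF Q True] by (auto simp: hw_equivalent_def)
  then have "originates_from_brane U'" by (simp add: always_originates_def hw_equivalent_def)
  moreover have "len U' = len Q" using U'(1) by (simp add: bow_subdiagram_def len_def)
  ultimately have "originates_from_brane Q" using U'(1)
    unfolding originates_from_brane_def bow_subdiagram_def by (metis order_trans)
  then show ?thesis using one_type_hw_equivalent[OF True] by (simp add: always_originates_def)
next
  case False
  then interpret periodic_lattice "num_arrows Q" "num_xpoints Q" by unfold_locales auto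
  have "1 \<le> num_arrows Q" "1 \<le> num_xpoints Q" using False by auto
  then obtain d p where p: "lattice_path p" and d: "surface d" and e: "Q = bow_on d p"
    by (rule bow_on_exists[OF Q])
  obtain q where q: "lattice_path q" "\<And>d. separated (bow_on d q)" using separated_path by blast
  then have "hw_equivalent Q (bow_on d q)" using hw_equivalent_bow_on[OF d p q(1)] unfolding e[symmetric] by blast
  then obtain U' where U': "bow_subdiagram U' (bow_on d q)" "same_jumps U' (bow_on d q)" "always_originates U'"
    using H q(2) by blast
  have "is_bow U'" "elts U' = map (\<lambda>k. element_at q (int k)) [0..<num_arrows Q + num_xpoints Q]"
    using U'(1) by (simp_all add: bow_subdiagram_def bow_on_def)
  then obtain d' where d': "surface d'" and e': "U' = bow_on d' q" by (rule bow_on_surface[OF q(1)])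
  have nn': "0 \<le> d' i j" for i j
    using U'(3) all_equivalent_originate_iff[OF q(1) d'] unfolding always_originates_def e'[symmetric] by blast
  have "0 \<le> d i j" for i j
    using nonneg_of_subdiagram[OF q(1) d d' nn'] U' unfolding e' by blast
  then show ?thesis
    using all_equivalent_originate_iff[OF p d] unfolding always_originates_def e[symmetric] by blast
qed

section \<open>Supersymmetric brane diagrams under transitions\<close>

text \<open>
  The arcs passed by a D3-brane, counted with multiplicity, are the integers in an interval; those
  over arc k are the ones congruent to k.
\<close>

definition lifts :: "int \<Rightarrow> int \<Rightarrow> int \<Rightarrow> int \<Rightarrow> int set" where
  "lifts N k a b = {x. a \<le> x \<and> x < b \<and> x mod N = k}"

lemma passes_eq_lifts:
  "passes B k (p, l) = card (lifts (int (length (vertices B))) (int k) (int p) (int p + int l))"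
proof -
  have "bij_betw (\<lambda>m. int p + int m) {m. m < l \<and> (p + m) mod length (vertices B) = k}
     (lifts (int (length (vertices B))) (int k) (int p) (int p + int l))"
  proof (rule bij_betw_byWitness[where f' = "\<lambda>x. nat (x - int p)"])
    show "(\<lambda>m. int p + int m) ` {m. m < l \<and> (p + m) mod length (vertices B) = k}
       \<subseteq> lifts (int (length (vertices B))) (int k) (int p) (int p + int l)"
      by (auto simp: lifts_def zmod_int)
    show "(\<lambda>x. nat (x - int p)) ` lifts (int (length (vertices B))) (int k) (int p) (int p + int l)
       \<subseteq> {m. m < l \<and> (p + m) mod length (vertices B) = k}"
    proof (clarsimp simp: lifts_def)
      fix x assume x: "int p \<le> x" "x < int p + int l" "x mod int (length (vertices B)) = int k"
      then have "int (p + nat (x - int p)) = x" by simp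
      then have "int ((p + nat (x - int p)) mod length (vertices B)) = int k" using x(3) by (simp only: zmod_int)
      then show "nat (x - int p) < l \<and> (p + nat (x - int p)) mod length (vertices B) = k" using x by simp
    qed
  qed (auto simp: lifts_def)
  then show ?thesis unfolding passes_def by (simp add: bij_betw_same_card)
qed

lemma card_lifts_translate:
  assumes "N dvd t" shows "card (lifts N k (a + t) (b + t)) = card (lifts N k a b)"
proof -
  have "bij_betw (\<lambda>x. x + t) (lifts N k a b) (lifts N k (a + t) (b + t))"
  proof (rule bij_betw_byWitness[where f' = "\<lambda>x. x - t"])
    have 1: "(x + t) mod N = x mod N" for x using assms by auto
    then have 2: "(x - t) mod N = x mod N" for x using 1[of "x - t"] by simp
    show "(\<lambda>x. x + t) ` lifts N k a b \<subseteq> lifts N k (a + t) (b + t)" using 1 by (auto simp: lifts_def)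
    show "(\<lambda>x. x - t) ` lifts N k (a + t) (b + t) \<subseteq> lifts N k a b" using 2 by (auto simp: lifts_def)
  qed auto
  then show ?thesis by (simp add: bij_betw_same_card)
qed

text \<open>
  The exchange of the vertices i and i + 1 on the unrolled circle.
\<close>

definition swap_lift :: "int \<Rightarrow> int \<Rightarrow> int \<Rightarrow> int" where
  "swap_lift N i x = (if N dvd x - i then x + 1 else if N dvd x - 1 - i then x - 1 else x)"

context
  fixes N i :: int
  assumes N: "N \<ge> 2" and i: "0 \<le> i" "i < N"
begin

lemma consecutive_not_both_dvd: "N dvd x - i \<Longrightarrow> \<not> N dvd x - 1 - i"
proof
  assume "N dvd x - i" "N dvd x - 1 - i"
  then have "N dvd (x - i) - (x - 1 - i)" by (rule dvd_diff)
  then show False using N zdvd_imp_le[of N 1] by simp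
qed

lemma swap_lift_swap_lift [simp]: "swap_lift N i (swap_lift N i x) = x"
  using consecutive_not_both_dvd[of x] consecutive_not_both_dvd[of "x + 1"] by (auto simp: swap_lift_def)

lemma swap_lift_translate: "N dvd t \<Longrightarrow> swap_lift N i (x + t) = swap_lift N i x + t"
proof -
  assume t: "N dvd t"
  have "x + t - i = (x - i) + t" "x + t - 1 - i = (x - 1 - i) + t" by simp_all
  then have "N dvd x + t - i \<longleftrightarrow> N dvd x - i" "N dvd x + t - 1 - i \<longleftrightarrow> N dvd x - 1 - i"
    using t by (simp_all only: dvd_add_left_iff)
  then show ?thesis by (simp add: swap_lift_def)
qed

lemma dvd_iff_mod: "N dvd x - i \<longleftrightarrow> x mod N = i"
  using i by (metis mod_eq_dvd_iff mod_pos_pos_trivial)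

text \<open>
  Moving an end of an interval across the arc i only affects whether that arc belongs to it.
\<close>

lemma lifts_swap_other:
  assumes "k \<noteq> i" shows "lifts N k (swap_lift N i a) (swap_lift N i b) = lifts N k a b"
proof -
  have le: "(swap_lift N i y \<le> x) = (y \<le> x)" if "x mod N = k" for y x
  proof -
    have x: "\<not> N dvd x - i" using that assms dvd_iff_mod by simp
    then have "x \<noteq> y" if "N dvd y - i" using that by auto
    moreover have "x \<noteq> y - 1" if "N dvd y - 1 - i" using that x by auto
    ultimately show ?thesis by (auto simp: swap_lift_def)
  qed
  show ?thesis unfolding lifts_def not_le[symmetric] using le by auto
qed

lemma card_lifts_neighbour:
  "card (lifts N ((i + s) mod N) a b) = card {x. a \<le> x + s \<and> x + s < b \<and> N dvd x - i}"
proof -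
  have "bij_betw (\<lambda>x. x + s) {x. a \<le> x + s \<and> x + s < b \<and> N dvd x - i} (lifts N ((i + s) mod N) a b)"
  proof (rule bij_betw_byWitness[where f' = "\<lambda>x. x - s"])
    show "(\<lambda>x. x + s) ` {x. a \<le> x + s \<and> x + s < b \<and> N dvd x - i} \<subseteq> lifts N ((i + s) mod N) a b"
      by (auto simp: lifts_def mod_eq_dvd_iff)
    show "(\<lambda>x. x - s) ` lifts N ((i + s) mod N) a b \<subseteq> {x. a \<le> x + s \<and> x + s < b \<and> N dvd x - i}"
      by (auto simp: lifts_def mod_eq_dvd_iff algebra_simps)
  qed auto
  then show ?thesis by (simp add: bij_betw_same_card)
qed

text \<open>
  This is the rule v1 + v3 = v2 + v2' for a single D3-brane. It is additive in the two ends of the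
  brane, so it reduces to a statement about one half-line at each lift of the arc i. The excluded
  brane is the one that only consists of the arc i: it is responsible for the summand 1 in the
  rule for dimensions.
\<close>

lemma card_lifts_swap_here:
  assumes ab: "a < b" and ex: "\<not> (N dvd a - i \<and> b = a + 1)"
  shows "card (lifts N i a b) + card (lifts N i (swap_lift N i a) (swap_lift N i b)) =
     card (lifts N ((i - 1) mod N) a b) + card (lifts N ((i + 1) mod N) a b)"
proof -
  define W where "W = {x \<in> {a - 2..b + 2}. N dvd x - i}"
  have fin: "finite W" by (rule finite_subset[of _ "{a - 2..b + 2}"]) (auto simp: W_def)
  have c: "card {x. P x \<and> N dvd x - i} = (\<Sum>x\<in>W. of_bool (P x))" if "\<And>x. P x \<Longrightarrow> x \<in> {a - 2..b + 2}" for P :: "int \<Rightarrow> bool"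
  proof -
    have "{x. P x \<and> N dvd x - i} = W \<inter> {x. P x}" using that by (auto simp: W_def)
    then show ?thesis using fin by (simp add: of_bool_def sum.If_cases)
  qed
  have l: "lifts N i a b = {x. (a \<le> x \<and> x < b) \<and> N dvd x - i}" for a b
    by (auto simp: lifts_def dvd_iff_mod)
  have bd: "a - 1 \<le> swap_lift N i a" "swap_lift N i b \<le> b + 1" by (auto simp: swap_lift_def)
  have 1: "card (lifts N i a b) = (\<Sum>x\<in>W. of_bool (a \<le> x \<and> x < b))"
    unfolding l by (rule c) auto
  have 2: "card (lifts N i (swap_lift N i a) (swap_lift N i b)) = (\<Sum>x\<in>W. of_bool (swap_lift N i a \<le> x \<and> x < swap_lift N i b))"
    unfolding l by (rule c) (use bd in auto)
  have 3: "card (lifts N ((i - 1) mod N) a b) = (\<Sum>x\<in>W. of_bool (a \<le> x - 1 \<and> x - 1 < b))"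
    using card_lifts_neighbour[of "-1" a b] c[of "\<lambda>x. a \<le> x - 1 \<and> x - 1 < b"] by (simp add: conj_assoc)
  have 4: "card (lifts N ((i + 1) mod N) a b) = (\<Sum>x\<in>W. of_bool (a \<le> x + 1 \<and> x + 1 < b))"
    using card_lifts_neighbour[of 1 a b] c[of "\<lambda>x. a \<le> x + 1 \<and> x + 1 < b"] by (simp add: conj_assoc)
  have pt: "of_bool (a \<le> x \<and> x < b) + of_bool (swap_lift N i a \<le> x \<and> x < swap_lift N i b)
     = (of_bool (a \<le> x - 1 \<and> x - 1 < b) + of_bool (a \<le> x + 1 \<and> x + 1 < b) :: nat)" if x: "N dvd x - i" for x
  proof -
    \<comment> \<open>The half-line that starts at y.\<close>
    have h: "of_bool (y \<le> x) + of_bool (swap_lift N i y \<le> x) = (of_bool (y \<le> x - 1) + of_bool (y \<le> x + 1) :: int)" for y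
    proof -
      have n1: "\<not> N dvd y - i" if "y = x + 1" using that consecutive_not_both_dvd[of "x + 1"] x by auto
      have e1: "N dvd y - 1 - i" if "y = x + 1" using that x by simp
      have n2: "\<not> N dvd y - 1 - i" if "y = x" using that consecutive_not_both_dvd[of x] x by auto
      have n3: "\<not> N dvd y - 1 - i" if "y = x + 2" using that x consecutive_not_both_dvd[of "x + 1"] by (auto simp: algebra_simps)
      consider "y < x" | "y = x" | "y = x + 1" | "y \<ge> x + 2" by linarith
      then show ?thesis
      proof cases
        case 1 then show ?thesis by (auto simp: swap_lift_def)
      next
        case 2 then show ?thesis using x n2 by (auto simp: swap_lift_def)
      next
        case 3 then show ?thesis using n1 e1 by (auto simp: swap_lift_def)
      next
        case 4 then show ?thesis using n3 by (auto simp: swap_lift_def)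
      qed
    qed
    have iv: "of_bool (u \<le> z \<and> z < v) = (of_bool (u \<le> z) - of_bool (v \<le> z) :: int)" if "u \<le> v" for u v z :: int
      using that by auto
    have le: "swap_lift N i a \<le> swap_lift N i b" using ab ex by (auto simp: swap_lift_def)
    have "(of_bool (a \<le> x \<and> x < b) + of_bool (swap_lift N i a \<le> x \<and> x < swap_lift N i b)
     = (of_bool (a \<le> x - 1 \<and> x - 1 < b) + of_bool (a \<le> x + 1 \<and> x + 1 < b) :: int))"
      unfolding iv[OF less_imp_le[OF ab]] iv[OF le] using h[of a] h[of b] by linarith
    then show ?thesis by (simp only: of_bool_def of_nat_eq_iff[where 'a = int, symmetric] of_nat_add if_distrib[of int] of_nat_0 of_nat_1)
  qed
  show ?thesis unfolding 1 2 3 4 sum.distrib[symmetric]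
    by (rule sum.cong[OF refl]) (rule pt, simp add: W_def)
qed

lemma swap_lift_less:
  assumes "a < b" "\<not> (N dvd a - i \<and> b = a + 1)" shows "swap_lift N i a < swap_lift N i b"
proof -
  have "b \<noteq> a + 2" if "N dvd a - i" "N dvd b - 1 - i"
    using that consecutive_not_both_dvd[of "b - 1"] by auto
  moreover have "a \<noteq> b - 1" if "\<not> N dvd a - i" "N dvd b - 1 - i" using that by auto
  ultimately show ?thesis using assms consecutive_not_both_dvd[of a] consecutive_not_both_dvd[of b] by (auto simp: swap_lift_def)
qed

end

text \<open>
  The vertices, the orientation and the winding number of a fixed D3-brane determine its starting
  point and its length.
\<close>

definition fixed_once :: "brane \<Rightarrow> bool" where
  "fixed_once B \<longleftrightarrow> (\<forall>p l. p < length (vertices B) \<and> l > 0 \<and>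
     vertices B ! p \<noteq> vertices B ! ((p + l) mod length (vertices B)) \<longrightarrow> count (d3branes B) (p, l) \<le> 1)"

lemma size_filter_unique:
  assumes "\<And>c. c \<in># M \<Longrightarrow> P c \<longleftrightarrow> c = x" shows "size (filter_mset P M) = count M x"
proof -
  have "filter_mset P M = filter_mset (\<lambda>c. c = x) M" using assms by (intro filter_mset_cong) auto
  then show ?thesis by (simp add: filter_eq_replicate_mset)
qed

text \<open>
  The length is determined by its remainder and quotient modulo the number of vertices.
\<close>

lemma length_determined:
  fixes L :: nat
  assumes "p < L" "q < L" "p \<noteq> q"
  shows "(p + l) mod L = q \<and> l div L = t \<longleftrightarrow> l = t * L + (q + L - p) mod L"
proof -
  have r: "(q + L - p) mod L < L" using assms by simp
  have "(p + (t * L + (q + L - p) mod L)) mod L = (p + (q + L - p) mod L + t * L) mod L"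
    by (simp only: ac_simps)
  also have "\<dots> = (p + (q + L - p)) mod L" by (simp only: mod_mult_self1 mod_add_right_eq)
  finally have "(p + (t * L + (q + L - p) mod L)) mod L = (p + (q + L - p)) mod L" .
  then have 1: "(p + (t * L + (q + L - p) mod L)) mod L = q" using assms by simp
  have 2: "(t * L + (q + L - p) mod L) div L = t" using r by simp
  have "l = t * L + (q + L - p) mod L" if h: "(p + l) mod L = q" "l div L = t"
  proof -
    have "(q + L - p) mod L = l mod L"
    proof -
      have "q + L - p = (p + l) mod L + (L - p)" using h assms by simp
      then have "(q + L - p) mod L = (p + l + (L - p)) mod L" by (simp only: mod_add_left_eq)
      also have "p + l + (L - p) = l + L" using assms by simp
      finally show ?thesis by simp
    qed
    then show ?thesis using h(2) by (metis div_mult_mod_eq)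
  qed
  then show ?thesis using 1 2 by blast
qed

lemma supersymmetric_brane_iff:
  assumes B: "is_brane B"
  shows "supersymmetric_brane B \<longleftrightarrow> fixed_once B"
proof -
  define L V M where "L = length (vertices B)" and "V = vertices B" and "M = d3branes B"
  have val: "fst c < L \<and> snd c > 0" if "c \<in># M" for c
    using B that unfolding is_brane_def L_def M_def by (cases c) auto
  have key: "size {#c \<in># M. fst c = p \<and> d3_end B c = q \<and> winding B c = t#} = count M (p, t * L + (q + L - p) mod L)"
    if "p < L" "q < L" "p \<noteq> q" for p q t
  proof (rule size_filter_unique)
    fix c :: "nat \<times> nat"
    obtain a l where c: "c = (a, l)" by (cases c)
    show "fst c = p \<and> d3_end B c = q \<and> winding B c = t \<longleftrightarrow> c = (p, t * L + (q + L - p) mod L)"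
      using length_determined[OF that, of l t] by (auto simp: c d3_end_def winding_def simp flip: L_def)
  qed
  have L0: "L > 0" using B by (simp add: is_brane_def L_def)
  show ?thesis
  proof
    assume S: "supersymmetric_brane B"
    show "fixed_once B" unfolding fixed_once_def
    proof (intro allI impI)
      fix p l assume a: "p < length (vertices B) \<and> l > 0 \<and> vertices B ! p \<noteq> vertices B ! ((p + l) mod length (vertices B))"
      define q t where "q = (p + l) mod L" and "t = l div L"
      have pq: "p < L" "q < L" "p \<noteq> q" "V ! p \<noteq> V ! q" using a L0 by (auto simp: q_def L_def V_def)
      have l: "l = t * L + (q + L - p) mod L" using length_determined[OF pq(1-3), of l t] by (simp add: q_def t_def)
      show "count (d3branes B) (p, l) \<le> 1"
      proof (cases "V ! p")
        case NS5
        then have "V ! q = D5" using pq by (cases "V ! q") auto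
        then have "size (anticlockwise_d3 B p q t) \<le> 1"
          using S NS5 pq unfolding supersymmetric_brane_def L_def V_def by blast
        then show ?thesis using key[OF pq(1-3), of t] l by (simp add: anticlockwise_d3_def M_def)
      next
        case D5
        then have "V ! q = NS5" using pq by (cases "V ! q") auto
        then have "size (clockwise_d3 B q p t) \<le> 1"
          using S D5 pq unfolding supersymmetric_brane_def L_def V_def by blast
        then show ?thesis using key[OF pq(1-3), of t] l by (simp add: clockwise_d3_def M_def)
      qed
    qed
  next
    assume F: "fixed_once B"
    have F': "count M (p, t * L + (q + L - p) mod L) \<le> 1" if "p < L" "q < L" "V ! p \<noteq> V ! q" for p q t
    proof -
      have pq: "p \<noteq> q" using that by auto
      define l where "l = t * L + (q + L - p) mod L"
      have l: "(p + l) mod L = q" using length_determined[OF that(1,2) pq, of l t] by (simp add: l_def)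
      then have "l > 0" using pq that by (cases l) auto
      then have "p < length (vertices B) \<and> l > 0 \<and> vertices B ! p \<noteq> vertices B ! ((p + l) mod length (vertices B))"
        using l that by (simp add: L_def V_def)
      then have "count (d3branes B) (p, l) \<le> 1" using F unfolding fixed_once_def by (elim allE impE)
      then show ?thesis by (simp only: M_def l_def)
    qed
    show "supersymmetric_brane B" unfolding supersymmetric_brane_def
    proof (intro allI impI)
      fix t p q assume "p < length (vertices B)" "q < length (vertices B)"
        and t: "vertices B ! p = NS5 \<and> vertices B ! q = D5"
      then have a: "p < L" "q < L" by (simp_all add: L_def)
      from t have pq: "p \<noteq> q" "q \<noteq> p" "V ! p \<noteq> V ! q" "V ! q \<noteq> V ! p" by (auto simp: V_def)
      show "size (clockwise_d3 B p q t) \<le> 1 \<and> size (anticlockwise_d3 B p q t) \<le> 1"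
        using key[OF a(1,2) pq(1), of t] key[OF a(2,1) pq(2), of t] F'[OF a(1,2) pq(3), of t] F'[OF a(2,1) pq(4), of t]
        by (simp add: clockwise_d3_def anticlockwise_d3_def M_def)
    qed
  qed
qed

lemma len_bow_of_brane [simp]: "len (bow_of_brane B) = length (vertices B)"
  by (simp add: len_def bow_of_brane_def)

lemma elts_bow_of_brane: "k < length (vertices B) \<Longrightarrow>
    elts (bow_of_brane B) ! k = (case vertices B ! k of NS5 \<Rightarrow> Arrow | D5 \<Rightarrow> XPoint)"
  by (simp add: bow_of_brane_def)

lemma dims_bow_of_brane: "k < length (vertices B) \<Longrightarrow>
    dims (bow_of_brane B) ! k = int (\<Sum>c\<in>#d3branes B. passes B k c)"
  by (simp add: bow_of_brane_def)

text \<open>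
  A D3-brane keeps its end vertices while these are exchanged, so it becomes longer or shorter.
\<close>

definition move_ends :: "nat \<Rightarrow> nat \<Rightarrow> nat \<times> nat \<Rightarrow> nat \<times> nat" where
  "move_ends L i = (\<lambda>(p, l). (nat (swap_lift (int L) (int i) (int p) mod int L),
     nat (swap_lift (int L) (int i) (int p + int l) - swap_lift (int L) (int i) (int p))))"

text \<open>
  The vertices i and i + 1 carry different types, so the D3-brane that runs from one to the other
  through the arc i alone is fixed and occurs at most once. The transition removes it if it is
  present and creates it otherwise. All other D3-branes follow their end vertices. This movement
  is an involution, so no two different branes become equal, and by
  \<open>card_lifts_swap_here\<close> the dimensions change as they should.
\<close>

lemma supersymmetric_hw_transition:
  assumes "supersymmetric D" and hw: "hw_transition D D'"
  shows "supersymmetric D'"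
proof -
  obtain B where B: "is_brane B" "supersymmetric_brane B" and D: "bow_of_brane B = D"
    using assms(1) unfolding supersymmetric_def by blast
  define L V M where "L = length (vertices B)" and "V = vertices B" and "M = d3branes B"
  define N where "N = int L"
  have lenD: "len D = L" unfolding D[symmetric] L_def by simp
  obtain i where i: "i < L" and ne: "elts D ! i \<noteq> elts D ! nxt D i"
    and D': "D' = \<lparr>elts = (elts D)[i := elts D ! (nxt D i), nxt D i := elts D ! i],
              dims = (dims D)[i := dims D ! (prv D i) + dims D ! (nxt D i) - dims D ! i + 1]\<rparr>"
    using hw unfolding hw_transition_def lenD by blast
  define j where "j = nxt D i"
  define h where "h = prv D i"
  have L0: "L > 0" using i by simp
  have j: "j = (i + 1) mod L" "j < L" using L0 by (simp_all add: j_def nxt_def lenD)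
  have h: "h = (i + L - 1) mod L" "h < L" using L0 by (simp_all add: h_def prv_def lenD)
  have ij: "i \<noteq> j" using ne by (auto simp: j_def)
  have L2: "L \<ge> 2"
  proof (rule ccontr)
    assume "\<not> L \<ge> 2" then have "L = 1" using L0 by simp then show False using ij j i by simp
  qed
  have N2: "N \<ge> 2" using L2 by (simp add: N_def)
  have iN: "0 \<le> int i" "int i < N" using i by (simp_all add: N_def)
  note ctx = N2 iN
  let ?\<sigma> = "swap_lift N (int i)"
  have jN: "int j = (int i + 1) mod N" by (simp add: j N_def zmod_int add.commute)
  have hN: "int h = (int i - 1) mod N"
  proof -
    have "int (i + L - 1) = int i - 1 + N" using L0 by (simp add: N_def)
    then show ?thesis unfolding h(1) zmod_int N_def[symmetric] by simp
  qed
  have Vne: "V ! i \<noteq> V ! j"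
  proof -
    have "elts (bow_of_brane B) ! i \<noteq> elts (bow_of_brane B) ! j" using ne unfolding j_def D .
    then show ?thesis using i j(2) by (auto simp: elts_bow_of_brane V_def L_def)
  qed
  have val: "fst c < L \<and> snd c > 0" if "c \<in># M" for c
    using B(1) that unfolding is_brane_def L_def M_def by (cases c) auto
  have once: "count M (p, l) \<le> 1" if "p < L" "l > 0" "V ! p \<noteq> V ! ((p + l) mod L)" for p l
    using B that supersymmetric_brane_iff unfolding fixed_once_def L_def V_def M_def by blast
  have one: "count M (i, 1) \<le> 1" using once[of i 1] i Vne j by simp
  define f where "f = move_ends L i"
  define V' where "V' = V[i := V ! j, j := V ! i]"
  define S where "S = filter_mset (\<lambda>c. c \<noteq> (i, 1)) M"
  define E where "E = (if (i, 1::nat) \<in># M then {#} else {#(i, 1::nat)#})"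
  define B' where "B' = \<lparr>vertices = V', d3branes = image_mset f S + E\<rparr>"
  have LV: "length V = L" "length V' = L" by (simp_all add: V_def V'_def L_def)
  \<comment> \<open>The branes other than the short one keep a positive length.\<close>
  have reg: "int p < int p + int l" "\<not> (N dvd int p - int i \<and> int p + int l = int p + 1)"
    if "(p, l) \<noteq> (i, 1)" "p < L" "l > 0" for p l
    using that dvd_iff_mod[OF ctx, of "int p"] by (auto simp: N_def)
  have less: "?\<sigma> (int p) < ?\<sigma> (int p + int l)" if "(p, l) \<noteq> (i, 1)" "p < L" "l > 0" for p l
    by (rule swap_lift_less[OF ctx reg[OF that]])
  have f: "int (fst (f (p, l))) = ?\<sigma> (int p) mod N" "int (snd (f (p, l))) = ?\<sigma> (int p + int l) - ?\<sigma> (int p)"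
      "fst (f (p, l)) < L" "snd (f (p, l)) > 0"
    if "(p, l) \<noteq> (i, 1)" "p < L" "l > 0" for p l
    using less[OF that] L0 by (simp_all add: f_def move_ends_def N_def nat_less_iff)
  have tr: "N dvd x mod N - x" for x by (metis mod_mod_trivial mod_eq_dvd_iff)
  \<comment> \<open>Exchanging the vertices twice moves every end back.\<close>
  have ff: "f (f (p, l)) = (p, l)" if c: "(p, l) \<noteq> (i, 1)" "p < L" "l > 0" for p l
  proof -
    obtain p' l' where c': "f (p, l) = (p', l')" by (cases "f (p, l)")
    have p': "int p' = ?\<sigma> (int p) + (?\<sigma> (int p) mod N - ?\<sigma> (int p))"
      and l': "int p' + int l' = ?\<sigma> (int p + int l) + (?\<sigma> (int p) mod N - ?\<sigma> (int p))"
      using f(1,2)[OF c] c' by simp_all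
    have 1: "?\<sigma> (int p') = int p + (?\<sigma> (int p) mod N - ?\<sigma> (int p))"
      unfolding p' swap_lift_translate[OF ctx tr] swap_lift_swap_lift[OF ctx] ..
    have 2: "?\<sigma> (int p' + int l') = int p + int l + (?\<sigma> (int p) mod N - ?\<sigma> (int p))"
      unfolding l' swap_lift_translate[OF ctx tr] swap_lift_swap_lift[OF ctx] ..
    have "(int p + (?\<sigma> (int p) mod N - ?\<sigma> (int p))) mod N = int p mod N"
      using tr[of "?\<sigma> (int p)"] by auto
    then have "f (p', l') = (p, l)"
      unfolding f_def move_ends_def N_def[symmetric] using 1 2 c(2) by (simp add: N_def)
    then show ?thesis by (simp add: c')
  qed
  have V'\<sigma>: "V' ! nat (?\<sigma> x mod N) = V ! nat (x mod N)" for x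
  proof -
    have s1: "(x + 1) mod N = int j" if "N dvd x - int i"
      using that unfolding jN by (simp add: mod_eq_dvd_iff)
    have s2: "x mod N = int j" if "N dvd x - 1 - int i"
      using that unfolding jN by (simp add: mod_eq_dvd_iff algebra_simps)
    have s3: "(x - 1) mod N = int i" if "N dvd x - 1 - int i"
      using that dvd_iff_mod[OF ctx, of "x - 1"] by simp
    have s4: "x mod N \<noteq> int j" if "\<not> N dvd x - 1 - int i"
      using that unfolding jN by (simp add: mod_eq_dvd_iff algebra_simps)
    have s5: "x mod N = int i \<longleftrightarrow> N dvd x - int i" using dvd_iff_mod[OF ctx, of x] by simp
    have nn: "0 \<le> x mod N" "nat (x mod N) < L" using N2 by (simp_all add: N_def nat_less_iff)
    consider "N dvd x - int i" | "\<not> N dvd x - int i" "N dvd x - 1 - int i" | "\<not> N dvd x - int i" "\<not> N dvd x - 1 - int i" by blast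
    then show ?thesis
    proof cases
      case 1 then show ?thesis using s1 s5 i j ij LV by (simp add: swap_lift_def V'_def nth_list_update)
    next
      case 2 then show ?thesis using s2 s3 i j ij LV by (simp add: swap_lift_def V'_def nth_list_update)
    next
      case 3
      then have "nat (x mod N) \<noteq> i" "nat (x mod N) \<noteq> j" using s4 s5 nn by auto
      then show ?thesis using 3 nn by (simp add: swap_lift_def V'_def nth_list_update)
    qed
  qed
  have types: "V' ! fst (f (p, l)) = V ! p" "V' ! ((fst (f (p, l)) + snd (f (p, l))) mod L) = V ! ((p + l) mod L)"
    if c: "(p, l) \<noteq> (i, 1)" "p < L" "l > 0" for p l
  proof -
    have "fst (f (p, l)) = nat (?\<sigma> (int p) mod N)" using f(1)[OF c] by simp
    moreover have "nat (int p mod N) = p" using c(2) by (simp add: N_def)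
    ultimately show "V' ! fst (f (p, l)) = V ! p" using V'\<sigma>[of "int p"] by simp
    have "int ((fst (f (p, l)) + snd (f (p, l))) mod L) = ?\<sigma> (int p + int l) mod N"
      unfolding zmod_int of_nat_add f(1,2)[OF c] N_def[symmetric] by (simp add: mod_simps)
    then have "(fst (f (p, l)) + snd (f (p, l))) mod L = nat (?\<sigma> (int p + int l) mod N)" by simp
    moreover have "nat ((int p + int l) mod N) = (p + l) mod L"
      by (simp add: N_def flip: of_nat_add zmod_int)
    ultimately show "V' ! ((fst (f (p, l)) + snd (f (p, l))) mod L) = V ! ((p + l) mod L)"
      using V'\<sigma>[of "int p + int l"] by simp
  qed
  have S: "c \<noteq> (i, 1) \<and> fst c < L \<and> snd c > 0" if "c \<in># S" for c using that val by (auto simp: S_def)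
  have brB': "is_brane B'"
    unfolding is_brane_def B'_def
  proof (intro conjI ballI)
    show "vertices \<lparr>vertices = V', d3branes = image_mset f S + E\<rparr> \<noteq> []" using LV L0 by auto
    fix c assume "c \<in># d3branes \<lparr>vertices = V', d3branes = image_mset f S + E\<rparr>"
    then consider c0 where "c0 \<in># S" "c = f c0" | "c = (i, 1)" by (auto simp: E_def split: if_splits)
    then show "case c of (i, l) \<Rightarrow> i < length (vertices \<lparr>vertices = V', d3branes = image_mset f S + E\<rparr>) \<and> 0 < l"
    proof cases
      case 1
      then show ?thesis using S[of c0] f(3,4)[of "fst c0" "snd c0"] LV by (auto simp: case_prod_beta)
    next
      case 2 then show ?thesis using i LV by simp
    qed
  qed
  have "fixed_once B'"
    unfolding fixed_once_def B'_def brane.simps LV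
  proof (intro allI impI)
    fix p l assume a: "p < L \<and> 0 < l \<and> V' ! p \<noteq> V' ! ((p + l) mod L)"
    have inj: "c = f (p, l)" if "c \<in># S" "f c = (p, l)" for c
      using ff[of "fst c" "snd c"] S[OF that(1)] that(2) by simp
    have im: "count (image_mset f S) (p, l) \<le> 1"
    proof (cases "\<exists>c. c \<in># S \<and> f c = (p, l)")
      case True
      then obtain c where c: "c \<in># S" "f c = (p, l)" by blast
      have u: "x = c" if "x \<in># S" "f x = (p, l)" for x using inj[OF that] inj[OF c] by (rule trans[OF _ sym])
      have "f -` {(p, l)} \<inter> set_mset S = {c}"
      proof (intro equalityI subsetI)
        fix x assume "x \<in> f -` {(p, l)} \<inter> set_mset S"
        then show "x \<in> {c}" using u by blast
      next
        fix x assume "x \<in> {c}"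
        then show "x \<in> f -` {(p, l)} \<inter> set_mset S" using c by simp
      qed
      then have "count (image_mset f S) (p, l) = count S c" by (simp add: count_image_mset)
      also have "\<dots> \<le> count M c" by (simp add: S_def)
      also have "\<dots> \<le> 1"
        using once[of "fst c" "snd c"] types[of "fst c" "snd c"] S[OF c(1)] c(2) a by simp
      finally show ?thesis .
    next
      case False
      then have "(p, l) \<notin># image_mset f S" by (metis imageE set_image_mset)
      then have "count (image_mset f S) (p, l) = 0" by (simp only: not_in_iff)
      then show ?thesis by simp
    qed
    show "count (image_mset f S + E) (p, l) \<le> 1"
    proof (cases "(p, l) = (i, 1)")
      case True
      have "f c \<noteq> (i, 1)" if "c \<in># S" for c
      proof
        assume fc: "f c = (i, 1)"
        obtain p0 l0 where c: "c = (p0, l0)" by (cases c)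
        have c0: "(p0, l0) \<noteq> (i, 1)" "p0 < L" "l0 > 0" using S[OF that] c by auto
        have 1: "?\<sigma> (int p0) mod N = int i" "?\<sigma> (int p0 + int l0) = ?\<sigma> (int p0) + 1"
          using f(1,2)[OF c0] fc c by auto
        then have d: "N dvd ?\<sigma> (int p0) - int i" using dvd_iff_mod[OF ctx] by simp
        have ends: "?\<sigma> y = y + 1" "?\<sigma> (y + 1) = y" if "N dvd y - int i" for y
          using that consecutive_not_both_dvd[OF ctx, of "y + 1"] by (auto simp: swap_lift_def)
        have "int p0 = ?\<sigma> (?\<sigma> (int p0))" using swap_lift_swap_lift[OF ctx] by simp
        also have "\<dots> = ?\<sigma> (int p0) + 1" by (rule ends(1)[OF d])
        finally have a1: "int p0 = ?\<sigma> (int p0) + 1" .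
        have "int p0 + int l0 = ?\<sigma> (?\<sigma> (int p0) + 1)" using swap_lift_swap_lift[OF ctx, of "int p0 + int l0"] 1(2) by simp
        also have "\<dots> = ?\<sigma> (int p0)" by (rule ends(2)[OF d])
        finally show False using a1 c0(3) by simp
      qed
      then have "(i, 1) \<notin># image_mset f S" by (metis imageE set_image_mset)
      then have "count (image_mset f S) (p, l) = 0" unfolding True by (simp only: not_in_iff)
      then show ?thesis unfolding True by (simp add: E_def)
    next
      case False
      then have "count E (p, l) = 0" by (auto simp: E_def)
      then show ?thesis using im by simp
    qed
  qed
  then have susyB': "supersymmetric_brane B'" using supersymmetric_brane_iff[OF brB'] by simp
  have P: "passes B k (p, l) = card (lifts N (int k) (int p) (int p + int l))" for k p l
    unfolding passes_eq_lifts N_def L_def ..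
  have P': "passes B' k (f (p, l)) = card (lifts N (int k) (?\<sigma> (int p)) (?\<sigma> (int p + int l)))"
    if c: "(p, l) \<noteq> (i, 1)" "p < L" "l > 0" for k p l
  proof -
    have "passes B' k (f (p, l)) = passes B' k (fst (f (p, l)), snd (f (p, l)))" by simp
    also have "\<dots> = card (lifts N (int k) (?\<sigma> (int p) mod N) (?\<sigma> (int p) mod N + (?\<sigma> (int p + int l) - ?\<sigma> (int p))))"
      unfolding passes_eq_lifts f(1,2)[OF c] by (simp add: B'_def LV N_def)
    also have "\<dots> = card (lifts N (int k) (?\<sigma> (int p)) (?\<sigma> (int p + int l)))"
      using card_lifts_translate[OF tr[of "?\<sigma> (int p)"], of "int k" "?\<sigma> (int p)" "?\<sigma> (int p + int l)"]
      by (simp add: algebra_simps)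
    finally show ?thesis .
  qed
  have short: "passes B k (i, 1) = of_bool (k = i)" "passes B' k (i, 1) = of_bool (k = i)" for k
  proof -
    have "{m. m < 1 \<and> (i + m) mod L = k} = (if k = i then {0} else {})" using i by auto
    then show "passes B k (i, 1) = of_bool (k = i)" "passes B' k (i, 1) = of_bool (k = i)"
      by (simp_all add: passes_def B'_def LV flip: L_def)
  qed
  have Msplit: "M = S + replicate_mset (count M (i, 1)) (i, 1)"
  proof -
    have "M = S + filter_mset (\<lambda>c. \<not> c \<noteq> (i, 1)) M" unfolding S_def by (rule multiset_partition)
    then show ?thesis by (simp add: filter_eq_replicate_mset)
  qed
  have old: "(\<Sum>c\<in>#M. passes B k c) = (\<Sum>c\<in>#S. passes B k c) + count M (i, 1) * of_bool (k = i)" for k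
    by (subst Msplit) (simp add: short short[unfolded One_nat_def])
  have dB': "d3branes B' = image_mset f S + E" by (simp add: B'_def)
  have new: "(\<Sum>c\<in>#d3branes B'. passes B' k c) = (\<Sum>c\<in>#S. passes B' k (f c)) + (if (i, 1) \<in># M then 0 else of_bool (k = i))" for k
    unfolding dB' by (simp add: E_def short short[unfolded One_nat_def] image_mset.compositionality comp_def)
  have other: "(\<Sum>c\<in>#S. passes B' k (f c)) = (\<Sum>c\<in>#S. passes B k c)" if "k \<noteq> i" for k
  proof (rule arg_cong[where f = sum_mset], rule image_mset_cong)
    fix c assume "c \<in># S"
    then show "passes B' k (f c) = passes B k c"
      using S P'[of "fst c" "snd c" k] P[of k "fst c" "snd c"] lifts_swap_other[OF ctx, of "int k" "int (fst c)" "int (fst c) + int (snd c)"] that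
      by simp
  qed
  have here: "(\<Sum>c\<in>#S. passes B i c) + (\<Sum>c\<in>#S. passes B' i (f c)) = (\<Sum>c\<in>#S. passes B h c) + (\<Sum>c\<in>#S. passes B j c)"
    unfolding sum_mset.distrib[symmetric]
  proof (rule arg_cong[where f = sum_mset], rule image_mset_cong)
    fix c assume c: "c \<in># S"
    then have c': "(fst c, snd c) \<noteq> (i, 1)" "fst c < L" "snd c > 0" using S by auto
    show "passes B i c + passes B' i (f c) = passes B h c + passes B j c"
      using card_lifts_swap_here[OF ctx reg[OF c']] P'[OF c', of i] P[of i "fst c" "snd c"] P[of h "fst c" "snd c"] P[of j "fst c" "snd c"]
      unfolding hN jN by simp
  qed
  have Dd: "dims D ! k = int (\<Sum>c\<in>#M. passes B k c)" if "k < L" for k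
    using that unfolding D[symmetric] M_def L_def by (rule dims_bow_of_brane)
  have D'd: "dims (bow_of_brane B') ! k = int (\<Sum>c\<in>#d3branes B'. passes B' k c)" if "k < L" for k
    by (rule dims_bow_of_brane) (simp add: B'_def LV that)
  have hi: "h \<noteq> i"
    using h(1) i L2 by (cases "i = 0") (auto simp: mod_if)
  have "bow_of_brane B' = D'"
  proof -
    have lens: "length (elts D) = L" "length (dims D) = L" unfolding D[symmetric] by (simp_all add: bow_of_brane_def L_def)
    have lens': "length (elts (bow_of_brane B')) = L" "length (dims (bow_of_brane B')) = L" by (simp_all add: bow_of_brane_def B'_def LV)
    have eD: "elts D ! k = (case V ! k of NS5 \<Rightarrow> Arrow | D5 \<Rightarrow> XPoint)" if "k < L" for k
      using that unfolding D[symmetric] V_def L_def by (rule elts_bow_of_brane)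
    have eD': "elts (bow_of_brane B') ! k = (case V' ! k of NS5 \<Rightarrow> Arrow | D5 \<Rightarrow> XPoint)" if "k < L" for k
      using elts_bow_of_brane[of k B'] that by (simp add: B'_def LV)
    have "elts (bow_of_brane B') = elts D'"
    proof (rule nth_equalityI)
      fix k assume "k < length (elts (bow_of_brane B'))"
      then have k: "k < L" using lens' by simp
      show "elts (bow_of_brane B') ! k = elts D' ! k"
        using k i j(2) ij lens LV by (simp add: D' eD eD' V'_def nth_list_update flip: j_def)
    qed (simp add: lens lens' D')
    moreover have "dims (bow_of_brane B') = dims D'"
    proof (rule nth_equalityI)
      fix k assume "k < length (dims (bow_of_brane B'))"
      then have k: "k < L" using lens' by simp
      show "dims (bow_of_brane B') ! k = dims D' ! k"
      proof (cases "k = i")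
        case False
        then show ?thesis using k i lens Dd[OF k] D'd[OF k] new[of k] old[of k] other[of k] by (simp add: D')
      next
        case True
        have cnt: "int (count M (i, 1)) = (if (i, 1) \<in># M then 1 else 0)"
        proof (cases "(i, 1) \<in># M")
          case True
          then have "count M (i, 1) > 0" by simp
          then have "count M (i, 1) = 1" using one by linarith
          then show ?thesis using True by simp
        qed (simp add: not_in_iff)
        have "dims D' ! i = dims D ! h + dims D ! j - dims D ! i + 1"
          using i lens by (simp add: D' flip: j_def h_def)
        also have "\<dots> = int (\<Sum>c\<in>#S. passes B' i (f c)) + 1 - int (count M (i, 1))"
        proof -
          define s where "s g = (\<Sum>c\<in>#S. g c)" for g :: "nat \<times> nat \<Rightarrow> nat"
          have o: "(\<Sum>c\<in>#M. passes B h c) = s (passes B h)" "(\<Sum>c\<in>#M. passes B j c) = s (passes B j)"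
            "(\<Sum>c\<in>#M. passes B i c) = s (passes B i) + count M (i, 1)"
            using old[of h] old[of j] old[of i] hi ij by (simp_all add: s_def)
          have "s (passes B i) + s (\<lambda>c. passes B' i (f c)) = s (passes B h) + s (passes B j)"
            using here by (simp only: s_def)
          then show ?thesis unfolding Dd[OF h(2)] Dd[OF j(2)] Dd[OF i] o s_def[symmetric] by linarith
        qed
        also have "\<dots> = dims (bow_of_brane B') ! i" using D'd[OF i] new[of i] cnt by simp
        finally show ?thesis using True by simp
      qed
    qed (simp add: lens lens' D')
    ultimately show ?thesis by (cases "bow_of_brane B'"; cases D') simp
  qed
  then show ?thesis using brB' susyB' unfolding supersymmetric_def by blast
qed

lemma mod_add_diff_cancel:
  fixes L :: nat
  assumes "y < L" "m \<le> L" shows "((y + m) mod L + L - m) mod L = y"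
proof -
  have "(y + m) mod L + L - m = (y + m) mod L + (L - m)" using assms by simp
  then have "((y + m) mod L + L - m) mod L = (y + m + (L - m)) mod L" by (simp only: mod_add_left_eq)
  also have "y + m + (L - m) = y + L" using assms by simp
  finally show ?thesis using assms by simp
qed

lemma mod_diff_add:
  fixes L :: nat
  assumes "j < L" "m \<le> L" "t \<le> m" shows "((j + L - m) mod L + t) mod L = (j + L - (m - t)) mod L"
proof -
  have "((j + L - m) mod L + t) mod L = (j + L - m + t) mod L" by (simp only: mod_add_left_eq)
  also have "j + L - m + t = j + L - (m - t)" using assms by simp
  finally show ?thesis .
qed

lemma sum_mset_replicates:
  assumes "finite K"
  shows "(\<Sum>c\<in>#(\<Sum>k\<in>K. replicate_mset (a k) (x k)). g c) = (\<Sum>k\<in>K. a k * g (x k))"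
    and "set_mset (\<Sum>k\<in>K. replicate_mset (a k) (x k)) \<subseteq> x ` K"
  using assms by (induction K rule: finite_induct) (auto split: if_splits)

text \<open>
  Joining every element of type T to the next element of the same type covers the circle exactly
  once. Giving the branes that start at k the multiplicity \<open>\<alpha> k\<close> produces the
  dimensions \<open>\<alpha>\<close>, since these do not change between two elements of type T.
\<close>

lemma free_branes:
  fixes es :: "'t list" and \<alpha> :: "nat \<Rightarrow> nat"
  defines "L \<equiv> length es"
  assumes ex: "\<exists>k<L. es ! k = T"
    and const: "\<And>k. k < L \<Longrightarrow> es ! k \<noteq> T \<Longrightarrow> \<alpha> ((k + L - 1) mod L) = \<alpha> k"
  shows "\<exists>M :: (nat \<times> nat) multiset.
    (\<forall>p l. (p, l) \<in># M \<longrightarrow> p < L \<and> l > 0 \<and> es ! p = T \<and> es ! ((p + l) mod L) = T) \<and>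
    (\<forall>j<L. (\<Sum>(p, l)\<in>#M. card {m. m < l \<and> (p + m) mod L = j}) = \<alpha> j)"
proof -
  define K where "K = {k. k < L \<and> es ! k = T}"
  define gap where "gap k = (LEAST g. g > 0 \<and> es ! ((k + g) mod L) = T)" for k
  have L0: "L > 0" using ex by auto
  have gap: "gap k > 0 \<and> es ! ((k + gap k) mod L) = T" if "k \<in> K" for k
    unfolding gap_def by (rule LeastI[of _ L]) (use that L0 in \<open>simp add: K_def\<close>)
  have gap_le: "gap k \<le> g" if "g > 0" "es ! ((k + g) mod L) = T" for k g
    unfolding gap_def by (rule Least_le) (use that in simp)
  define M where "M = (\<Sum>k\<in>K. replicate_mset (\<alpha> k) (k, gap k))"
  have finK: "finite K" by (simp add: K_def)
  have 1: "p < L \<and> l > 0 \<and> es ! p = T \<and> es ! ((p + l) mod L) = T" if "(p, l) \<in># M" for p l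
  proof -
    have "(p, l) \<in> (\<lambda>k. (k, gap k)) ` K"
      using subsetD[OF sum_mset_replicates(2)[OF finK, of \<alpha> "\<lambda>k. (k, gap k)"]] that unfolding M_def by blast
    then show ?thesis using gap by (auto simp: K_def)
  qed
  have 2: "(\<Sum>(p, l)\<in>#M. card {m. m < l \<and> (p + m) mod L = j}) = \<alpha> j" if j: "j < L" for j
  proof -
    define P where "P m \<longleftrightarrow> m < L \<and> es ! ((j + L - m) mod L) = T" for m
    \<comment> \<open>The distance from arc j back to the last element of type T before it.\<close>
    define m0 where "m0 = (LEAST m. P m)"
    obtain k where k: "k < L" "es ! k = T" using ex by blast
    have "P ((j + L - k) mod L)"
    proof -
      have "((j + L - k) mod L + k) mod L = j" using mod_diff_add[OF j, of k k] k j by simp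
      then have "(j + L - (j + L - k) mod L) mod L = k"
        using mod_add_diff_cancel[of k L "(j + L - k) mod L"] k L0 by (simp add: add.commute)
      then show ?thesis using k L0 by (simp add: P_def)
    qed
    then have P0: "P m0" unfolding m0_def by (rule LeastI)
    have least: "m0 \<le> m" if "P m" for m unfolding m0_def using that by (rule Least_le)
    define k0 where "k0 = (j + L - m0) mod L"
    have m0L: "m0 < L" using P0 by (simp add: P_def)
    have k0: "k0 \<in> K" "(k0 + m0) mod L = j"
      using P0 L0 mod_diff_add[OF j, of m0 m0] m0L j by (simp_all add: K_def P_def k0_def)
    have m0gap: "m0 < gap k0"
    proof (rule ccontr)
      assume "\<not> m0 < gap k0"
      then have "gap k0 \<le> m0" by simp
      then have "P (m0 - gap k0)"
        using gap[OF k0(1)] mod_diff_add[OF j, of m0 "gap k0"] m0L by (simp add: P_def k0_def)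
      then show False using least[of "m0 - gap k0"] conjunct1[OF gap[OF k0(1)]] \<open>gap k0 \<le> m0\<close> by linarith
    qed
    have "\<alpha> ((j + L - m) mod L) = \<alpha> j" if "m \<le> m0" for m
      using that
    proof (induction m)
      case 0 then show ?case using j by simp
    next
      case (Suc m)
      then have m: "m < m0" by simp
      have "\<not> P m" using least[of m] m by auto
      then have "es ! ((j + L - m) mod L) \<noteq> T" using m m0L by (simp add: P_def)
      then have "\<alpha> (((j + L - m) mod L + L - 1) mod L) = \<alpha> j" using const[of "(j + L - m) mod L"] L0 Suc m by simp
      moreover have "((j + L - m) mod L + L - 1) mod L = (j + L - Suc m) mod L"
      proof -
        have "(j + L - m) mod L = ((j + L - Suc m) mod L + 1) mod L"
          using mod_diff_add[OF j, of "Suc m" 1] m m0L by simp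
        then show ?thesis using mod_add_diff_cancel[of "(j + L - Suc m) mod L" L 1] L0 by simp
      qed
      ultimately show ?case by simp
    qed
    then have \<alpha>0: "\<alpha> k0 = \<alpha> j" by (simp add: k0_def)
    have uniq: "k = k0 \<and> m = m0" if "k \<in> K" "m < gap k" "(k + m) mod L = j" for k m
    proof (cases "m \<le> m0")
      case True
      then have "k = (j + L - m) mod L" using mod_add_diff_cancel[of k L m] that m0L by (simp add: K_def)
      moreover from this have "P m" using that True m0L by (simp add: P_def K_def)
      ultimately show ?thesis using least[of m] True by (simp add: k0_def)
    next
      case False
      have "(k + (m - m0)) mod L = k0"
      proof -
        have "((k + (m - m0)) mod L + m0) mod L = (k + (m - m0) + m0) mod L" by (simp only: mod_add_left_eq)
        also have "k + (m - m0) + m0 = k + m" using False by simp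
        finally show ?thesis using mod_add_diff_cancel[of "(k + (m - m0)) mod L" L m0] m0L L0 that by (simp add: k0_def)
      qed
      then have "gap k \<le> m - m0" using gap_le[of "m - m0" k] False k0(1) by (simp add: K_def)
      then show ?thesis using that by simp
    qed
    have cnt: "card {m. m < gap k \<and> (k + m) mod L = j} = of_bool (k = k0)" if "k \<in> K" for k
    proof -
      have "{m. m < gap k \<and> (k + m) mod L = j} = (if k = k0 then {m0} else {})"
      proof (cases "k = k0")
        case True
        then have "m \<in> {m. m < gap k \<and> (k + m) mod L = j} \<longleftrightarrow> m = m0" for m
          using uniq[OF that, of m] k0(2) m0gap by blast
        then show ?thesis using True by auto
      next
        case False
        then have "m \<notin> {m. m < gap k \<and> (k + m) mod L = j}" for m using uniq[OF that, of m] by blast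
        then show ?thesis using False by auto
      qed
      then show ?thesis by simp
    qed
    have "(\<Sum>(p, l)\<in>#M. card {m. m < l \<and> (p + m) mod L = j}) = (\<Sum>k\<in>K. \<alpha> k * card {m. m < gap k \<and> (k + m) mod L = j})"
      unfolding M_def sum_mset_replicates(1)[OF finK] by simp
    also have "\<dots> = (\<Sum>k\<in>K. if k = k0 then \<alpha> k else 0)" by (intro sum.cong) (auto simp: cnt)
    also have "\<dots> = \<alpha> j" using k0(1) finK \<alpha>0 by simp
    finally show ?thesis .
  qed
  show ?thesis using 1 2 by (intro exI[of _ M] conjI allI impI) blast+
qed

text \<open>
  All D3-branes have both ends on fivebranes of the same type, so none of them is fixed. If one of
  the types is missing, the other one has to carry the whole dimension.
\<close>

lemma decomposable_supersymmetric:
  assumes D: "is_bow D" and dec: "decomposable D"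
  shows "supersymmetric D"
proof -
  obtain \<alpha> \<beta> :: "nat \<Rightarrow> nat" where dims: "\<And>k. k < len D \<Longrightarrow> dims D ! k = int (\<alpha> k + \<beta> k)"
    and a: "\<And>k. k < len D \<Longrightarrow> elts D ! k = XPoint \<Longrightarrow> \<alpha> (prv D k) = \<alpha> k"
    and b: "\<And>k. k < len D \<Longrightarrow> elts D ! k = Arrow \<Longrightarrow> \<beta> (prv D k) = \<beta> k"
    using dec unfolding decomposable_def by blast
  define L where "L = len D"
  have Le: "length (elts D) = L" by (simp add: L_def len_def)
  have pr: "prv D k = (k + L - 1) mod L" for k by (simp add: prv_def L_def)
  define good where "good M \<longleftrightarrow> (\<forall>p l. (p, l) \<in># M \<longrightarrow> p < L \<and> l > 0 \<and> elts D ! p = elts D ! ((p + l) mod L))"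
    for M :: "(nat \<times> nat) multiset"
  define tot where "tot M j = (\<Sum>(p, l)\<in>#M. card {m. m < l \<and> (p + m) mod L = j})" for M j
  have free: "\<exists>M. good M \<and> (\<forall>j<L. tot M j = \<gamma> j)"
    if T: "\<exists>k<L. elts D ! k = T" and G: "\<And>k. k < L \<Longrightarrow> elts D ! k \<noteq> T \<Longrightarrow> \<gamma> (prv D k) = \<gamma> k" for T \<gamma>
  proof -
    have e: "\<exists>k<length (elts D). elts D ! k = T" using T by (simp only: Le)
    have c: "\<gamma> ((k + length (elts D) - 1) mod length (elts D)) = \<gamma> k" if "k < length (elts D)" "elts D ! k \<noteq> T" for k
      using that G[of k] by (simp add: Le pr)
    obtain M where M: "\<forall>p l. (p, l) \<in># M \<longrightarrow> p < L \<and> l > 0 \<and> elts D ! p = T \<and> elts D ! ((p + l) mod L) = T"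
      "\<forall>j<L. tot M j = \<gamma> j"
      using free_branes[of "elts D" T \<gamma>, OF e c] unfolding tot_def Le by blast
    have "good M" unfolding good_def using M(1) by simp
    then show ?thesis using M(2) by blast
  qed
  have "\<exists>M. good M \<and> (\<forall>j<L. tot M j = \<alpha> j + \<beta> j)"
  proof (cases "\<exists>k<L. elts D ! k = Arrow")
    case False
    have X: "elts D ! k = XPoint" if "k < L" for k using False that by (cases "elts D ! k") auto
    have "L > 0" using D by (simp add: is_bow_def flip: Le)
    then show ?thesis using X by (intro free[of XPoint]) auto
  next
    case A: True
    show ?thesis
    proof (cases "\<exists>k<L. elts D ! k = XPoint")
      case False
      then show ?thesis using A by (intro free[of Arrow]) (metis element.exhaust)+
    next
      case True
      have "\<alpha> (prv D k) = \<alpha> k" if "k < L" "elts D ! k \<noteq> Arrow" for k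
        using that a[of k] by (cases "elts D ! k") (auto simp: L_def)
      then obtain M1 where M1: "good M1" "\<forall>j<L. tot M1 j = \<alpha> j" using free[OF A] by blast
      have "\<beta> (prv D k) = \<beta> k" if "k < L" "elts D ! k \<noteq> XPoint" for k
        using that b[of k] by (cases "elts D ! k") (auto simp: L_def)
      then obtain M2 where M2: "good M2" "\<forall>j<L. tot M2 j = \<beta> j" using free[OF True] by blast
      have "good (M1 + M2)" using M1 M2 unfolding good_def by auto
      moreover have "\<forall>j<L. tot (M1 + M2) j = \<alpha> j + \<beta> j" using M1 M2 by (simp add: tot_def)
      ultimately show ?thesis by blast
    qed
  qed
  then obtain M where M: "good M" "\<And>j. j < L \<Longrightarrow> tot M j = \<alpha> j + \<beta> j" by blast
  define V where "V = map (\<lambda>e. case e of Arrow \<Rightarrow> NS5 | XPoint \<Rightarrow> D5) (elts D)"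
  define B where "B = \<lparr>vertices = V, d3branes = M\<rparr>"
  have LV: "length V = L" by (simp add: V_def Le)
  have L0: "L > 0" using D by (simp add: is_bow_def flip: Le)
  have "is_brane B" using M(1) L0 unfolding is_brane_def B_def good_def by (auto simp: LV simp flip: length_greater_0_conv)
  moreover have "fixed_once B"
    unfolding fixed_once_def
  proof (intro allI impI)
    fix p l assume h: "p < length (vertices B) \<and> l > 0 \<and> vertices B ! p \<noteq> vertices B ! ((p + l) mod length (vertices B))"
    have "(p, l) \<notin># M"
    proof
      assume "(p, l) \<in># M"
      then have "p < L" "elts D ! p = elts D ! ((p + l) mod L)" using M(1) unfolding good_def by blast+
      then have "V ! p = V ! ((p + l) mod L)" using L0 by (simp add: V_def Le)
      then show False using h by (simp add: B_def LV)
    qed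
    then show "count (d3branes B) (p, l) \<le> 1" by (simp add: B_def not_in_iff)
  qed
  moreover have "bow_of_brane B = D"
  proof -
    have inv: "(case (case e of Arrow \<Rightarrow> NS5 | XPoint \<Rightarrow> D5) of NS5 \<Rightarrow> Arrow | D5 \<Rightarrow> XPoint) = e" for e
      by (cases e) auto
    have "elts (bow_of_brane B) = elts D"
      by (simp add: bow_of_brane_def B_def V_def inv comp_def)
    moreover have "dims (bow_of_brane B) = dims D"
    proof (rule nth_equalityI)
      show "length (dims (bow_of_brane B)) = length (dims D)"
        using D by (simp add: bow_of_brane_def B_def LV is_bow_def flip: Le)
      fix j assume "j < length (dims (bow_of_brane B))"
      then have j: "j < L" by (simp add: bow_of_brane_def B_def LV)
      have "dims (bow_of_brane B) ! j = int (tot M j)"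
        using j by (simp add: bow_of_brane_def B_def LV tot_def passes_def)
      then show "dims (bow_of_brane B) ! j = dims D ! j" using M(2)[OF j] dims j by (simp add: L_def)
    qed
    ultimately show ?thesis by (cases "bow_of_brane B"; cases D) simp
  qed
  ultimately show ?thesis unfolding supersymmetric_def using supersymmetric_brane_iff by blast
qed

lemma always_originates_iff_supersymmetric:
  assumes Q: "is_bow Q"
  shows "always_originates Q \<longleftrightarrow> supersymmetric Q"
proof -
  have inv: "supersymmetric E" if "hw_equivalent D E" "supersymmetric D" for D E
    using that unfolding hw_equivalent_def
    by (induction rule: rtranclp_induct) (auto intro: supersymmetric_hw_transition)
  have nn: "originates_from_brane D" if D: "supersymmetric D" for D
  proof -
    obtain B where "bow_of_brane B = D" using D unfolding supersymmetric_def by blast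
    then show ?thesis unfolding originates_from_brane_def
      using dims_bow_of_brane[of _ B] len_bow_of_brane[of B] by (metis of_nat_0_le_iff)
  qed
  show ?thesis
  proof
    assume "always_originates Q"
    then obtain U where U: "hw_equivalent Q U" "decomposable U" using always_originates_decomposable[OF Q] by blast
    then have "supersymmetric U" using hw_equivalent_sym[OF Q U(1)] decomposable_supersymmetric by blast
    then show "supersymmetric Q" using inv hw_equivalent_sym[OF Q U(1)] by blast
  next
    assume "supersymmetric Q"
    then show "always_originates Q" unfolding always_originates_def using inv nn by blast
  qed
qed

section \<open>Subspaces and eigenvectors\<close>

definition injective_mat :: "'a :: field mat \<Rightarrow> bool" where
  "injective_mat Z \<longleftrightarrow> (\<forall>u\<in>carrier_vec (dim_col Z). Z *\<^sub>v u = 0\<^sub>v (dim_row Z) \<longrightarrow> u = 0\<^sub>v (dim_col Z))"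

text \<open>
  Pad the matrix with zero rows to a square matrix. It is singular, since its transpose kills the
  unit vector at a zero row.
\<close>

lemma wide_matrix_has_kernel:
  fixes Z :: "'a :: field mat"
  assumes Z: "Z \<in> carrier_mat m q" and mq: "m < q"
  shows "\<exists>u\<in>carrier_vec q. u \<noteq> 0\<^sub>v q \<and> Z *\<^sub>v u = 0\<^sub>v m"
proof -
  define Z' where "Z' = mat q q (\<lambda>(i, j). if i < m then Z $$ (i, j) else 0)"
  have Z': "Z' \<in> carrier_mat q q" by (simp add: Z'_def)
  have "Z'\<^sup>T *\<^sub>v unit_vec q m = 0\<^sub>v q"
    using mq by (intro eq_vecI) (auto simp: Z'_def)
  moreover have "unit_vec q m \<noteq> (0\<^sub>v q :: 'a vec)"
    using mq by (metis index_unit_vec(1) index_zero_vec(1) zero_neq_one)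
  ultimately have "det Z'\<^sup>T = 0"
    using det_0_iff_vec_prod_zero[of "Z'\<^sup>T" q] Z' by (metis transpose_carrier_mat unit_vec_carrier)
  then have "det Z' = 0" using det_transpose[OF Z'] by simp
  then obtain u where u: "u \<in> carrier_vec q" "u \<noteq> 0\<^sub>v q" "Z' *\<^sub>v u = 0\<^sub>v q"
    using det_0_iff_vec_prod_zero[OF Z'] by blast
  have "Z *\<^sub>v u = 0\<^sub>v m"
  proof (rule eq_vecI)
    fix i assume "i < dim_vec (0\<^sub>v m :: 'a vec)"
    then have i: "i < m" by simp
    then have "row Z' i = row Z i" using Z mq by (intro eq_vecI) (auto simp: Z'_def)
    then have "(Z *\<^sub>v u) $ i = (Z' *\<^sub>v u) $ i" using i Z Z' mq by simp
    then show "(Z *\<^sub>v u) $ i = 0\<^sub>v m $ i" using u(3) i mq by simp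
  qed (use Z in simp)
  then show ?thesis using u by blast
qed

text \<open>
  A vector y orthogonal to the image comes from the kernel of the transpose. A unit vector at a
  nonzero entry of y is not orthogonal to y.
\<close>

lemma tall_matrix_misses_vector:
  fixes Z :: "'a :: field mat"
  assumes Z: "Z \<in> carrier_mat m q" and qm: "q < m"
  shows "\<exists>x\<in>carrier_vec m. \<forall>u\<in>carrier_vec q. Z *\<^sub>v u \<noteq> x"
proof -
  have "Z\<^sup>T \<in> carrier_mat q m" using Z by simp
  from wide_matrix_has_kernel[OF this qm] obtain y where y: "y \<in> carrier_vec m" "y \<noteq> 0\<^sub>v m" "Z\<^sup>T *\<^sub>v y = 0\<^sub>v q" by blast
  then obtain i where i: "i < m" "y $ i \<noteq> 0" by (metis carrier_vecD eq_vecI index_zero_vec)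
  have "Z *\<^sub>v u \<noteq> unit_vec m i" if u: "u \<in> carrier_vec q" for u
  proof
    assume "Z *\<^sub>v u = unit_vec m i"
    then have "y $ i = y \<bullet> (Z *\<^sub>v u)" using i y by simp
    also have "\<dots> = (Z\<^sup>T *\<^sub>v y) \<bullet> u" using transpose_vec_mult_scalar[OF Z u y(1)] by simp
    also have "\<dots> = 0" using y(3) u by simp
    finally show False using i by simp
  qed
  then show ?thesis using i by (meson unit_vec_carrier)
qed

definition add_col :: "'a mat \<Rightarrow> 'a vec \<Rightarrow> 'a mat" where
  "add_col Z x = mat (dim_row Z) (dim_col Z + 1) (\<lambda>(i, j). if j < dim_col Z then Z $$ (i, j) else x $ i)"

lemma add_col_mult:
  fixes Z :: "'a :: field mat"
  assumes "Z \<in> carrier_mat m q" "x \<in> carrier_vec m" "u \<in> carrier_vec (q + 1)"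
  shows "add_col Z x *\<^sub>v u = Z *\<^sub>v vec q (\<lambda>j. u $ j) + u $ q \<cdot>\<^sub>v x"
  using assms by (intro eq_vecI) (auto simp: add_col_def scalar_prod_def mult.commute intro!: sum.cong)

lemma injective_add_col:
  fixes Z :: "'a :: field mat"
  assumes Z: "Z \<in> carrier_mat m q" and x: "x \<in> carrier_vec m" and inj: "injective_mat Z"
    and nx: "\<And>u. u \<in> carrier_vec q \<Longrightarrow> Z *\<^sub>v u \<noteq> x"
  shows "injective_mat (add_col Z x)" "add_col Z x \<in> carrier_mat m (q + 1)"
proof -
  show c: "add_col Z x \<in> carrier_mat m (q + 1)" using Z by (simp add: add_col_def)
  have "u = 0\<^sub>v (q + 1)" if u: "u \<in> carrier_vec (q + 1)" and z: "add_col Z x *\<^sub>v u = 0\<^sub>v m" for u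
  proof -
    define v where "v = vec q (\<lambda>j. u $ j)"
    have v: "v \<in> carrier_vec q" by (simp add: v_def)
    have e: "Z *\<^sub>v v + u $ q \<cdot>\<^sub>v x = 0\<^sub>v m" using add_col_mult[OF Z x u] z by (simp add: v_def)
    have e': "(Z *\<^sub>v v) $ i + u $ q * x $ i = 0" if "i < m" for i
      using arg_cong[OF e, of "\<lambda>y. y $ i"] that Z x by simp
    have uq: "u $ q = 0"
    proof (rule ccontr)
      assume nz: "u $ q \<noteq> 0"
      have "Z *\<^sub>v ((- inverse (u $ q)) \<cdot>\<^sub>v v) = x"
      proof (rule eq_vecI)
        fix i assume "i < dim_vec x"
        then have i: "i < m" using x by simp
        have "(Z *\<^sub>v ((- inverse (u $ q)) \<cdot>\<^sub>v v)) $ i = - inverse (u $ q) * (Z *\<^sub>v v) $ i"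
          unfolding mult_mat_vec[OF Z v] using i Z by simp
        also have "\<dots> = x $ i" using e'[OF i] nz by (simp add: field_simps) (metis add_eq_0_iff)
        finally show "(Z *\<^sub>v ((- inverse (u $ q)) \<cdot>\<^sub>v v)) $ i = x $ i" .
      qed (use Z x in simp)
      then show False using nx[of "(- inverse (u $ q)) \<cdot>\<^sub>v v"] v by simp
    qed
    have "Z *\<^sub>v v = 0\<^sub>v m" using e' uq Z by (intro eq_vecI) auto
    then have "v = 0\<^sub>v q" using inj v Z by (simp add: injective_mat_def)
    moreover have "u $ j = v $ j" if "j < q" for j using that by (simp add: v_def)
    ultimately have "u $ j = 0" if "j < q" for j using that by simp
    then show ?thesis using uq u by (intro eq_vecI) (auto simp: less_Suc_eq)
  qed
  then show "injective_mat (add_col Z x)" using c by (simp add: injective_mat_def)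
qed

lemma injective_mat_le:
  fixes Z :: "'a :: field mat"
  assumes "Z \<in> carrier_mat m q" "injective_mat Z" shows "q \<le> m"
  using wide_matrix_has_kernel[OF assms(1)] assms by (auto simp: injective_mat_def not_less[symmetric])

lemma injective_mat_extends:
  fixes X :: "'a :: field mat"
  assumes "X \<in> carrier_mat m q" "injective_mat X"
  shows "\<exists>P\<in>carrier_mat m m. injective_mat P \<and> (\<forall>i<m. \<forall>j<q. P $$ (i, j) = X $$ (i, j))"
  using assms
proof (induction "m - q" arbitrary: q X)
  case 0
  then show ?case using injective_mat_le[OF 0(2,3)] by (intro bexI[of _ X]) auto
next
  case (Suc k)
  then have "q < m" by simp
  obtain x where x: "x \<in> carrier_vec m" "\<And>u. u \<in> carrier_vec q \<Longrightarrow> X *\<^sub>v u \<noteq> x"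
    using tall_matrix_misses_vector[OF Suc.prems(1) \<open>q < m\<close>] by blast
  have "k = m - (q + 1)" using Suc by simp
  from Suc.hyps(1)[OF this injective_add_col(2,1)[OF Suc.prems(1) x(1) Suc.prems(2) x(2)]]
  obtain P where P: "P \<in> carrier_mat m m" "injective_mat P"
    "\<forall>i<m. \<forall>j<q + 1. P $$ (i, j) = add_col X x $$ (i, j)" by blast
  then show ?case using Suc.prems(1) by (intro bexI[of _ P]) (auto simp: add_col_def)
qed

lemma mat_block_product:
  fixes A B :: "'a :: comm_ring_1 mat"
  assumes "A \<in> carrier_mat r m" "B \<in> carrier_mat m c" "a + a' \<le> r" "b + b' \<le> c"
  shows "mat a' m (\<lambda>(i, j). A $$ (a + i, j)) * mat m b' (\<lambda>(i, j). B $$ (i, b + j)) =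
    mat a' b' (\<lambda>(i, j). (A * B) $$ (a + i, b + j))"
  using assms by (intro eq_matI) (auto simp: scalar_prod_def)

text \<open>
  Extend X to an invertible matrix (X | Y); then L and R are the upper and lower part of its
  inverse. So R is a cokernel of X, with a section Y.
\<close>

lemma injective_mat_complement:
  fixes X :: "'a :: field mat"
  assumes X: "X \<in> carrier_mat m q" and inj: "injective_mat X"
  obtains R Y L where "R \<in> carrier_mat (m - q) m" "Y \<in> carrier_mat m (m - q)" "L \<in> carrier_mat q m"
    "R * X = 0\<^sub>m (m - q) q" "R * Y = 1\<^sub>m (m - q)" "X * L + Y * R = 1\<^sub>m m"
proof -
  have qm: "q \<le> m" by (rule injective_mat_le[OF X inj])
  obtain P where P: "P \<in> carrier_mat m m" "injective_mat P" "\<And>i j. i < m \<Longrightarrow> j < q \<Longrightarrow> P $$ (i, j) = X $$ (i, j)"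
    using injective_mat_extends[OF X inj] by blast
  have "det P \<noteq> 0" using det_0_iff_vec_prod_zero[OF P(1)] P(1,2) by (auto simp: injective_mat_def)
  from det_non_zero_imp_unit[OF P(1) this, of "()"]
  obtain S where S: "S \<in> carrier_mat m m" "S * P = 1\<^sub>m m" "P * S = 1\<^sub>m m"
    by (auto simp: Units_def ring_mat_def)
  define R where "R = mat (m - q) m (\<lambda>(i, j). S $$ (q + i, j))"
  define L where "L = mat q m (\<lambda>(i, j). S $$ (0 + i, j))"
  define Y where "Y = mat m (m - q) (\<lambda>(i, j). P $$ (i, q + j))"
  have X': "X = mat m q (\<lambda>(i, j). P $$ (i, 0 + j))" using X P by (intro eq_matI) auto
  have 1: "R * X = 0\<^sub>m (m - q) q"
    unfolding R_def X' using mat_block_product[OF S(1) P(1), of q "m - q" 0 q] qm S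
    by (intro eq_matI) auto
  have 2: "R * Y = 1\<^sub>m (m - q)"
    unfolding R_def Y_def using mat_block_product[OF S(1) P(1), of q "m - q" q "m - q"] qm S
    by (intro eq_matI) auto
  have 3: "X * L + Y * R = 1\<^sub>m m"
  proof (rule eq_matI)
    fix i j assume "i < dim_row (1\<^sub>m m :: 'a mat)" "j < dim_col (1\<^sub>m m :: 'a mat)"
    then have ij: "i < m" "j < m" by auto
    have "(\<Sum>k\<in>{0..<m}. P $$ (i, k) * S $$ (k, j)) = (P * S) $$ (i, j)"
      using P(1) S(1) ij by (simp add: scalar_prod_def)
    moreover have "(\<Sum>k\<in>{0..<m}. P $$ (i, k) * S $$ (k, j)) =
       (\<Sum>k\<in>{0..<q}. P $$ (i, k) * S $$ (k, j)) + (\<Sum>k\<in>{0..<m - q}. P $$ (i, q + k) * S $$ (q + k, j))"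
    proof -
      have "(\<Sum>k\<in>{0..<m}. P $$ (i, k) * S $$ (k, j)) = (\<Sum>k\<in>{0..<q}. P $$ (i, k) * S $$ (k, j)) + (\<Sum>k\<in>{q..<m}. P $$ (i, k) * S $$ (k, j))"
        using qm by (simp add: sum.atLeastLessThan_concat)
      also have "(\<Sum>k\<in>{q..<m}. P $$ (i, k) * S $$ (k, j)) = (\<Sum>k\<in>{0..<m - q}. P $$ (i, q + k) * S $$ (q + k, j))"
        using sum.shift_bounds_nat_ivl[of "\<lambda>k. P $$ (i, k) * S $$ (k, j)" 0 q "m - q"] qm by (simp add: add.commute)
      finally show ?thesis .
    qed
    moreover have "(X * L) $$ (i, j) = (\<Sum>k\<in>{0..<q}. P $$ (i, k) * S $$ (k, j))"
      using ij X P(3) by (simp add: L_def scalar_prod_def)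
    moreover have "(Y * R) $$ (i, j) = (\<Sum>k\<in>{0..<m - q}. P $$ (i, q + k) * S $$ (q + k, j))"
      using ij by (simp add: Y_def R_def scalar_prod_def)
    ultimately have "(X * L) $$ (i, j) + (Y * R) $$ (i, j) = (P * S) $$ (i, j)" by simp
    then show "(X * L + Y * R) $$ (i, j) = 1\<^sub>m m $$ (i, j)" using S(3) ij X by (simp add: Y_def R_def)
  qed (use X in \<open>auto simp: L_def R_def Y_def\<close>)
  show ?thesis by (rule that[OF _ _ _ 1 2 3]) (simp_all add: R_def Y_def L_def)
qed

lemma is_subspace_iff:
  "is_subspace m W \<longleftrightarrow> W \<subseteq> carrier_vec m \<and> 0\<^sub>v m \<in> W \<and> (\<forall>u\<in>W. \<forall>v\<in>W. u + v \<in> W) \<and> (\<forall>c. \<forall>u\<in>W. c \<cdot>\<^sub>v u \<in> W)"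
  unfolding is_subspace_def VectorSpace.subspace_def LinearCombinations.submodule_def
  using vec_vs[where 'a = complex, of m] vec_module[where 'a = complex, of m]
  by (auto simp: module_vec_simps class_ring_simps)

text \<open>
  An injective matrix with image in W and with as many columns as possible has image W: another
  vector of W could be added as a column.
\<close>

lemma subspace_has_basis:
  assumes W: "is_subspace m W"
  obtains q Z where "Z \<in> carrier_mat m q" "injective_mat Z" "W = (\<lambda>u. Z *\<^sub>v u) ` carrier_vec q"
proof -
  note W = W[unfolded is_subspace_iff]
  define G where "G q \<longleftrightarrow> (\<exists>Z\<in>carrier_mat m q. injective_mat Z \<and> (\<forall>u\<in>carrier_vec q. Z *\<^sub>v u \<in> W))" for q
  have G0: "G 0" unfolding G_def
  proof (intro bexI conjI ballI)
    show "injective_mat (0\<^sub>m m 0 :: complex mat)" by (auto simp: injective_mat_def)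
    fix u :: "complex vec" assume "u \<in> carrier_vec 0"
    then have "0\<^sub>m m 0 *\<^sub>v u = 0\<^sub>v m" by (intro eq_vecI) (auto simp: scalar_prod_def)
    then show "0\<^sub>m m 0 *\<^sub>v u \<in> W" using W by simp
  qed simp
  have bound: "q \<le> m" if "G q" for q using that injective_mat_le unfolding G_def by blast
  obtain q where q: "G q" "\<And>q'. G q' \<Longrightarrow> q' \<le> q"
  proof -
    have "\<forall>y. G y \<longrightarrow> y < Suc m" using bound by (simp add: less_Suc_eq_le)
    from ex_has_greatest_nat[of G 0 "\<lambda>x. x", OF G0 this] show ?thesis using that by blast
  qed
  then obtain Z where Z: "Z \<in> carrier_mat m q" "injective_mat Z" "\<And>u. u \<in> carrier_vec q \<Longrightarrow> Z *\<^sub>v u \<in> W"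
    unfolding G_def by blast
  have "W = (\<lambda>u. Z *\<^sub>v u) ` carrier_vec q"
  proof (rule ccontr)
    assume "W \<noteq> (\<lambda>u. Z *\<^sub>v u) ` carrier_vec q"
    then obtain x where x: "x \<in> W" "\<And>u. u \<in> carrier_vec q \<Longrightarrow> Z *\<^sub>v u \<noteq> x" using Z(3) by blast
    then have xm: "x \<in> carrier_vec m" using W by blast
    note add = injective_add_col[OF Z(1) xm Z(2) x(2)]
    have "add_col Z x *\<^sub>v u \<in> W" if "u \<in> carrier_vec (q + 1)" for u
    proof -
      have "Z *\<^sub>v vec q (\<lambda>j. u $ j) \<in> W" using Z(3) by simp
      moreover have "u $ q \<cdot>\<^sub>v x \<in> W" using W x(1) by blast
      ultimately show ?thesis unfolding add_col_mult[OF Z(1) xm that] using W by blast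
    qed
    then have "G (q + 1)" unfolding G_def using add by (intro bexI[of _ "add_col Z x"]) auto
    then show False using q(2) by fastforce
  qed
  then show ?thesis by (rule that[OF Z(1,2)])
qed

text \<open>
  In a basis, the restriction of B to W is a square matrix over the complex numbers, which has an
  eigenvector.
\<close>

lemma invariant_subspace_has_eigenvector:
  assumes W: "is_subspace m W" and nz: "W \<noteq> {0\<^sub>v m}" and inv: "invariant_under B W" and B: "B \<in> carrier_mat m m"
  obtains u c where "u \<in> W" "u \<noteq> 0\<^sub>v m" "B *\<^sub>v u = c \<cdot>\<^sub>v u"
proof -
  obtain q Z where Z: "Z \<in> carrier_mat m q" "injective_mat Z" and WZ: "W = (\<lambda>u. Z *\<^sub>v u) ` carrier_vec q"
    by (rule subspace_has_basis[OF W])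
  have "q > 0"
  proof (rule ccontr)
    assume "\<not> q > 0"
    then have "Z *\<^sub>v u = 0\<^sub>v m" if "u \<in> carrier_vec q" for u
      using Z that by (intro eq_vecI) (auto simp: scalar_prod_def)
    then have "W \<subseteq> {0\<^sub>v m}" using WZ by auto
    then show False using nz W unfolding is_subspace_iff by blast
  qed
  have "\<exists>y\<in>carrier_vec q. Z *\<^sub>v y = B *\<^sub>v col Z j" if "j < q" for j
  proof -
    have "col Z j = Z *\<^sub>v unit_vec q j" using Z that by (intro eq_vecI) auto
    then have "col Z j \<in> W" unfolding WZ using unit_vec_carrier by (rule image_eqI)
    then have "B *\<^sub>v col Z j \<in> W" using inv by (simp add: invariant_under_def)
    then obtain y where "B *\<^sub>v col Z j = Z *\<^sub>v y" "y \<in> carrier_vec q" unfolding WZ by (rule imageE)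
    then show ?thesis by (intro bexI[of _ y]) simp_all
  qed
  then obtain y where y: "\<And>j. j < q \<Longrightarrow> y j \<in> carrier_vec q" "\<And>j. j < q \<Longrightarrow> Z *\<^sub>v y j = B *\<^sub>v col Z j" by metis
  define M where "M = mat q q (\<lambda>(i, j). y j $ i)"
  have M: "M \<in> carrier_mat q q" by (simp add: M_def)
  have cM: "col M j = y j" if "j < q" for j using y(1)[OF that] that by (intro eq_vecI) (auto simp: M_def)
  have BZ: "B * Z = Z * M"
  proof (rule eq_matI)
    fix i j assume "i < dim_row (Z * M)" "j < dim_col (Z * M)"
    then have ij: "i < m" "j < q" using Z M by auto
    have "(B * Z) $$ (i, j) = (B *\<^sub>v col Z j) $ i" using ij B Z by simp
    also have "\<dots> = (Z *\<^sub>v col M j) $ i" using y(2)[OF ij(2)] cM[OF ij(2)] by simp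
    also have "\<dots> = (Z * M) $$ (i, j)" using ij Z M by simp
    finally show "(B * Z) $$ (i, j) = (Z * M) $$ (i, j)" .
  qed (use B Z M in auto)
  obtain c where "c \<in> spectrum M" using spectrum_non_empty[OF M \<open>q > 0\<close>] by blast
  then obtain x where x: "x \<in> carrier_vec q" "x \<noteq> 0\<^sub>v q" "M *\<^sub>v x = c \<cdot>\<^sub>v x"
    using M by (auto simp: spectrum_def eigenvalue_def eigenvector_def)
  have "B *\<^sub>v (Z *\<^sub>v x) = (B * Z) *\<^sub>v x" using B Z x by simp
  also have "\<dots> = Z *\<^sub>v (M *\<^sub>v x)" unfolding BZ using Z M x by simp
  also have "\<dots> = c \<cdot>\<^sub>v (Z *\<^sub>v x)" unfolding x(3) by (rule mult_mat_vec[OF Z(1) x(1)])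
  finally have "B *\<^sub>v (Z *\<^sub>v x) = c \<cdot>\<^sub>v (Z *\<^sub>v x)" .
  moreover have "Z *\<^sub>v x \<noteq> 0\<^sub>v m" using Z x by (auto simp: injective_mat_def)
  moreover have "Z *\<^sub>v x \<in> W" unfolding WZ using x(1) by (rule imageI)
  ultimately show ?thesis using that by simp
qed

lemma proper_subspace_annihilator:
  assumes W: "is_subspace m W" and ne: "W \<noteq> carrier_vec m"
  obtains y where "y \<in> carrier_vec m" "y \<noteq> 0\<^sub>v m" "\<forall>u\<in>W. y \<bullet> u = 0"
proof -
  obtain q Z where Z: "Z \<in> carrier_mat m q" "injective_mat Z" and WZ: "W = (\<lambda>u. Z *\<^sub>v u) ` carrier_vec q"
    by (rule subspace_has_basis[OF W])
  have "q \<le> m" by (rule injective_mat_le[OF Z])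
  have "q < m"
  proof (rule ccontr)
    assume "\<not> q < m"
    then have qm: "q = m" using \<open>q \<le> m\<close> by simp
    have "x \<in> W" if x: "x \<in> carrier_vec m" for x
    proof (rule ccontr)
      assume "x \<notin> W"
      then have "Z *\<^sub>v u \<noteq> x" if "u \<in> carrier_vec q" for u using imageI[OF that, of "\<lambda>u. Z *\<^sub>v u"] unfolding WZ by auto
      from injective_add_col[OF Z(1) x Z(2) this] have "q + 1 \<le> m" using injective_mat_le by blast
      then show False using qm by simp
    qed
    then show False using ne W unfolding is_subspace_iff by blast
  qed
  have "Z\<^sup>T \<in> carrier_mat q m" using Z by simp
  from wide_matrix_has_kernel[OF this \<open>q < m\<close>]
  obtain y where y: "y \<in> carrier_vec m" "y \<noteq> 0\<^sub>v m" "Z\<^sup>T *\<^sub>v y = 0\<^sub>v q" by blast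
  have "y \<bullet> (Z *\<^sub>v u) = 0" if u: "u \<in> carrier_vec q" for u
    using transpose_vec_mult_scalar[OF Z(1) u y(1)] y(3) u by simp
  then have "\<forall>u\<in>W. y \<bullet> u = 0" unfolding WZ by simp
  then show ?thesis by (rule that[OF y(1,2)])
qed

section \<open>Matrix algebra and cokernels\<close>

text \<open>
  The side conditions of these rules are equations between dimensions, which the simplifier can
  compute; rules with carrier sets leave the inner dimension undetermined.
\<close>

lemma mat_assoc: "\<lbrakk>dim_col A = dim_row B; dim_col B = dim_row C\<rbrakk> \<Longrightarrow> (A * B) * C = A * (B * (C :: 'a :: comm_ring_1 mat))"
  by (rule assoc_mult_mat[of A "dim_row A" "dim_row B" B "dim_row C" C "dim_col C"]) auto

lemma mat_distrib_left:
  "\<lbrakk>dim_col A = dim_row B; dim_row B = dim_row C; dim_col B = dim_col C\<rbrakk> \<Longrightarrow> A * (B + C) = A * B + A * (C :: 'a :: comm_ring_1 mat)"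
  by (rule mult_add_distrib_mat[of A "dim_row A" "dim_row B" B "dim_col C" C]) auto

lemma mat_distrib_right:
  "\<lbrakk>dim_col A = dim_row C; dim_row A = dim_row B; dim_col A = dim_col B\<rbrakk> \<Longrightarrow> (A + B) * C = A * C + B * (C :: 'a :: comm_ring_1 mat)"
  by (rule add_mult_distrib_mat[of A "dim_row A" "dim_row C" B C "dim_col C"]) auto

lemma mat_smult_left: "dim_col A = dim_row B \<Longrightarrow> (c \<cdot>\<^sub>m A) * B = c \<cdot>\<^sub>m (A * (B :: 'a :: comm_ring_1 mat))"
  by (rule mult_smult_assoc_mat[of A "dim_row A" "dim_row B" B "dim_col B"]) auto

lemma mat_smult_right: "dim_col A = dim_row B \<Longrightarrow> A * (c \<cdot>\<^sub>m B) = c \<cdot>\<^sub>m (A * (B :: 'a :: comm_ring_1 mat))"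
  by (rule mult_smult_distrib[of A "dim_row A" "dim_row B" B "dim_col B"]) auto

lemma mat_uminus_left: "dim_col A = dim_row B \<Longrightarrow> (- A) * B = - (A * (B :: 'a :: comm_ring_1 mat))"
  and mat_uminus_right: "dim_col A = dim_row B \<Longrightarrow> A * (- B) = - (A * (B :: 'a :: comm_ring_1 mat))"
  by simp_all

lemma mat_transpose_mult: "dim_col A = dim_row B \<Longrightarrow> (A * B)\<^sup>T = B\<^sup>T * (A :: 'a :: comm_ring_1 mat)\<^sup>T"
  by (rule transpose_mult[of A "dim_row A" "dim_row B" B "dim_col B"]) auto

lemma mat_transpose_smult: "(c \<cdot>\<^sub>m A)\<^sup>T = c \<cdot>\<^sub>m (A :: 'a :: comm_ring_1 mat)\<^sup>T"
  by (rule eq_matI) auto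

lemma mat_add_zero: "\<lbrakk>dim_row A = n; dim_col A = m\<rbrakk> \<Longrightarrow> A + 0\<^sub>m n m = (A :: 'a :: comm_ring_1 mat)"
  and mat_zero_add: "\<lbrakk>dim_row A = n; dim_col A = m\<rbrakk> \<Longrightarrow> 0\<^sub>m n m + A = A"
  by (rule right_add_zero_mat left_add_zero_mat, rule carrier_matI, assumption+)+

lemma mat_uminus_zero [simp]: "- 0\<^sub>m n m = (0\<^sub>m n m :: 'a :: comm_ring_1 mat)"
  and mat_smult_zero [simp]: "c \<cdot>\<^sub>m 0\<^sub>m n m = (0\<^sub>m n m :: 'a :: comm_ring_1 mat)"
  by (rule eq_matI; simp)+

lemmas mat_expand = mat_assoc mat_distrib_left mat_distrib_right mat_smult_left mat_smult_right
  mat_uminus_left mat_uminus_right mat_add_zero mat_zero_add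

text \<open>
  The projection to k consecutive coordinates that begin at s; its transpose is the inclusion.
\<close>

definition coordinate_rows :: "nat \<Rightarrow> nat \<Rightarrow> nat \<Rightarrow> complex mat" where
  "coordinate_rows k m s = mat k m (\<lambda>(i, j). if j = s + i then 1 else 0)"

lemma coordinate_rows_dims [simp]: "dim_row (coordinate_rows k m s) = k" "dim_col (coordinate_rows k m s) = m"
  by (simp_all add: coordinate_rows_def)

lemma coordinate_rows_mult_transpose:
  assumes "s + k \<le> m"
  shows "coordinate_rows k m s * (coordinate_rows k m s)\<^sup>T = 1\<^sub>m k"
    and "s' + k' \<le> m \<Longrightarrow> s + k \<le> s' \<or> s' + k' \<le> s \<Longrightarrow> coordinate_rows k m s * (coordinate_rows k' m s')\<^sup>T = 0\<^sub>m k k'"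
  using assms by (auto intro!: eq_matI simp: coordinate_rows_def scalar_prod_def if_distrib cong: if_cong)

lemma coordinate_rows_resolution:
  assumes "m = k1 + k2 + k3"
  shows "(coordinate_rows k1 m 0)\<^sup>T * coordinate_rows k1 m 0 + (coordinate_rows k2 m k1)\<^sup>T * coordinate_rows k2 m k1
    + (coordinate_rows k3 m (k1 + k2))\<^sup>T * coordinate_rows k3 m (k1 + k2) = 1\<^sub>m m"
proof -
  have e: "((coordinate_rows k m s)\<^sup>T * coordinate_rows k m s) $$ (i, j) = of_bool (i = j \<and> s \<le> i \<and> i < s + k)"
    if "i < m" "j < m" for k s i j
  proof -
    have "((coordinate_rows k m s)\<^sup>T * coordinate_rows k m s) $$ (i, j) = (\<Sum>l\<in>{0..<k}. (if i = s + l then 1 else 0) * (if j = s + l then 1 else 0))"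
      using that by (simp add: coordinate_rows_def scalar_prod_def)
    also have "\<dots> = (\<Sum>l\<in>{0..<k}. if l = i - s then of_bool (i = j \<and> s \<le> i) else 0)"
      by (intro sum.cong) auto
    also have "\<dots> = of_bool (i = j \<and> s \<le> i \<and> i < s + k)" by auto
    finally show ?thesis .
  qed
  show ?thesis
  proof (rule eq_matI)
    fix i j assume "i < dim_row (1\<^sub>m m :: complex mat)" "j < dim_col (1\<^sub>m m :: complex mat)"
    then have ij: "i < m" "j < m" by simp_all
    then have "((coordinate_rows k1 m 0)\<^sup>T * coordinate_rows k1 m 0 + (coordinate_rows k2 m k1)\<^sup>T * coordinate_rows k2 m k1
      + (coordinate_rows k3 m (k1 + k2))\<^sup>T * coordinate_rows k3 m (k1 + k2)) $$ (i, j) =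
      of_bool (i = j \<and> 0 \<le> i \<and> i < 0 + k1) + of_bool (i = j \<and> k1 \<le> i \<and> i < k1 + k2)
      + of_bool (i = j \<and> k1 + k2 \<le> i \<and> i < k1 + k2 + k3)"
      by (simp add: e del: index_mult_mat(1))
    also have "\<dots> = 1\<^sub>m m $$ (i, j)" using ij assms by auto
    finally show "((coordinate_rows k1 m 0)\<^sup>T * coordinate_rows k1 m 0 + (coordinate_rows k2 m k1)\<^sup>T * coordinate_rows k2 m k1
      + (coordinate_rows k3 m (k1 + k2))\<^sup>T * coordinate_rows k3 m (k1 + k2)) $$ (i, j) = 1\<^sub>m m $$ (i, j)" .
  qed simp_all
qed

text \<open>
  Stack the three matrices to an injective matrix X, take its cokernel R, and split R into blocks
  again. The four properties say that R X = 0, that R is surjective, that the kernel of R is the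
  image of X (for vectors in the first summand), and that matrices which kill X factor through R.
\<close>

lemma cokernel_of_three:
  fixes D A b :: "complex mat"
  assumes D: "D \<in> carrier_mat v1 q" and A: "A \<in> carrier_mat v3 q" and b: "b \<in> carrier_mat 1 q"
    and inj: "\<And>U. \<lbrakk>U \<in> carrier_mat q 1; D * U = 0\<^sub>m v1 1; A * U = 0\<^sub>m v3 1; b * U = 0\<^sub>m 1 1\<rbrakk> \<Longrightarrow> U = 0\<^sub>m q 1"
  shows "q \<le> v1 + v3 + 1"
    and "\<exists>R1 R3 Rc. R1 \<in> carrier_mat (v1 + v3 + 1 - q) v1 \<and> R3 \<in> carrier_mat (v1 + v3 + 1 - q) v3 \<and>
      Rc \<in> carrier_mat (v1 + v3 + 1 - q) 1 \<and>
      R1 * D + R3 * A + Rc * b = 0\<^sub>m (v1 + v3 + 1 - q) q \<and>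
      (\<forall>Y\<in>carrier_mat 1 (v1 + v3 + 1 - q). Y * R1 = 0\<^sub>m 1 v1 \<and> Y * R3 = 0\<^sub>m 1 v3 \<and> Y * Rc = 0\<^sub>m 1 1 \<longrightarrow>
         Y = 0\<^sub>m 1 (v1 + v3 + 1 - q)) \<and>
      (\<forall>U\<in>carrier_mat v1 1. R1 * U = 0\<^sub>m (v1 + v3 + 1 - q) 1 \<longrightarrow>
         (\<exists>T\<in>carrier_mat q 1. D * T = U \<and> A * T = 0\<^sub>m v3 1 \<and> b * T = 0\<^sub>m 1 1)) \<and>
      (\<forall>k. \<forall>F1\<in>carrier_mat k v1. \<forall>F3\<in>carrier_mat k v3. \<forall>Fc\<in>carrier_mat k 1.
         F1 * D + F3 * A + Fc * b = 0\<^sub>m k q \<longrightarrow>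
         (\<exists>C\<in>carrier_mat k (v1 + v3 + 1 - q). C * R1 = F1 \<and> C * R3 = F3 \<and> C * Rc = Fc))"
proof -
  define m where "m = v1 + v3 + 1"
  define E1 where "E1 = coordinate_rows v1 m 0"
  define E3 where "E3 = coordinate_rows v3 m v1"
  define Ec where "Ec = coordinate_rows 1 m (v1 + v3)"
  have dE [simp]: "dim_row E1 = v1" "dim_row E3 = v3" "dim_row Ec = 1" "dim_col E1 = m" "dim_col E3 = m" "dim_col Ec = m"
    by (simp_all add: E1_def E3_def Ec_def)
  have dm [simp]: "dim_row D = v1" "dim_col D = q" "dim_row A = v3" "dim_col A = q" "dim_row b = 1" "dim_col b = q"
    using D A b by auto
  have EE: "E1 * E1\<^sup>T = 1\<^sub>m v1" "E1 * E3\<^sup>T = 0\<^sub>m v1 v3" "E1 * Ec\<^sup>T = 0\<^sub>m v1 1"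
     "E3 * E1\<^sup>T = 0\<^sub>m v3 v1" "E3 * E3\<^sup>T = 1\<^sub>m v3" "E3 * Ec\<^sup>T = 0\<^sub>m v3 1"
     "Ec * E1\<^sup>T = 0\<^sub>m 1 v1" "Ec * E3\<^sup>T = 0\<^sub>m 1 v3" "Ec * Ec\<^sup>T = 1\<^sub>m 1"
    unfolding E1_def E3_def Ec_def m_def by (auto intro!: coordinate_rows_mult_transpose)
  have res: "E1\<^sup>T * E1 + E3\<^sup>T * E3 + Ec\<^sup>T * Ec = 1\<^sub>m m"
    unfolding E1_def E3_def Ec_def m_def by (rule coordinate_rows_resolution) simp
  define X where "X = E1\<^sup>T * D + E3\<^sup>T * A + Ec\<^sup>T * b"
  have dX [simp]: "dim_row X = m" "dim_col X = q" by (simp_all add: X_def)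
  have EX': "E * X = (E * E1\<^sup>T) * D + (E * E3\<^sup>T) * A + (E * Ec\<^sup>T) * b" if "dim_col E = m" for E
    unfolding X_def using that by (simp add: mat_assoc mat_distrib_left)
  have EX: "E1 * X = D" "E3 * X = A" "Ec * X = b"
    unfolding EX'[OF dE(4)] EX'[OF dE(5)] EX'[OF dE(6)] EE using D A b by simp_all
  have X: "X \<in> carrier_mat m q" by (rule carrier_matI) simp_all
  have injX: "injective_mat X"
    unfolding injective_mat_def dX
  proof (intro ballI impI)
    fix u :: "complex vec" assume u: "u \<in> carrier_vec q" "X *\<^sub>v u = 0\<^sub>v m"
    define U where "U = mat q 1 (\<lambda>(i, j). u $ i)"
    have dU [simp]: "dim_row U = q" "dim_col U = 1" by (simp_all add: U_def)
    have "col U 0 = u" using u by (intro eq_vecI) (auto simp: U_def)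
    then have "X * U = 0\<^sub>m m 1" using u(2) X by (intro eq_matI) (auto simp flip: index_mult_mat_vec)
    then have "E * X * U = 0\<^sub>m (dim_row E) 1" if "dim_col E = m" for E using that by (simp add: mat_assoc)
    from this[OF dE(4)] this[OF dE(5)] this[OF dE(6)]
    have "D * U = 0\<^sub>m v1 1" "A * U = 0\<^sub>m v3 1" "b * U = 0\<^sub>m 1 1" unfolding EX by simp_all
    then have "U = 0\<^sub>m q 1" using inj[of U] by (simp add: U_def)
    then have "U $$ (i, 0) = 0" if "i < q" for i using that by simp
    then show "u = 0\<^sub>v q" using u(1) by (intro eq_vecI) (auto simp: U_def)
  qed
  show "q \<le> v1 + v3 + 1" using injective_mat_le[OF X injX] by (simp add: m_def)
  define r where "r = m - q"
  obtain R Y L where R: "R \<in> carrier_mat r m" and Y: "Y \<in> carrier_mat m r" and L: "L \<in> carrier_mat q m"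
    and RX: "R * X = 0\<^sub>m r q" and RY: "R * Y = 1\<^sub>m r" and XY: "X * L + Y * R = 1\<^sub>m m"
    unfolding r_def by (rule injective_mat_complement[OF X injX])
  have dR [simp]: "dim_row R = r" "dim_col R = m" "dim_row Y = m" "dim_col Y = r" "dim_row L = q" "dim_col L = m"
    using R Y L by auto
  define R1 R3 Rc where "R1 = R * E1\<^sup>T" and "R3 = R * E3\<^sup>T" and "Rc = R * Ec\<^sup>T"
  have dRs [simp]: "dim_row R1 = r" "dim_row R3 = r" "dim_row Rc = r" "dim_col R1 = v1" "dim_col R3 = v3" "dim_col Rc = 1"
    by (simp_all add: R1_def R3_def Rc_def)
  have 1: "R1 * D + R3 * A + Rc * b = 0\<^sub>m r q"
    using RX unfolding X_def R1_def R3_def Rc_def by (simp add: mat_assoc mat_distrib_left)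
  have 2: "W = 0\<^sub>m 1 r" if W: "W \<in> carrier_mat 1 r" and z: "W * R1 = 0\<^sub>m 1 v1" "W * R3 = 0\<^sub>m 1 v3" "W * Rc = 0\<^sub>m 1 1" for W
  proof -
    have dW [simp]: "dim_row W = 1" "dim_col W = r" using W by auto
    have "W * R = W * R * (E1\<^sup>T * E1 + E3\<^sup>T * E3 + Ec\<^sup>T * Ec)" unfolding res by simp
    also have "\<dots> = (W * R1) * E1 + (W * R3) * E3 + (W * Rc) * Ec"
      unfolding R1_def R3_def Rc_def by (simp add: mat_assoc mat_distrib_left)
    also have "\<dots> = 0\<^sub>m 1 m" unfolding z by simp
    finally have "W * R * Y = 0\<^sub>m 1 r" by simp
    then show ?thesis using RY W by (simp add: mat_assoc)
  qed
  have 3: "\<exists>T\<in>carrier_mat q 1. D * T = U \<and> A * T = 0\<^sub>m v3 1 \<and> b * T = 0\<^sub>m 1 1"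
    if U: "U \<in> carrier_mat v1 1" and z: "R1 * U = 0\<^sub>m r 1" for U
  proof -
    have dU [simp]: "dim_row U = v1" "dim_col U = 1" using U by auto
    have RU: "R * (E1\<^sup>T * U) = 0\<^sub>m r 1" using z unfolding R1_def by (simp add: mat_assoc)
    have "E1\<^sup>T * U = (X * L + Y * R) * (E1\<^sup>T * U)" unfolding XY by simp
    also have "\<dots> = X * (L * (E1\<^sup>T * U)) + Y * (R * (E1\<^sup>T * U))" by (simp add: mat_assoc mat_distrib_right)
    also have "\<dots> = X * (L * (E1\<^sup>T * U))" unfolding RU by (simp add: mat_add_zero)
    finally have e: "X * (L * (E1\<^sup>T * U)) = E1\<^sup>T * U" by simp
    define T where "T = L * (E1\<^sup>T * U)"
    have dT: "dim_row T = q" "dim_col T = 1" by (simp_all add: T_def)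
    have "D * T = E1 * (X * T)" "A * T = E3 * (X * T)" "b * T = Ec * (X * T)"
      unfolding EX[symmetric] using dT by (simp_all only: mat_assoc dE dX)
    then have "D * T = U" "A * T = 0\<^sub>m v3 1" "b * T = 0\<^sub>m 1 1"
      unfolding T_def e by (simp_all flip: mat_assoc add: EE)
    then show ?thesis using dT by (intro bexI[of _ T]) auto
  qed
  have 4: "\<exists>C\<in>carrier_mat k r. C * R1 = F1 \<and> C * R3 = F3 \<and> C * Rc = Fc"
    if F: "F1 \<in> carrier_mat k v1" "F3 \<in> carrier_mat k v3" "Fc \<in> carrier_mat k 1"
      and z: "F1 * D + F3 * A + Fc * b = 0\<^sub>m k q" for k F1 F3 Fc
  proof -
    have dF [simp]: "dim_row F1 = k" "dim_row F3 = k" "dim_row Fc = k" "dim_col F1 = v1" "dim_col F3 = v3" "dim_col Fc = 1"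
      using F by auto
    define G where "G = F1 * E1 + F3 * E3 + Fc * Ec"
    have dG [simp]: "dim_row G = k" "dim_col G = m" by (simp_all add: G_def)
    have "G * X = F1 * (E1 * X) + F3 * (E3 * X) + Fc * (Ec * X)"
      unfolding G_def by (simp add: mat_assoc mat_distrib_right)
    then have GX: "G * X = 0\<^sub>m k q" unfolding EX z .
    have "G = G * (X * L + Y * R)" unfolding XY by simp
    also have "\<dots> = (G * X) * L + (G * Y) * R" by (simp add: mat_assoc mat_distrib_left)
    also have "\<dots> = G * Y * R" unfolding GX by (simp add: mat_zero_add)
    finally have GYR: "G * Y * R = G" by simp
    have "G * Y * R1 = (G * Y * R) * E1\<^sup>T" "G * Y * R3 = (G * Y * R) * E3\<^sup>T" "G * Y * Rc = (G * Y * R) * Ec\<^sup>T"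
      unfolding R1_def R3_def Rc_def by (simp_all add: mat_assoc)
    then have "G * Y * R1 = F1" "G * Y * R3 = F3" "G * Y * Rc = Fc"
      unfolding GYR unfolding G_def using F by (simp_all add: mat_assoc mat_distrib_right EE)
    then show ?thesis by (intro bexI[of _ "G * Y"] conjI carrier_matI) simp_all
  qed
  have car: "R1 \<in> carrier_mat r v1" "R3 \<in> carrier_mat r v3" "Rc \<in> carrier_mat r 1" by (auto intro!: carrier_matI)
  show "\<exists>R1 R3 Rc. R1 \<in> carrier_mat (v1 + v3 + 1 - q) v1 \<and> R3 \<in> carrier_mat (v1 + v3 + 1 - q) v3 \<and>
      Rc \<in> carrier_mat (v1 + v3 + 1 - q) 1 \<and>
      R1 * D + R3 * A + Rc * b = 0\<^sub>m (v1 + v3 + 1 - q) q \<and>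
      (\<forall>Y\<in>carrier_mat 1 (v1 + v3 + 1 - q). Y * R1 = 0\<^sub>m 1 v1 \<and> Y * R3 = 0\<^sub>m 1 v3 \<and> Y * Rc = 0\<^sub>m 1 1 \<longrightarrow>
         Y = 0\<^sub>m 1 (v1 + v3 + 1 - q)) \<and>
      (\<forall>U\<in>carrier_mat v1 1. R1 * U = 0\<^sub>m (v1 + v3 + 1 - q) 1 \<longrightarrow>
         (\<exists>T\<in>carrier_mat q 1. D * T = U \<and> A * T = 0\<^sub>m v3 1 \<and> b * T = 0\<^sub>m 1 1)) \<and>
      (\<forall>k. \<forall>F1\<in>carrier_mat k v1. \<forall>F3\<in>carrier_mat k v3. \<forall>Fc\<in>carrier_mat k 1.
         F1 * D + F3 * A + Fc * b = 0\<^sub>m k q \<longrightarrow>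
         (\<exists>C\<in>carrier_mat k (v1 + v3 + 1 - q). C * R1 = F1 \<and> C * R3 = F3 \<and> C * Rc = Fc))"
    unfolding m_def[symmetric] r_def[symmetric]
    by (intro exI[of _ R1] exI[of _ R3] exI[of _ Rc] conjI car 1 ballI impI allI) (use 2 3 4 in auto)
qed

section \<open>Transitions of linear maps at a segment\<close>

text \<open>
  By the existence of eigenvectors, the absence of a nonzero invariant subspace in the kernel of
  both A and b can be tested on eigenvectors (the Hautus test). Vectors are matrices with one
  column, so that transposition exchanges the two notions.
\<close>

definition observable :: "complex mat \<Rightarrow> complex mat \<Rightarrow> complex mat \<Rightarrow> bool" where
  "observable A b B \<longleftrightarrow> (\<forall>c. \<forall>U\<in>carrier_mat (dim_row B) 1.
     B * U = c \<cdot>\<^sub>m U \<and> A * U = 0\<^sub>m (dim_row A) 1 \<and> b * U = 0\<^sub>m (dim_row b) 1 \<longrightarrow> U = 0\<^sub>m (dim_row B) 1)"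

definition controllable :: "complex mat \<Rightarrow> complex mat \<Rightarrow> complex mat \<Rightarrow> bool" where
  "controllable A a B \<longleftrightarrow> (\<forall>c. \<forall>Y\<in>carrier_mat 1 (dim_row B).
     Y * B = c \<cdot>\<^sub>m Y \<and> Y * A = 0\<^sub>m 1 (dim_col A) \<and> Y * a = 0\<^sub>m 1 (dim_col a) \<longrightarrow> Y = 0\<^sub>m 1 (dim_row B))"

lemma observable_transpose:
  assumes "B \<in> carrier_mat m m" "A \<in> carrier_mat m k" "a \<in> carrier_mat m l"
  shows "observable A\<^sup>T a\<^sup>T B\<^sup>T \<longleftrightarrow> controllable A a B"
proof -
  have d: "dim_row B = m" "dim_col B = m" "dim_row A = m" "dim_col A = k" "dim_row a = m" "dim_col a = l"
    using assms by auto
  show ?thesis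
  proof
    assume O: "observable A\<^sup>T a\<^sup>T B\<^sup>T"
    show "controllable A a B" unfolding controllable_def d
    proof (intro allI ballI impI)
      fix c Y assume Y: "Y \<in> carrier_mat 1 m" and z: "Y * B = c \<cdot>\<^sub>m Y \<and> Y * A = 0\<^sub>m 1 k \<and> Y * a = 0\<^sub>m 1 l"
      have dY: "dim_row Y = 1" "dim_col Y = m" using Y by auto
      have "(Y * B)\<^sup>T = (c \<cdot>\<^sub>m Y)\<^sup>T" "(Y * A)\<^sup>T = (0\<^sub>m 1 k)\<^sup>T" "(Y * a)\<^sup>T = (0\<^sub>m 1 l)\<^sup>T" using z by simp_all
      then have "B\<^sup>T * Y\<^sup>T = c \<cdot>\<^sub>m Y\<^sup>T" "A\<^sup>T * Y\<^sup>T = 0\<^sub>m k 1" "a\<^sup>T * Y\<^sup>T = 0\<^sub>m l 1"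
        using d dY by (simp_all add: mat_transpose_mult mat_transpose_smult)
      then have "Y\<^sup>T = 0\<^sub>m m 1" using O[unfolded observable_def, rule_format, of "Y\<^sup>T" c] Y d by simp
      then have "Y\<^sup>T\<^sup>T = (0\<^sub>m m 1)\<^sup>T" by (rule arg_cong)
      then show "Y = 0\<^sub>m 1 m" by simp
    qed
  next
    assume O: "controllable A a B"
    show "observable A\<^sup>T a\<^sup>T B\<^sup>T" unfolding observable_def index_transpose_mat d
    proof (intro allI ballI impI)
      fix c U assume U: "U \<in> carrier_mat m 1" and z: "B\<^sup>T * U = c \<cdot>\<^sub>m U \<and> A\<^sup>T * U = 0\<^sub>m k 1 \<and> a\<^sup>T * U = 0\<^sub>m l 1"
      have dU: "dim_row U = m" "dim_col U = 1" using U by auto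
      have "(B\<^sup>T * U)\<^sup>T = (c \<cdot>\<^sub>m U)\<^sup>T" "(A\<^sup>T * U)\<^sup>T = (0\<^sub>m k 1)\<^sup>T" "(a\<^sup>T * U)\<^sup>T = (0\<^sub>m l 1)\<^sup>T" using z by simp_all
      then have "U\<^sup>T * B = c \<cdot>\<^sub>m U\<^sup>T" "U\<^sup>T * A = 0\<^sub>m 1 k" "U\<^sup>T * a = 0\<^sub>m 1 l"
        using d dU by (simp_all add: mat_transpose_mult mat_transpose_smult)
      then have "U\<^sup>T = 0\<^sub>m 1 m" using O[unfolded controllable_def, rule_format, of "U\<^sup>T" c] U d by simp
      then have "U\<^sup>T\<^sup>T = (0\<^sub>m 1 m)\<^sup>T" by (rule arg_cong)
      then show "U = 0\<^sub>m m 1" by simp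
    qed
  qed
qed

lemma mat_add_eq_zero:
  fixes A B :: "complex mat"
  assumes "A \<in> carrier_mat r c" "B \<in> carrier_mat r c" "A + B = 0\<^sub>m r c" shows "A = - B"
proof (rule eq_matI)
  fix i j assume "i < dim_row (- B)" "j < dim_col (- B)"
  then have ij: "i < r" "j < c" using assms by auto
  then have "(A + B) $$ (i, j) = 0" using assms(3) by simp
  then show "A $$ (i, j) = (- B) $$ (i, j)" using ij assms(1,2) by (simp add: eq_neg_iff_add_eq_0)
qed (use assms in auto)

text \<open>
  The local form of a transition. Before it, an arrow with maps C, D between spaces of dimensions
  v1, v2 is followed by an x-point with maps A, B2, B3, a, b between dimensions v2, v3. The map
  (D, A, b) from the middle space to the sum of the two outer spaces and a line is injective: on
  its kernel B2 is the scalar l, so observability applies. Its cokernel is the new middle space.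
  The new maps into it are the three blocks R1, R3, Rc of the cokernel projection. By the triangle
  relation and the moment map equation, (- A C, l - B3, - a) vanishes on the image of (D, A, b),
  so it factors through the cokernel, and C' is the factor.

  Eigenvectors that violate the new conditions produce eigenvectors that violate the old ones,
  with the eigenvalue shifted by l.
\<close>

lemma transition_by_cokernel:
  fixes C D A B2 B3 a b :: "complex mat"
  assumes C: "C \<in> carrier_mat v2 v1" and D: "D \<in> carrier_mat v1 v2" and A: "A \<in> carrier_mat v3 v2"
    and B2: "B2 \<in> carrier_mat v2 v2" and B3: "B3 \<in> carrier_mat v3 v3"
    and a: "a \<in> carrier_mat v3 1" and b: "b \<in> carrier_mat 1 v2"
    and rel: "B3 * A - A * B2 + a * b = 0\<^sub>m v3 v2"
    and obs: "observable A b B2" and con: "controllable A a B3"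
    and mom: "C * D + B2 = l \<cdot>\<^sub>m 1\<^sub>m v2"
  defines "r \<equiv> v1 + v3 + 1 - v2"
  shows "v2 \<le> v1 + v3 + 1"
    and "\<exists>A' B2' a' b' C' D'. A' \<in> carrier_mat r v1 \<and> B2' \<in> carrier_mat r r \<and> a' \<in> carrier_mat r 1 \<and>
      b' \<in> carrier_mat 1 v1 \<and> C' \<in> carrier_mat v3 r \<and> D' \<in> carrier_mat r v3 \<and>
      B2' * A' - A' * (- (D * C)) + a' * b' = 0\<^sub>m r v1 \<and>
      observable A' b' (- (D * C)) \<and> controllable A' a' B2' \<and>
      B2' + D' * C' = 0\<^sub>m r r \<and> C' * D' = - B3 + l \<cdot>\<^sub>m 1\<^sub>m v3"
proof -
  have dm [simp]: "dim_row C = v2" "dim_col C = v1" "dim_row D = v1" "dim_col D = v2" "dim_row A = v3" "dim_col A = v2"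
    "dim_row B2 = v2" "dim_col B2 = v2" "dim_row B3 = v3" "dim_col B3 = v3" "dim_row a = v3" "dim_col a = 1"
    "dim_row b = 1" "dim_col b = v2" using assms by auto
  have B2': "B2 = l \<cdot>\<^sub>m 1\<^sub>m v2 + - (C * D)"
  proof (rule eq_matI)
    fix i j assume "i < dim_row (l \<cdot>\<^sub>m 1\<^sub>m v2 + - (C * D))" "j < dim_col (l \<cdot>\<^sub>m 1\<^sub>m v2 + - (C * D))"
    then have ij: "i < v2" "j < v2" by auto
    have "(C * D + B2) $$ (i, j) = (l \<cdot>\<^sub>m 1\<^sub>m v2) $$ (i, j)" using mom by simp
    then show "B2 $$ (i, j) = (l \<cdot>\<^sub>m 1\<^sub>m v2 + - (C * D)) $$ (i, j)"
      using ij by (simp add: algebra_simps del: index_mult_mat(1))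
  qed auto
  have B3A: "B3 * A + a * b = A * B2"
  proof (rule eq_matI)
    fix i j assume "i < dim_row (A * B2)" "j < dim_col (A * B2)"
    then have ij: "i < v3" "j < v2" by auto
    have "(B3 * A - A * B2 + a * b) $$ (i, j) = 0" using rel ij by simp
    then show "(B3 * A + a * b) $$ (i, j) = (A * B2) $$ (i, j)"
      using ij by (simp add: algebra_simps del: index_mult_mat(1))
  qed auto
  have inj: "U = 0\<^sub>m v2 1"
    if U: "U \<in> carrier_mat v2 1" and z: "D * U = 0\<^sub>m v1 1" "A * U = 0\<^sub>m v3 1" "b * U = 0\<^sub>m 1 1" for U
  proof -
    have dU [simp]: "dim_row U = v2" "dim_col U = 1" using U by auto
    have "B2 * U = l \<cdot>\<^sub>m U + - (C * (D * U))" unfolding B2' by (simp add: mat_expand)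
    then have "B2 * U = l \<cdot>\<^sub>m U" unfolding z(1) by (simp add: mat_add_zero)
    then show ?thesis using obs[unfolded observable_def, rule_format, of U l] U z by simp
  qed
  show "v2 \<le> v1 + v3 + 1" by (rule cokernel_of_three(1)[OF D A b inj])
  obtain R1 R3 Rc where R: "R1 \<in> carrier_mat r v1" "R3 \<in> carrier_mat r v3" "Rc \<in> carrier_mat r 1"
    and RX: "R1 * D + R3 * A + Rc * b = 0\<^sub>m r v2"
    and surj: "\<forall>Y\<in>carrier_mat 1 r. Y * R1 = 0\<^sub>m 1 v1 \<and> Y * R3 = 0\<^sub>m 1 v3 \<and> Y * Rc = 0\<^sub>m 1 1 \<longrightarrow> Y = 0\<^sub>m 1 r"
    and exact: "\<forall>U\<in>carrier_mat v1 1. R1 * U = 0\<^sub>m r 1 \<longrightarrow>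
         (\<exists>T\<in>carrier_mat v2 1. D * T = U \<and> A * T = 0\<^sub>m v3 1 \<and> b * T = 0\<^sub>m 1 1)"
    and fact: "\<forall>k. \<forall>F1\<in>carrier_mat k v1. \<forall>F3\<in>carrier_mat k v3. \<forall>Fc\<in>carrier_mat k 1.
         F1 * D + F3 * A + Fc * b = 0\<^sub>m k v2 \<longrightarrow>
         (\<exists>C\<in>carrier_mat k r. C * R1 = F1 \<and> C * R3 = F3 \<and> C * Rc = Fc)"
    using cokernel_of_three(2)[OF D A b inj] unfolding r_def by blast
  have dR [simp]: "dim_row R1 = r" "dim_col R1 = v1" "dim_row R3 = r" "dim_col R3 = v3" "dim_row Rc = r" "dim_col Rc = 1"
    using R by auto
  \<comment> \<open>The three maps out of the outer spaces that C' has to induce.\<close>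
  have "(- (A * C)) * D + (- B3 + l \<cdot>\<^sub>m 1\<^sub>m v3) * A + (- a) * b = 0\<^sub>m v3 v2"
  proof -
    have e: "(- (A * C)) * D + (- B3 + l \<cdot>\<^sub>m 1\<^sub>m v3) * A + (- a) * b =
      - (A * (C * D)) + (- (B3 * A) + l \<cdot>\<^sub>m A) + - (a * b)" by (simp add: mat_expand)
    have "A * B2 = l \<cdot>\<^sub>m A + - (A * (C * D))" unfolding B2' using A by (simp add: mat_expand)
    then have f: "B3 * A + a * b = l \<cdot>\<^sub>m A + - (A * (C * D))" using B3A by simp
    show ?thesis unfolding e
    proof (rule eq_matI)
      fix i j assume "i < dim_row (0\<^sub>m v3 v2 :: complex mat)" "j < dim_col (0\<^sub>m v3 v2 :: complex mat)"
      then have ij: "i < v3" "j < v2" by auto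
      have "(B3 * A + a * b) $$ (i, j) = (l \<cdot>\<^sub>m A + - (A * (C * D))) $$ (i, j)" using f by simp
      then show "(- (A * (C * D)) + (- (B3 * A) + l \<cdot>\<^sub>m A) + - (a * b)) $$ (i, j) = 0\<^sub>m v3 v2 $$ (i, j)"
        using ij by (simp add: algebra_simps del: index_mult_mat(1))
    qed auto
  qed
  moreover have "- (A * C) \<in> carrier_mat v3 v1" "- B3 + l \<cdot>\<^sub>m 1\<^sub>m v3 \<in> carrier_mat v3 v3" "- a \<in> carrier_mat v3 1"
    using a by (auto intro!: carrier_matI)
  ultimately obtain C' where C': "C' \<in> carrier_mat v3 r" and C'R: "C' * R1 = - (A * C)" "C' * R3 = - B3 + l \<cdot>\<^sub>m 1\<^sub>m v3" "C' * Rc = - a"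
    using fact by blast
  have dC' [simp]: "dim_row C' = v3" "dim_col C' = r" using C' by auto
  define M where "M = - (R3 * C')"
  have dM [simp]: "dim_row M = r" "dim_col M = r" by (simp_all add: M_def)
  have 1: "M * R1 - R1 * (- (D * C)) + Rc * (b * C) = 0\<^sub>m r v1"
  proof -
    have "(R1 * D + R3 * A + Rc * b) * C = 0\<^sub>m r v1" unfolding RX by simp
    then have z: "R1 * (D * C) + R3 * (A * C) + Rc * (b * C) = 0\<^sub>m r v1" by (simp add: mat_expand)
    have "M * R1 = - (R3 * (C' * R1))" unfolding M_def by (simp add: mat_expand)
    also have "\<dots> = R3 * (A * C)" unfolding C'R by simp
    finally have e: "M * R1 = R3 * (A * C)" .
    have e': "R1 * (- (D * C)) = - (R1 * (D * C))" by simp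
    show ?thesis unfolding e e'
    proof (rule eq_matI)
      fix i j assume "i < dim_row (0\<^sub>m r v1 :: complex mat)" "j < dim_col (0\<^sub>m r v1 :: complex mat)"
      then have ij: "i < r" "j < v1" by auto
      have "(R1 * (D * C) + R3 * (A * C) + Rc * (b * C)) $$ (i, j) = 0" using z ij by simp
      then show "(R3 * (A * C) - - (R1 * (D * C)) + Rc * (b * C)) $$ (i, j) = 0\<^sub>m r v1 $$ (i, j)"
        using ij by (simp add: algebra_simps del: index_mult_mat(1))
    qed auto
  qed
  have 2: "observable R1 (b * C) (- (D * C))"
    unfolding observable_def
  proof (intro allI ballI impI)
    fix c U assume U: "U \<in> carrier_mat (dim_row (- (D * C))) 1"
      and z: "(- (D * C)) * U = c \<cdot>\<^sub>m U \<and> R1 * U = 0\<^sub>m (dim_row R1) 1 \<and> b * C * U = 0\<^sub>m (dim_row (b * C)) 1"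
    have U': "U \<in> carrier_mat v1 1" and dU [simp]: "dim_row U = v1" "dim_col U = 1" using U by auto
    have z': "- (D * (C * U)) = c \<cdot>\<^sub>m U" "R1 * U = 0\<^sub>m r 1" "b * (C * U) = 0\<^sub>m 1 1"
      using z by (simp_all add: mat_expand)
    obtain T where T: "T \<in> carrier_mat v2 1" "D * T = U" "A * T = 0\<^sub>m v3 1" "b * T = 0\<^sub>m 1 1"
      using exact U' z'(2) by blast
    have dT [simp]: "dim_row T = v2" "dim_col T = 1" using T by auto
    \<comment> \<open>T is a preimage of U; injectivity shows that S vanishes, so T is an eigenvector of B2.\<close>
    define S where "S = C * U + c \<cdot>\<^sub>m T"
    have dS [simp]: "dim_row S = v2" "dim_col S = 1" by (simp_all add: S_def)
    have "D * S = D * (C * U) + c \<cdot>\<^sub>m U" unfolding S_def using T(2) by (simp add: mat_expand)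
    also have "\<dots> = 0\<^sub>m v1 1" unfolding z'(1)[symmetric] by (rule eq_matI) (auto simp del: index_mult_mat(1))
    finally have s1: "D * S = 0\<^sub>m v1 1" .
    have "b * S = b * (C * U) + c \<cdot>\<^sub>m (b * T)" unfolding S_def by (simp add: mat_expand)
    then have s2: "b * S = 0\<^sub>m 1 1" unfolding z'(3) T(4) by (intro eq_matI) auto
    have B2T: "B2 * T = l \<cdot>\<^sub>m T + - (C * U)"
      unfolding B2' using T(2) by (simp add: mat_expand)
    have "A * (B2 * T) = B3 * (A * T) + a * (b * T)"
    proof -
      have "(A * B2) * T = (B3 * A + a * b) * T" by (simp only: B3A)
      then show ?thesis by (simp add: mat_expand)
    qed
    then have "A * (B2 * T) = 0\<^sub>m v3 1" unfolding T(3,4) by (simp add: mat_add_zero)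
    moreover have "A * (B2 * T) = l \<cdot>\<^sub>m (A * T) + - (A * (C * U))" unfolding B2T by (simp add: mat_expand)
    ultimately have ACU: "- (A * (C * U)) = 0\<^sub>m v3 1" unfolding T(3) by (simp add: mat_zero_add)
    have "A * S = A * (C * U) + c \<cdot>\<^sub>m (A * T)" unfolding S_def by (simp add: mat_expand)
    also have "A * (C * U) = - (- (A * (C * U)))" by simp
    finally have s3: "A * S = 0\<^sub>m v3 1" unfolding ACU T(3) by (intro eq_matI) auto
    have S0: "C * U + c \<cdot>\<^sub>m T = 0\<^sub>m v2 1" using inj[OF _ s1 s3 s2] S_def by (simp add: carrier_matI)
    have "B2 * T = (l + c) \<cdot>\<^sub>m T"
    proof -
      have "C * U = - (c \<cdot>\<^sub>m T)" by (rule mat_add_eq_zero[OF _ _ S0]) (auto intro!: carrier_matI)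
      then show ?thesis unfolding B2T by (intro eq_matI) (auto simp: algebra_simps)
    qed
    then have "T = 0\<^sub>m v2 1" using obs[unfolded observable_def, rule_format, of T "l + c"] T by simp
    then show "U = 0\<^sub>m (dim_row (- (D * C))) 1" using T(2) by simp
  qed
  have 3: "controllable R1 Rc M"
    unfolding controllable_def
  proof (intro allI ballI impI)
    fix c Y assume Y: "Y \<in> carrier_mat 1 (dim_row M)"
      and z: "Y * M = c \<cdot>\<^sub>m Y \<and> Y * R1 = 0\<^sub>m 1 (dim_col R1) \<and> Y * Rc = 0\<^sub>m 1 (dim_col Rc)"
    have Y': "Y \<in> carrier_mat 1 r" and dY [simp]: "dim_row Y = 1" "dim_col Y = r" using Y by auto
    have z': "Y * M = c \<cdot>\<^sub>m Y" "Y * R1 = 0\<^sub>m 1 v1" "Y * Rc = 0\<^sub>m 1 1" using z by simp_all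
    \<comment> \<open>Z is a left eigenvector of B3 that kills A and a; then Y kills all blocks of R.\<close>
    define Z where "Z = Y * R3"
    have dZ [simp]: "dim_row Z = 1" "dim_col Z = v3" by (simp_all add: Z_def)
    have "- (Y * (R3 * C')) = c \<cdot>\<^sub>m Y" using z'(1) unfolding M_def by simp
    then have "- (- (Y * (R3 * C'))) = - (c \<cdot>\<^sub>m Y)" by (rule arg_cong)
    then have ZC: "Z * C' = - (c \<cdot>\<^sub>m Y)" unfolding Z_def by (simp add: mat_assoc)
    have "Z * (C' * R3) = - (c \<cdot>\<^sub>m Z)"
    proof -
      have "Z * (C' * R3) = (Z * C') * R3" by (simp add: mat_assoc)
      then show ?thesis unfolding ZC by (simp add: mat_expand Z_def)
    qed
    then have "- (Z * B3) + l \<cdot>\<^sub>m Z = - (c \<cdot>\<^sub>m Z)" unfolding C'R by (simp add: mat_expand)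
    then have ZB: "Z * B3 = (l + c) \<cdot>\<^sub>m Z"
    proof -
      assume h: "- (Z * B3) + l \<cdot>\<^sub>m Z = - (c \<cdot>\<^sub>m Z)"
      show ?thesis
      proof (rule eq_matI)
        fix i j assume "i < dim_row ((l + c) \<cdot>\<^sub>m Z)" "j < dim_col ((l + c) \<cdot>\<^sub>m Z)"
        then have ij: "i < 1" "j < v3" by auto
        have "(- (Z * B3) + l \<cdot>\<^sub>m Z) $$ (i, j) = (- (c \<cdot>\<^sub>m Z)) $$ (i, j)" using h by simp
        then show "(Z * B3) $$ (i, j) = ((l + c) \<cdot>\<^sub>m Z) $$ (i, j)"
          using ij by (simp add: algebra_simps del: index_mult_mat(1))
      qed auto
    qed
    have "Y * (R1 * D + R3 * A + Rc * b) = 0\<^sub>m 1 v2" unfolding RX by simp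
    then have "(Y * R1) * D + Z * A + (Y * Rc) * b = 0\<^sub>m 1 v2" unfolding Z_def by (simp add: mat_expand)
    then have ZA: "Z * A = 0\<^sub>m 1 v2" unfolding z' by (simp add: mat_add_zero mat_zero_add)
    have "Z * (C' * Rc) = (Z * C') * Rc" by (simp add: mat_assoc)
    also have "\<dots> = - (c \<cdot>\<^sub>m (Y * Rc))" unfolding ZC by (simp add: mat_expand)
    finally have "- (Z * a) = - (c \<cdot>\<^sub>m 0\<^sub>m 1 1)" unfolding z' C'R by simp
    then have "- (Z * a) = 0\<^sub>m 1 1" by simp
    then have "- (- (Z * a)) = - 0\<^sub>m 1 1" by (rule arg_cong)
    then have Za: "Z * a = 0\<^sub>m 1 1" by simp
    have "Z = 0\<^sub>m 1 v3"
      using con[unfolded controllable_def, rule_format, of Z "l + c"] ZB ZA Za by (simp add: carrier_matI)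
    then show "Y = 0\<^sub>m 1 (dim_row M)" using surj Y' z' by (simp add: Z_def)
  qed
  have 4: "M + R3 * C' = 0\<^sub>m r r" unfolding M_def by (rule eq_matI) (auto simp del: index_mult_mat(1))
  show "\<exists>A' B2' a' b' C' D'. A' \<in> carrier_mat r v1 \<and> B2' \<in> carrier_mat r r \<and> a' \<in> carrier_mat r 1 \<and>
      b' \<in> carrier_mat 1 v1 \<and> C' \<in> carrier_mat v3 r \<and> D' \<in> carrier_mat r v3 \<and>
      B2' * A' - A' * (- (D * C)) + a' * b' = 0\<^sub>m r v1 \<and>
      observable A' b' (- (D * C)) \<and> controllable A' a' B2' \<and>
      B2' + D' * C' = 0\<^sub>m r r \<and> C' * D' = - B3 + l \<cdot>\<^sub>m 1\<^sub>m v3"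
    using R C' 1 2 3 4 C'R(2) mult_carrier_mat[OF b C]
    by - (rule exI[of _ R1], rule exI[of _ M], rule exI[of _ Rc], rule exI[of _ "b * C"], rule exI[of _ C'], rule exI[of _ R3],
      simp add: M_def)
qed

lemma mat_uminus_eq_zero: "- M = 0\<^sub>m r c \<longleftrightarrow> M = (0\<^sub>m r c :: complex mat)"
  by (metis mat_uminus_zero uminus_uminus_mat)

lemma controllable_uminus: "controllable A (- a) B \<longleftrightarrow> controllable A a B" if "dim_row a = dim_row B"
  unfolding controllable_def using that by (auto simp: mat_uminus_eq_zero)

text \<open>
  The other order of arrow and x-point follows by transposing all maps, which reverses the
  direction of the circle. Transposition turns the triangle relation into one with the opposite
  sign of the last term, which is absorbed in a, and it changes the sign of the scalar l.
\<close>

lemma transition_by_kernel: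
  fixes C D A B1 B2 a b :: "complex mat"
  assumes C: "C \<in> carrier_mat v3 v2" and D: "D \<in> carrier_mat v2 v3" and A: "A \<in> carrier_mat v2 v1"
    and B1: "B1 \<in> carrier_mat v1 v1" and B2: "B2 \<in> carrier_mat v2 v2"
    and a: "a \<in> carrier_mat v2 1" and b: "b \<in> carrier_mat 1 v1"
    and rel: "B2 * A - A * B1 + a * b = 0\<^sub>m v2 v1"
    and obs: "observable A b B1" and con: "controllable A a B2"
    and mom: "- B2 + - (D * C) = l \<cdot>\<^sub>m 1\<^sub>m v2"
  defines "r \<equiv> v1 + v3 + 1 - v2"
  shows "v2 \<le> v1 + v3 + 1"
    and "\<exists>A' B2' a' b' C' D'. A' \<in> carrier_mat v3 r \<and> B2' \<in> carrier_mat r r \<and> a' \<in> carrier_mat v3 1 \<and>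
      b' \<in> carrier_mat 1 r \<and> C' \<in> carrier_mat r v1 \<and> D' \<in> carrier_mat v1 r \<and>
      (- (C * D)) * A' - A' * B2' + a' * b' = 0\<^sub>m v3 r \<and>
      observable A' b' B2' \<and> controllable A' a' (- (C * D)) \<and>
      C' * D' + B2' = 0\<^sub>m r r \<and> - (D' * C') = B1 + l \<cdot>\<^sub>m 1\<^sub>m v1"
proof -
  have dm [simp]: "dim_row C = v3" "dim_col C = v2" "dim_row D = v2" "dim_col D = v3" "dim_row A = v2" "dim_col A = v1"
    "dim_row B1 = v1" "dim_col B1 = v1" "dim_row B2 = v2" "dim_col B2 = v2" "dim_row a = v2" "dim_col a = 1"
    "dim_row b = 1" "dim_col b = v1" using assms by auto
  have car: "C\<^sup>T \<in> carrier_mat v2 v3" "D\<^sup>T \<in> carrier_mat v3 v2" "A\<^sup>T \<in> carrier_mat v1 v2" "B2\<^sup>T \<in> carrier_mat v2 v2"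
    "B1\<^sup>T \<in> carrier_mat v1 v1" "- (b\<^sup>T) \<in> carrier_mat v1 1" "a\<^sup>T \<in> carrier_mat 1 v2"
    using assms by (auto intro!: carrier_matI)
  have rel': "B1\<^sup>T * A\<^sup>T - A\<^sup>T * B2\<^sup>T + (- (b\<^sup>T)) * a\<^sup>T = 0\<^sub>m v1 v2"
  proof -
    have t: "B1\<^sup>T * A\<^sup>T = (A * B1)\<^sup>T" "A\<^sup>T * B2\<^sup>T = (B2 * A)\<^sup>T" "(- (b\<^sup>T)) * a\<^sup>T = - ((a * b)\<^sup>T)"
      by (simp_all add: mat_transpose_mult)
    show ?thesis unfolding t
    proof (rule eq_matI)
      fix i j assume "i < dim_row (0\<^sub>m v1 v2 :: complex mat)" "j < dim_col (0\<^sub>m v1 v2 :: complex mat)"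
      then have ij: "i < v1" "j < v2" by auto
      have "(B2 * A - A * B1 + a * b) $$ (j, i) = 0" using rel ij by simp
      then show "((A * B1)\<^sup>T - (B2 * A)\<^sup>T + - ((a * b)\<^sup>T)) $$ (i, j) = 0\<^sub>m v1 v2 $$ (i, j)"
        using ij by (simp add: algebra_simps del: index_mult_mat(1))
    qed auto
  qed
  have obs': "observable A\<^sup>T a\<^sup>T B2\<^sup>T" using con observable_transpose[OF B2 A a] by simp
  have con': "controllable A\<^sup>T (- (b\<^sup>T)) B1\<^sup>T"
    using observable_transpose[OF car(5,3), of "b\<^sup>T" 1] b obs controllable_uminus[of "b\<^sup>T" "B1\<^sup>T"] by simp
  have mom': "C\<^sup>T * D\<^sup>T + B2\<^sup>T = (- l) \<cdot>\<^sub>m 1\<^sub>m v2"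
  proof -
    have t: "C\<^sup>T * D\<^sup>T = (D * C)\<^sup>T" by (simp add: mat_transpose_mult)
    show ?thesis unfolding t
    proof (rule eq_matI)
      fix i j assume "i < dim_row ((- l) \<cdot>\<^sub>m 1\<^sub>m v2)" "j < dim_col ((- l) \<cdot>\<^sub>m 1\<^sub>m v2)"
      then have ij: "i < v2" "j < v2" by auto
      have "(- B2 + - (D * C)) $$ (j, i) = (l \<cdot>\<^sub>m 1\<^sub>m v2) $$ (j, i)" using mom by simp
      then have "- B2 $$ (j, i) - (D * C) $$ (j, i) = (if i = j then l else 0)" using ij by (auto simp del: index_mult_mat(1))
      moreover have "(D * C) $$ (j, i) + B2 $$ (j, i) = - (- B2 $$ (j, i) - (D * C) $$ (j, i))"
        by (simp del: index_mult_mat(1))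
      ultimately have "(D * C) $$ (j, i) + B2 $$ (j, i) = - (if i = j then l else 0)" by (simp only:)
      then show "((D * C)\<^sup>T + B2\<^sup>T) $$ (i, j) = ((- l) \<cdot>\<^sub>m 1\<^sub>m v2) $$ (i, j)" using ij by (simp del: index_mult_mat(1))
    qed auto
  qed
  note H = transition_by_cokernel[OF car(1,2,3,4,5,6,7) rel' obs' con' mom']
  show "v2 \<le> v1 + v3 + 1" using H(1) by simp
  have r: "v3 + v1 + 1 - v2 = r" by (simp add: r_def)
  obtain A1 M1 a1 b1 C1 D1 where K: "A1 \<in> carrier_mat r v3" "M1 \<in> carrier_mat r r" "a1 \<in> carrier_mat r 1"
      "b1 \<in> carrier_mat 1 v3" "C1 \<in> carrier_mat v1 r" "D1 \<in> carrier_mat r v1"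
      "M1 * A1 - A1 * (- (D\<^sup>T * C\<^sup>T)) + a1 * b1 = 0\<^sub>m r v3"
      "observable A1 b1 (- (D\<^sup>T * C\<^sup>T))" "controllable A1 a1 M1"
      "M1 + D1 * C1 = 0\<^sub>m r r" "C1 * D1 = - (B1\<^sup>T) + (- l) \<cdot>\<^sub>m 1\<^sub>m v1"
    using H(2) unfolding r by blast
  have dK [simp]: "dim_row A1 = r" "dim_col A1 = v3" "dim_row M1 = r" "dim_col M1 = r" "dim_row a1 = r" "dim_col a1 = 1"
    "dim_row b1 = 1" "dim_col b1 = v3" "dim_row C1 = v1" "dim_col C1 = r" "dim_row D1 = r" "dim_col D1 = v1"
    using K(1-6) by auto
  have DC: "- (D\<^sup>T * C\<^sup>T) = (- (C * D))\<^sup>T" by (simp add: mat_transpose_mult transpose_uminus)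
  have CD: "- (C * D) \<in> carrier_mat v3 v3" by (auto intro!: carrier_matI)
  have 1: "(- (C * D)) * A1\<^sup>T - A1\<^sup>T * M1\<^sup>T + (- (b1\<^sup>T)) * a1\<^sup>T = 0\<^sub>m v3 r"
  proof -
    have t: "(- (C * D)) * A1\<^sup>T = (A1 * (- (D\<^sup>T * C\<^sup>T)))\<^sup>T" "A1\<^sup>T * M1\<^sup>T = (M1 * A1)\<^sup>T" "(- (b1\<^sup>T)) * a1\<^sup>T = - ((a1 * b1)\<^sup>T)"
      unfolding DC by (simp_all add: mat_transpose_mult transpose_uminus)
    show ?thesis unfolding t
    proof (rule eq_matI)
      fix i j assume "i < dim_row (0\<^sub>m v3 r :: complex mat)" "j < dim_col (0\<^sub>m v3 r :: complex mat)"
      then have ij: "i < v3" "j < r" by auto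
      define Z where "Z = A1 * (- (D\<^sup>T * C\<^sup>T))"
      have dZ: "dim_row Z = r" "dim_col Z = v3" by (simp_all add: Z_def)
      have "(M1 * A1 - Z + a1 * b1) $$ (j, i) = 0" using K(7) ij by (simp add: Z_def)
      then show "((A1 * (- (D\<^sup>T * C\<^sup>T)))\<^sup>T - (M1 * A1)\<^sup>T + - ((a1 * b1)\<^sup>T)) $$ (i, j) = 0\<^sub>m v3 r $$ (i, j)"
        unfolding Z_def[symmetric] using ij dZ by (simp add: algebra_simps del: index_mult_mat(1))
    qed auto
  qed
  have 2: "observable A1\<^sup>T a1\<^sup>T M1\<^sup>T" using observable_transpose[OF K(2,1,3)] K(9) by simp
  have 3: "controllable A1\<^sup>T (- (b1\<^sup>T)) (- (C * D))"
    using observable_transpose[OF CD, of "A1\<^sup>T" r "b1\<^sup>T" 1] K(1,4,8) controllable_uminus[of "b1\<^sup>T" "- (C * D)"]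
    unfolding DC by simp
  have 4: "C1\<^sup>T * D1\<^sup>T + M1\<^sup>T = 0\<^sub>m r r"
  proof -
    have t: "C1\<^sup>T * D1\<^sup>T = (D1 * C1)\<^sup>T" by (simp add: mat_transpose_mult)
    show ?thesis unfolding t
    proof (rule eq_matI)
      fix i j assume "i < dim_row (0\<^sub>m r r :: complex mat)" "j < dim_col (0\<^sub>m r r :: complex mat)"
      then have ij: "i < r" "j < r" by auto
      have "(M1 + D1 * C1) $$ (j, i) = 0" using K(10) ij by simp
      then show "((D1 * C1)\<^sup>T + M1\<^sup>T) $$ (i, j) = 0\<^sub>m r r $$ (i, j)"
        using ij by (simp add: algebra_simps del: index_mult_mat(1))
    qed auto
  qed
  have 5: "- (D1\<^sup>T * C1\<^sup>T) = B1 + l \<cdot>\<^sub>m 1\<^sub>m v1"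
  proof -
    have t: "D1\<^sup>T * C1\<^sup>T = (C1 * D1)\<^sup>T" by (simp add: mat_transpose_mult)
    show ?thesis unfolding t K(11) by (rule eq_matI) auto
  qed
  show "\<exists>A' B2' a' b' C' D'. A' \<in> carrier_mat v3 r \<and> B2' \<in> carrier_mat r r \<and> a' \<in> carrier_mat v3 1 \<and>
      b' \<in> carrier_mat 1 r \<and> C' \<in> carrier_mat r v1 \<and> D' \<in> carrier_mat v1 r \<and>
      (- (C * D)) * A' - A' * B2' + a' * b' = 0\<^sub>m v3 r \<and>
      observable A' b' B2' \<and> controllable A' a' (- (C * D)) \<and>
      C' * D' + B2' = 0\<^sub>m r r \<and> - (D' * C') = B1 + l \<cdot>\<^sub>m 1\<^sub>m v1"
    using 1 2 3 4 5 K(1-6)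
    by - (rule exI[of _ "A1\<^sup>T"], rule exI[of _ "M1\<^sup>T"], rule exI[of _ "- (b1\<^sup>T)"], rule exI[of _ "a1\<^sup>T"],
        rule exI[of _ "C1\<^sup>T"], rule exI[of _ "D1\<^sup>T"], simp)
qed

section \<open>Triangle conditions as eigenvector tests\<close>

definition column :: "complex vec \<Rightarrow> complex mat" where
  "column u = mat (dim_vec u) 1 (\<lambda>(i, j). u $ i)"

lemma column_dims [simp]: "dim_row (column u) = dim_vec u" "dim_col (column u) = 1"
  by (simp_all add: column_def)

lemma column_carrier [simp]: "column u \<in> carrier_mat m 1 \<longleftrightarrow> u \<in> carrier_vec m"
  unfolding carrier_mat_def carrier_vec_def by simp

lemma col_column [simp]: "col (column u) 0 = u"
  by (intro eq_vecI) (auto simp: column_def)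

lemma mult_column: "dim_col M = dim_vec u \<Longrightarrow> M * column u = column (M *\<^sub>v u)"
  by (intro eq_matI) (auto simp: column_def[of "M *\<^sub>v u"] simp flip: One_nat_def)

lemma column_smult: "column (c \<cdot>\<^sub>v u) = c \<cdot>\<^sub>m column u"
  by (intro eq_matI) (auto simp: column_def)

lemma column_zero [simp]: "column (0\<^sub>v m) = 0\<^sub>m m 1"
  by (intro eq_matI) (auto simp: column_def)

lemma column_inject: "column u = column v \<Longrightarrow> u = v"
  by (metis col_column)

lemma column_eq_zero: "u \<in> carrier_vec m \<Longrightarrow> column u = 0\<^sub>m m 1 \<longleftrightarrow> u = 0\<^sub>v m"
  using column_inject[of u "0\<^sub>v m"] by auto

lemma column_surj: "U \<in> carrier_mat m 1 \<Longrightarrow> U = column (col U 0)"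
  by (intro eq_matI) (auto simp: column_def)

text \<open>
  An eigenvector spans an invariant line, and an invariant subspace contains an eigenvector.
\<close>

lemma observable_iff_no_subspace:
  assumes A: "A \<in> carrier_mat p m" and b: "b \<in> carrier_mat 1 m" and B: "B \<in> carrier_mat m m"
  shows "observable A b B \<longleftrightarrow> \<not> (\<exists>W. is_subspace m W \<and> W \<noteq> {0\<^sub>v m} \<and> invariant_under B W \<and>
           (\<forall>u\<in>W. A *\<^sub>v u = 0\<^sub>v p \<and> b *\<^sub>v u = 0\<^sub>v 1))"
proof -
  have ev: "observable A b B \<longleftrightarrow> (\<forall>c. \<forall>u\<in>carrier_vec m. B *\<^sub>v u = c \<cdot>\<^sub>v u \<and> A *\<^sub>v u = 0\<^sub>v p \<and> b *\<^sub>v u = 0\<^sub>v 1 \<longrightarrow> u = 0\<^sub>v m)"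
    (is "_ \<longleftrightarrow> ?E")
  proof
    assume O: "observable A b B"
    show ?E
    proof (intro allI ballI impI)
      fix c u assume u: "u \<in> carrier_vec m" and z: "B *\<^sub>v u = c \<cdot>\<^sub>v u \<and> A *\<^sub>v u = 0\<^sub>v p \<and> b *\<^sub>v u = 0\<^sub>v 1"
      have "B * column u = c \<cdot>\<^sub>m column u" "A * column u = 0\<^sub>m p 1" "b * column u = 0\<^sub>m 1 1"
        using u z A b B by (simp_all add: mult_column column_smult)
      then have "column u = 0\<^sub>m m 1" using O[unfolded observable_def, rule_format, of "column u" c] u A b B by (simp del: One_nat_def)
      then show "u = 0\<^sub>v m" using column_eq_zero[OF u] by simp
    qed
  next
    assume E: ?E
    show "observable A b B" unfolding observable_def
    proof (intro allI ballI impI)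
      fix c U assume U: "U \<in> carrier_mat (dim_row B) 1"
        and z: "B * U = c \<cdot>\<^sub>m U \<and> A * U = 0\<^sub>m (dim_row A) 1 \<and> b * U = 0\<^sub>m (dim_row b) 1"
      define u where "u = col U 0"
      have u: "u \<in> carrier_vec m" "U = column u" using U B column_surj[of U m] by (auto simp: u_def)
      have "column (B *\<^sub>v u) = column (c \<cdot>\<^sub>v u)" "column (A *\<^sub>v u) = column (0\<^sub>v p)" "column (b *\<^sub>v u) = column (0\<^sub>v 1)"
        using z u A b B by (simp_all add: mult_column[symmetric] column_smult)
      from this[THEN column_inject] have "B *\<^sub>v u = c \<cdot>\<^sub>v u" "A *\<^sub>v u = 0\<^sub>v p" "b *\<^sub>v u = 0\<^sub>v 1" .
      then have "u = 0\<^sub>v m" using E u(1) by blast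
      then show "U = 0\<^sub>m (dim_row B) 1" using u(2) B by simp
    qed
  qed
  show ?thesis unfolding ev
  proof
    assume E: ?E
    show "\<not> (\<exists>W. is_subspace m W \<and> W \<noteq> {0\<^sub>v m} \<and> invariant_under B W \<and> (\<forall>u\<in>W. A *\<^sub>v u = 0\<^sub>v p \<and> b *\<^sub>v u = 0\<^sub>v 1))"
    proof
      assume "\<exists>W. is_subspace m W \<and> W \<noteq> {0\<^sub>v m} \<and> invariant_under B W \<and> (\<forall>u\<in>W. A *\<^sub>v u = 0\<^sub>v p \<and> b *\<^sub>v u = 0\<^sub>v 1)"
      then obtain W where W: "is_subspace m W" "W \<noteq> {0\<^sub>v m}" "invariant_under B W"
        "\<forall>u\<in>W. A *\<^sub>v u = 0\<^sub>v p \<and> b *\<^sub>v u = 0\<^sub>v 1" by blast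
      obtain u c where u: "u \<in> W" "u \<noteq> 0\<^sub>v m" "B *\<^sub>v u = c \<cdot>\<^sub>v u"
        by (rule invariant_subspace_has_eigenvector[OF W(1-3) B])
      have "u \<in> carrier_vec m" using u(1) W(1) unfolding is_subspace_iff by blast
      then show False using E u W(4) by blast
    qed
  next
    assume N: "\<not> (\<exists>W. is_subspace m W \<and> W \<noteq> {0\<^sub>v m} \<and> invariant_under B W \<and> (\<forall>u\<in>W. A *\<^sub>v u = 0\<^sub>v p \<and> b *\<^sub>v u = 0\<^sub>v 1))"
    show ?E
    proof (intro allI ballI impI)
      fix c u assume u: "u \<in> carrier_vec m" and z: "B *\<^sub>v u = c \<cdot>\<^sub>v u \<and> A *\<^sub>v u = 0\<^sub>v p \<and> b *\<^sub>v u = 0\<^sub>v 1"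
      define W where "W = range (\<lambda>k. k \<cdot>\<^sub>v u)"
      have mv: "M *\<^sub>v (k \<cdot>\<^sub>v u) = k \<cdot>\<^sub>v (M *\<^sub>v u)" if "dim_col M = m" for M k
        by (rule mult_mat_vec[of M "dim_row M" m]) (use that u in auto)
      have "is_subspace m W" unfolding is_subspace_iff
      proof (intro conjI ballI allI)
        show "W \<subseteq> carrier_vec m" using u by (auto simp: W_def)
        have "0\<^sub>v m = 0 \<cdot>\<^sub>v u" using u by (intro eq_vecI) auto
        then show "0\<^sub>v m \<in> W" by (auto simp: W_def)
        fix x assume "x \<in> W"
        then obtain k where k: "x = k \<cdot>\<^sub>v u" by (auto simp: W_def)
        show "c \<cdot>\<^sub>v x \<in> W" for c using k by (auto simp: W_def smult_smult_assoc)
        fix y assume "y \<in> W"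
        then obtain k' where "y = k' \<cdot>\<^sub>v u" by (auto simp: W_def)
        then have "x + y = (k + k') \<cdot>\<^sub>v u" using k u by (intro eq_vecI) (auto simp: algebra_simps)
        then show "x + y \<in> W" by (auto simp: W_def)
      qed
      moreover have "invariant_under B W" unfolding invariant_under_def
      proof
        fix x assume "x \<in> W"
        then obtain k where "x = k \<cdot>\<^sub>v u" by (auto simp: W_def)
        then have "B *\<^sub>v x = (k * c) \<cdot>\<^sub>v u" using mv[of B k] B z by (simp add: smult_smult_assoc)
        then show "B *\<^sub>v x \<in> W" by (auto simp: W_def)
      qed
      moreover have "A *\<^sub>v x = 0\<^sub>v p \<and> b *\<^sub>v x = 0\<^sub>v 1" if "x \<in> W" for x
      proof -
        obtain k where "x = k \<cdot>\<^sub>v u" using \<open>x \<in> W\<close> by (auto simp: W_def)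
        then show ?thesis using mv[of A k] mv[of b k] A b z by auto
      qed
      ultimately have "W = {0\<^sub>v m}" using N by blast
      moreover have "1 \<cdot>\<^sub>v u \<in> W" unfolding W_def by blast
      ultimately show "u = 0\<^sub>v m" by simp
    qed
  qed
qed

text \<open>
  A left eigenvector has an invariant kernel. Conversely the annihilator of an invariant proper
  subspace is a nonzero invariant subspace for the transpose, and contains an eigenvector of it.
\<close>

lemma controllable_iff_no_subspace:
  assumes A: "A \<in> carrier_mat p m" and a: "a \<in> carrier_mat p 1" and B: "B \<in> carrier_mat p p"
  shows "controllable A a B \<longleftrightarrow> \<not> (\<exists>W. is_subspace p W \<and> W \<noteq> carrier_vec p \<and> invariant_under B W \<and>
           (\<forall>u\<in>carrier_vec m. \<forall>c\<in>carrier_vec 1. A *\<^sub>v u + a *\<^sub>v c \<in> W))"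
proof
  assume C: "controllable A a B"
  show "\<not> (\<exists>W. is_subspace p W \<and> W \<noteq> carrier_vec p \<and> invariant_under B W \<and>
           (\<forall>u\<in>carrier_vec m. \<forall>c\<in>carrier_vec 1. A *\<^sub>v u + a *\<^sub>v c \<in> W))"
  proof
    assume "\<exists>W. is_subspace p W \<and> W \<noteq> carrier_vec p \<and> invariant_under B W \<and>
           (\<forall>u\<in>carrier_vec m. \<forall>c\<in>carrier_vec 1. A *\<^sub>v u + a *\<^sub>v c \<in> W)"
    then obtain W where W: "is_subspace p W" "W \<noteq> carrier_vec p" "invariant_under B W"
      and im: "\<And>u c. u \<in> carrier_vec m \<Longrightarrow> c \<in> carrier_vec 1 \<Longrightarrow> A *\<^sub>v u + a *\<^sub>v c \<in> W" by blast
    have Wc: "W \<subseteq> carrier_vec p" using W(1) unfolding is_subspace_iff by blast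
    define K where "K = {y \<in> carrier_vec p. \<forall>x\<in>W. y \<bullet> x = 0}"
    have tm: "(M\<^sup>T *\<^sub>v y) \<bullet> x = y \<bullet> (M *\<^sub>v x)" if "M \<in> carrier_mat p q" "x \<in> carrier_vec q" "y \<in> carrier_vec p" for M :: "complex mat" and x y q
      by (rule transpose_vec_mult_scalar[OF that])
    have "is_subspace p K" unfolding is_subspace_iff
    proof (intro conjI ballI allI)
      show "0\<^sub>v p \<in> K" using Wc by (auto simp: K_def)
      fix x assume x: "x \<in> K"
      show "c \<cdot>\<^sub>v x \<in> K" for c using x Wc by (auto simp: K_def)
      fix y assume "y \<in> K"
      then show "x + y \<in> K" using x Wc by (auto simp: K_def add_scalar_prod_distrib[of _ p])
    qed (auto simp: K_def)
    moreover have "K \<noteq> {0\<^sub>v p}"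
    proof -
      obtain y where "y \<in> carrier_vec p" "y \<noteq> 0\<^sub>v p" "\<forall>u\<in>W. y \<bullet> u = 0"
        by (rule proper_subspace_annihilator[OF W(1,2)])
      then show ?thesis by (auto simp: K_def)
    qed
    moreover have "invariant_under B\<^sup>T K" unfolding invariant_under_def
    proof
      fix y assume y: "y \<in> K"
      then have yc: "y \<in> carrier_vec p" by (simp add: K_def)
      have "(B\<^sup>T *\<^sub>v y) \<bullet> x = 0" if "x \<in> W" for x
      proof -
        have "B *\<^sub>v x \<in> W" using that W(3) by (simp add: invariant_under_def)
        then have "y \<bullet> (B *\<^sub>v x) = 0" using y by (simp add: K_def)
        then show ?thesis using tm[OF B _ yc, of x] that Wc by auto
      qed
      then show "B\<^sup>T *\<^sub>v y \<in> K" using B yc by (simp add: K_def)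
    qed
    moreover have "B\<^sup>T \<in> carrier_mat p p" using B by simp
    ultimately obtain y c where y: "y \<in> K" "y \<noteq> 0\<^sub>v p" "B\<^sup>T *\<^sub>v y = c \<cdot>\<^sub>v y"
      by (rule invariant_subspace_has_eigenvector)
    have yc: "y \<in> carrier_vec p" and dy: "dim_vec y = p" using y(1) by (auto simp: K_def)
    have kill: "M\<^sup>T *\<^sub>v y = 0\<^sub>v q" if M: "M \<in> carrier_mat p q" and im: "\<And>x. x \<in> carrier_vec q \<Longrightarrow> M *\<^sub>v x \<in> W" for M q
    proof (rule eq_vecI)
      fix i assume "i < dim_vec (0\<^sub>v q :: complex vec)"
      then have i: "i < q" by simp
      have "(M\<^sup>T *\<^sub>v y) \<bullet> unit_vec q i = y \<bullet> (M *\<^sub>v unit_vec q i)" by (rule tm[OF M _ yc]) simp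
      also have "\<dots> = 0" using im[of "unit_vec q i"] y(1) by (simp add: K_def)
      finally have h: "(M\<^sup>T *\<^sub>v y) \<bullet> unit_vec q i = 0" .
      have "M\<^sup>T *\<^sub>v y \<in> carrier_vec q" by (rule carrier_vecI) (use M in auto)
      then have "(M\<^sup>T *\<^sub>v y) \<bullet> unit_vec q i = (M\<^sup>T *\<^sub>v y) $ i" using i by simp
      then show "(M\<^sup>T *\<^sub>v y) $ i = 0\<^sub>v q $ i" using h i by simp
    qed (use M in simp)
    have A0: "A\<^sup>T *\<^sub>v y = 0\<^sub>v m"
    proof (rule kill[OF A])
      fix x :: "complex vec" assume x: "x \<in> carrier_vec m"
      have "a *\<^sub>v 0\<^sub>v 1 = 0\<^sub>v p" using a by (intro eq_vecI) auto
      then show "A *\<^sub>v x \<in> W" using im[OF x, of "0\<^sub>v 1"] A x by simp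
    qed
    have a0: "a\<^sup>T *\<^sub>v y = 0\<^sub>v 1"
    proof (rule kill[OF a])
      fix x :: "complex vec" assume x: "x \<in> carrier_vec 1"
      have "A *\<^sub>v 0\<^sub>v m = 0\<^sub>v p" using A by (intro eq_vecI) auto
      then show "a *\<^sub>v x \<in> W" using im[of "0\<^sub>v m", OF _ x] a x by simp
    qed
    have "observable A\<^sup>T a\<^sup>T B\<^sup>T" using C observable_transpose[OF B A a] by simp
    moreover have "B\<^sup>T * column y = c \<cdot>\<^sub>m column y" "A\<^sup>T * column y = 0\<^sub>m m 1" "a\<^sup>T * column y = 0\<^sub>m 1 1"
      using A0 a0 y(3) A a B dy by (simp_all add: mult_column column_smult)
    ultimately have "column y = 0\<^sub>m p 1"
      using A a B yc unfolding observable_def by (auto simp del: One_nat_def)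
    then show False using column_eq_zero[OF yc] y(2) by simp
  qed
next
  assume N: "\<not> (\<exists>W. is_subspace p W \<and> W \<noteq> carrier_vec p \<and> invariant_under B W \<and>
           (\<forall>u\<in>carrier_vec m. \<forall>c\<in>carrier_vec 1. A *\<^sub>v u + a *\<^sub>v c \<in> W))"
  show "controllable A a B" unfolding controllable_def
  proof (intro allI ballI impI)
    fix c Y assume Y: "Y \<in> carrier_mat 1 (dim_row B)"
      and z: "Y * B = c \<cdot>\<^sub>m Y \<and> Y * A = 0\<^sub>m 1 (dim_col A) \<and> Y * a = 0\<^sub>m 1 (dim_col a)"
    have Yc: "Y \<in> carrier_mat 1 p" using Y B by simp
    have z': "Y * B = c \<cdot>\<^sub>m Y" "Y * A = 0\<^sub>m 1 m" "Y * a = 0\<^sub>m 1 1" using z A a by auto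
    define W where "W = {v \<in> carrier_vec p. Y *\<^sub>v v = 0\<^sub>v 1}"
    have sz: "k \<cdot>\<^sub>v 0\<^sub>v 1 = (0\<^sub>v 1 :: complex vec)" for k by (rule eq_vecI) auto
    have "is_subspace p W" unfolding is_subspace_iff
    proof (intro conjI ballI allI)
      have "Y *\<^sub>v 0\<^sub>v p = 0\<^sub>v 1" using Yc by (intro eq_vecI) auto
      then show "0\<^sub>v p \<in> W" by (simp add: W_def)
      fix x assume x: "x \<in> W"
      show "c \<cdot>\<^sub>v x \<in> W" for c
        using x mult_mat_vec[OF Yc, of x c] sz[of c] by (simp add: W_def)
      fix y assume "y \<in> W"
      then show "x + y \<in> W" using x mult_add_distrib_mat_vec[OF Yc, of x y] by (simp add: W_def)
    qed (auto simp: W_def)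
    moreover have "invariant_under B W" unfolding invariant_under_def
    proof
      fix x assume x: "x \<in> W"
      then have xc: "x \<in> carrier_vec p" by (simp add: W_def)
      have "Y *\<^sub>v (B *\<^sub>v x) = (Y * B) *\<^sub>v x" using Yc B xc by simp
      also have "\<dots> = c \<cdot>\<^sub>v (Y *\<^sub>v x)" unfolding z' using Yc xc by (intro eq_vecI) auto
      also have "\<dots> = 0\<^sub>v 1" using x sz[of c] by (simp add: W_def)
      finally show "B *\<^sub>v x \<in> W" using B xc by (simp add: W_def)
    qed
    moreover have "A *\<^sub>v u + a *\<^sub>v e \<in> W" if u: "u \<in> carrier_vec m" and e: "e \<in> carrier_vec 1" for u e
    proof -
      have c: "A *\<^sub>v u \<in> carrier_vec p" "a *\<^sub>v e \<in> carrier_vec p" using A a u e by auto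
      have "Y *\<^sub>v (A *\<^sub>v u) = (Y * A) *\<^sub>v u" "Y *\<^sub>v (a *\<^sub>v e) = (Y * a) *\<^sub>v e" using Yc A a u e by simp_all
      then have "Y *\<^sub>v (A *\<^sub>v u) = 0\<^sub>v 1" "Y *\<^sub>v (a *\<^sub>v e) = 0\<^sub>v 1" unfolding z' using u e by (auto intro!: eq_vecI)
      then show ?thesis using mult_add_distrib_mat_vec[OF Yc c] c by (simp add: W_def)
    qed
    ultimately have W: "W = carrier_vec p" using N by blast
    show "Y = 0\<^sub>m 1 (dim_row B)"
    proof (rule eq_matI)
      fix i j assume "i < dim_row (0\<^sub>m 1 (dim_row B) :: complex mat)" "j < dim_col (0\<^sub>m 1 (dim_row B) :: complex mat)"
      then have ij: "i = 0" "j < p" using B by auto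
      have "unit_vec p j \<in> W" unfolding W by simp
      then have "(Y *\<^sub>v unit_vec p j) $ 0 = 0" by (simp add: W_def)
      then show "Y $$ (i, j) = 0\<^sub>m 1 (dim_row B) $$ (i, j)" using ij Yc B by simp
    qed (use Y in auto)
  qed
qed

section \<open>Fibres of the moment map under transitions\<close>

lemma triangle_conditions_iff:
  assumes A: "z MA i \<in> carrier_mat (vdim Q i) (vdim Q (prv Q i))"
    and Bm: "z MBminus i \<in> carrier_mat (vdim Q (prv Q i)) (vdim Q (prv Q i))"
    and Bp: "z MBplus i \<in> carrier_mat (vdim Q i) (vdim Q i)"
    and a: "z Ma i \<in> carrier_mat (vdim Q i) 1" and b: "z Mb i \<in> carrier_mat 1 (vdim Q (prv Q i))"
  shows "triangle_conditions Q z i \<longleftrightarrow>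
     z MBplus i * z MA i - z MA i * z MBminus i + z Ma i * z Mb i = 0\<^sub>m (vdim Q i) (vdim Q (prv Q i)) \<and>
     observable (z MA i) (z Mb i) (z MBminus i) \<and> controllable (z MA i) (z Ma i) (z MBplus i)"
  unfolding triangle_conditions_def Let_def
  using observable_iff_no_subspace[OF A b Bm] controllable_iff_no_subspace[OF A a Bp] by (simp only:)

text \<open>
  The contribution of an element to the segment at its head; \<open>tail_moment\<close> is the one
  to the segment at its tail.
\<close>

definition head_moment :: "bow \<Rightarrow> point \<Rightarrow> nat \<Rightarrow> complex mat" where
  "head_moment Q z k = (case elts Q ! k of Arrow \<Rightarrow> z MC k * z MD k | XPoint \<Rightarrow> - z MBplus k)"

definition tail_moment :: "bow \<Rightarrow> point \<Rightarrow> nat \<Rightarrow> complex mat" where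
  "tail_moment Q z k = (case elts Q ! k of Arrow \<Rightarrow> - (z MD k * z MC k) | XPoint \<Rightarrow> z MBminus k)"

lemma moment_map_split: "moment_map Q z k = head_moment Q z k + tail_moment Q z (nxt Q k)"
  by (simp add: moment_map_def head_moment_def tail_moment_def Let_def)

text \<open>
  Parameters are allowed on all segments, not only on the first ones of wavy lines, since a
  transition may move a parameter across an x-point.
\<close>

definition fibre :: "bow \<Rightarrow> (nat \<Rightarrow> complex) \<Rightarrow> point set" where
  "fibre Q lam = {z \<in> Mtilde Q. \<forall>i<len Q. moment_map Q z i = lam i \<cdot>\<^sub>m 1\<^sub>m (vdim Q i)}"

lemma moment_fibre_eq_fibre: "moment_fibre Q lam = fibre Q (\<lambda>i. if i \<in> wavy_lines Q then lam i else 0)"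
  by (simp add: moment_fibre_def fibre_def)

lemma nxt_prv: assumes "i < len Q" shows "nxt Q (prv Q i) = i"
proof -
  have "nxt Q (prv Q i) = (i + len Q - 1 + 1) mod len Q" unfolding nxt_def prv_def by (simp only: mod_add_left_eq)
  also have "i + len Q - 1 + 1 = i + len Q" using assms by simp
  finally show ?thesis using assms by simp
qed

lemma prv_nxt: assumes "i < len Q" shows "prv Q (nxt Q i) = i"
proof -
  have "(i + 1) mod len Q + len Q - 1 = (i + 1) mod len Q + (len Q - 1)" using assms by simp
  then have "prv Q (nxt Q i) = (i + 1 + (len Q - 1)) mod len Q" unfolding nxt_def prv_def by (simp only: mod_add_left_eq)
  also have "i + 1 + (len Q - 1) = i + len Q" using assms by simp
  finally show ?thesis using assms by simp
qed

lemma nxt_less_len: "i < len Q \<Longrightarrow> nxt Q i < len Q" and prv_less_len: "i < len Q \<Longrightarrow> prv Q i < len Q"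
  by (simp_all add: nxt_def prv_def)

lemma Mtilde_carrier: "z \<in> Mtilde Q \<Longrightarrow> z K i \<in> carrier_mat (fst (shape Q K i)) (snd (shape Q K i))"
  by (simp add: Mtilde_def)

lemma arrow_carrier:
  assumes "z \<in> Mtilde Q" "i < len Q" "elts Q ! i = Arrow"
  shows "z MC i \<in> carrier_mat (vdim Q i) (vdim Q (prv Q i))" "z MD i \<in> carrier_mat (vdim Q (prv Q i)) (vdim Q i)"
  using Mtilde_carrier[OF assms(1), of MC i] Mtilde_carrier[OF assms(1), of MD i] assms(2,3)
  by (simp_all add: shape_def)

lemma triangle_carrier:
  assumes "z \<in> Mtilde Q" "i < len Q" "elts Q ! i = XPoint"
  shows "z MA i \<in> carrier_mat (vdim Q i) (vdim Q (prv Q i))"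
    "z MBminus i \<in> carrier_mat (vdim Q (prv Q i)) (vdim Q (prv Q i))"
    "z MBplus i \<in> carrier_mat (vdim Q i) (vdim Q i)"
    "z Ma i \<in> carrier_mat (vdim Q i) 1" "z Mb i \<in> carrier_mat 1 (vdim Q (prv Q i))"
  using Mtilde_carrier[OF assms(1), of MA i] Mtilde_carrier[OF assms(1), of MBminus i]
    Mtilde_carrier[OF assms(1), of MBplus i] Mtilde_carrier[OF assms(1), of Ma i]
    Mtilde_carrier[OF assms(1), of Mb i] assms(2,3)
  by (simp_all add: shape_def)

lemma triangle_parts:
  assumes "z \<in> Mtilde Q" "i < len Q" "elts Q ! i = XPoint"
  shows "z MBplus i * z MA i - z MA i * z MBminus i + z Ma i * z Mb i = 0\<^sub>m (vdim Q i) (vdim Q (prv Q i))"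
    "observable (z MA i) (z Mb i) (z MBminus i)" "controllable (z MA i) (z Ma i) (z MBplus i)"
proof -
  have "triangle_conditions Q z i" using assms by (simp add: Mtilde_def)
  then show "z MBplus i * z MA i - z MA i * z MBminus i + z Ma i * z Mb i = 0\<^sub>m (vdim Q i) (vdim Q (prv Q i))"
    "observable (z MA i) (z Mb i) (z MBminus i)" "controllable (z MA i) (z Ma i) (z MBplus i)"
    using triangle_conditions_iff[of z i Q, OF triangle_carrier[OF assms]] by blast+
qed

lemma head_moment_carrier: "\<lbrakk>z \<in> Mtilde Q; i < len Q\<rbrakk> \<Longrightarrow> head_moment Q z i \<in> carrier_mat (vdim Q i) (vdim Q i)"
  using arrow_carrier[of z Q i] triangle_carrier[of z Q i] by (cases "elts Q ! i") (auto simp: head_moment_def)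

lemma tail_moment_carrier:
  "\<lbrakk>z \<in> Mtilde Q; i < len Q\<rbrakk> \<Longrightarrow> tail_moment Q z i \<in> carrier_mat (vdim Q (prv Q i)) (vdim Q (prv Q i))"
  using arrow_carrier[of z Q i] triangle_carrier[of z Q i] by (cases "elts Q ! i") (auto simp: tail_moment_def)

lemma mat_add_shift_left:
  fixes H T :: "complex mat"
  assumes "H \<in> carrier_mat v v" "T \<in> carrier_mat v v" "H + T = x \<cdot>\<^sub>m 1\<^sub>m v"
  shows "(H + y \<cdot>\<^sub>m 1\<^sub>m v) + T = (x + y) \<cdot>\<^sub>m 1\<^sub>m v" "H + (T + y \<cdot>\<^sub>m 1\<^sub>m v) = (x + y) \<cdot>\<^sub>m 1\<^sub>m v"
proof -
  have e: "H $$ (i, j) + T $$ (i, j) = (if i = j then x else 0)" if "i < v" "j < v" for i j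
    using arg_cong[OF assms(3), of "\<lambda>M. M $$ (i, j)"] that assms(1,2) by auto
  show "(H + y \<cdot>\<^sub>m 1\<^sub>m v) + T = (x + y) \<cdot>\<^sub>m 1\<^sub>m v"
  proof (rule eq_matI)
    fix i j assume "i < dim_row ((x + y) \<cdot>\<^sub>m 1\<^sub>m v)" "j < dim_col ((x + y) \<cdot>\<^sub>m 1\<^sub>m v)"
    then show "((H + y \<cdot>\<^sub>m 1\<^sub>m v) + T) $$ (i, j) = ((x + y) \<cdot>\<^sub>m 1\<^sub>m v) $$ (i, j)"
      using e[of i j] assms(1,2) by (auto simp: algebra_simps split: if_splits)
  qed (use assms in auto)
  show "H + (T + y \<cdot>\<^sub>m 1\<^sub>m v) = (x + y) \<cdot>\<^sub>m 1\<^sub>m v"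
  proof (rule eq_matI)
    fix i j assume "i < dim_row ((x + y) \<cdot>\<^sub>m 1\<^sub>m v)" "j < dim_col ((x + y) \<cdot>\<^sub>m 1\<^sub>m v)"
    then show "(H + (T + y \<cdot>\<^sub>m 1\<^sub>m v)) $$ (i, j) = ((x + y) \<cdot>\<^sub>m 1\<^sub>m v) $$ (i, j)"
      using e[of i j] assms(1,2) by (auto simp: algebra_simps split: if_splits)
  qed (use assms in auto)
qed

text \<open>
  Only the maps at the two exchanged elements change, and they change by
  \<open>transition_by_cokernel\<close> or \<open>transition_by_kernel\<close>. The contributions
  to the outer segments stay the same up to a scalar, so the parameter of the middle segment moves
  to one of its neighbours. When the circle only has two elements, the two outer segments
  coincide; treating the contributions of the elements separately covers this case.
\<close>

lemma hw_transition_fibre: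
  assumes Q: "is_bow Q" and nn: "originates_from_brane Q" and z: "z \<in> fibre Q lam" and hw: "hw_transition Q Q'"
  shows "originates_from_brane Q' \<and> (\<exists>lam'. fibre Q' lam' \<noteq> {} \<and> (lam = (\<lambda>_. 0) \<longrightarrow> lam' = (\<lambda>_. 0)))"
proof -
  define L where "L = len Q"
  obtain i where i: "i < L" and ne: "elts Q ! i \<noteq> elts Q ! nxt Q i"
    and Q': "Q' = \<lparr>elts = (elts Q)[i := elts Q ! (nxt Q i), nxt Q i := elts Q ! i],
              dims = (dims Q)[i := dims Q ! (prv Q i) + dims Q ! (nxt Q i) - dims Q ! i + 1]\<rparr>"
    using hw unfolding hw_transition_def L_def by blast
  define j where "j = nxt Q i"
  define h where "h = prv Q i"
  have j: "j < L" "h < L" using nxt_less_len prv_less_len i by (simp_all add: j_def h_def L_def)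
  have ij: "i \<noteq> j" using ne by (auto simp: j_def)
  have lens: "length (elts Q) = L" "length (dims Q) = L" using Q by (simp_all add: L_def len_def is_bow_def)
  have len': "len Q' = L" by (simp add: Q' len_def lens)
  have nx: "nxt Q' = nxt Q" "prv Q' = prv Q" by (rule ext, simp add: nxt_def prv_def len' flip: L_def)+
  have pj: "prv Q j = i" using prv_nxt i by (simp add: j_def L_def)
  have nh: "nxt Q h = i" using nxt_prv i by (simp add: h_def L_def)
  have hi: "h \<noteq> i" using nh ij by (auto simp: j_def)
  have prv_i: "k = j" if "k < L" "prv Q k = i" for k using nxt_prv[of k Q] that by (simp add: L_def j_def)
  have nxt_j: "k = i" if "k < L" "nxt Q k = j" for k using prv_nxt[of k Q] that pj by (simp add: L_def)
  have nxt_i: "k = h" if "k < L" "nxt Q k = i" for k using prv_nxt[of k Q] that by (simp add: L_def h_def)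
  have el: "elts Q' ! i = elts Q ! j" "elts Q' ! j = elts Q ! i" "\<And>k. k \<noteq> i \<Longrightarrow> k \<noteq> j \<Longrightarrow> elts Q' ! k = elts Q ! k"
    using i j ij lens by (simp_all add: Q' flip: j_def)
  have di: "dims Q' ! i = dims Q ! h + dims Q ! j - dims Q ! i + 1" "\<And>k. k \<noteq> i \<Longrightarrow> dims Q' ! k = dims Q ! k"
    using i lens by (simp_all add: Q' flip: j_def h_def)
  have vd: "vdim Q' k = vdim Q k" if "k \<noteq> i" for k using di(2)[OF that] by (simp add: vdim_def)
  have dnn: "dims Q ! k = int (vdim Q k)" if "k < L" for k
    using nn that by (simp add: originates_from_brane_def vdim_def L_def)
  have M: "z \<in> Mtilde Q" and mom: "\<And>k. k < L \<Longrightarrow> head_moment Q z k + tail_moment Q z (nxt Q k) = lam k \<cdot>\<^sub>m 1\<^sub>m (vdim Q k)"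
    using z by (auto simp: fibre_def moment_map_split L_def)
  define v1 v2 v3 where "v1 = vdim Q h" and "v2 = vdim Q i" and "v3 = vdim Q j"
  define r where "r = v1 + v3 + 1 - v2"
  have fin: "originates_from_brane Q' \<and> vdim Q' i = r" if "v2 \<le> v1 + v3 + 1"
  proof -
    have "dims Q' ! i = int r" using that di(1) dnn i j by (simp add: r_def v1_def v2_def v3_def)
    then show ?thesis using di(2) dnn len' unfolding originates_from_brane_def vdim_def
      by (metis nat_int of_nat_0_le_iff)
  qed
  have other_shape: "shape Q' K k = shape Q K k" if "k \<noteq> i" "k \<noteq> j" for K k
  proof (cases "k < L")
    case True
    then have "prv Q k \<noteq> i" using prv_i that by blast
    then show ?thesis using that True el(3)[OF that] vd[of k] vd[of "prv Q k"]
      by (cases "elts Q ! k"; cases K) (simp_all add: shape_def len' nx flip: L_def)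
  qed (simp add: shape_def len' flip: L_def)
  have other_triangle: "triangle_conditions Q' z' k"
    if "k \<noteq> i" "k \<noteq> j" "k < L" "elts Q' ! k = XPoint" "\<And>K. z' K k = z K k" for k z'
  proof -
    have "prv Q k \<noteq> i" using prv_i that by blast
    then have "triangle_conditions Q' z' k = triangle_conditions Q z k"
      using that vd by (simp add: triangle_conditions_def nx)
    then show ?thesis using M that el(3) by (simp add: Mtilde_def L_def)
  qed
  have other_head: "head_moment Q' z' k = head_moment Q z k" if "k \<noteq> i" "k \<noteq> j" "\<And>K. z' K k = z K k" for k z'
    using that(3) el(3)[OF that(1,2)] by (cases "elts Q ! k") (simp_all add: head_moment_def)
  have other_tail: "tail_moment Q' z' k = tail_moment Q z k" if "k \<noteq> i" "k \<noteq> j" "\<And>K. z' K k = z K k" for k z'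
    using that(3) el(3)[OF that(1,2)] by (cases "elts Q ! k") (simp_all add: tail_moment_def)
  note hc = head_moment_carrier[OF M, folded L_def] and tc = tail_moment_carrier[OF M, folded L_def]
  show ?thesis
  proof (cases "elts Q ! i")
    case Arrow
    then have X: "elts Q ! j = XPoint" using ne by (cases "elts Q ! j") (auto simp: j_def)
    note ca = arrow_carrier[OF M i[unfolded L_def] Arrow, folded h_def v1_def v2_def]
    note cx = triangle_carrier[OF M j(1)[unfolded L_def] X, unfolded pj, folded v2_def v3_def]
    note px = triangle_parts[OF M j(1)[unfolded L_def] X, unfolded pj, folded v2_def v3_def]
    have m: "z MC i * z MD i + z MBminus j = lam i \<cdot>\<^sub>m 1\<^sub>m v2"
      using mom[OF i] Arrow X by (simp add: head_moment_def tail_moment_def v2_def flip: j_def)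
    note H = transition_by_cokernel[OF ca cx(1,2,3,4,5) px m]
    have f: "originates_from_brane Q'" "vdim Q' i = r" using fin[OF H(1)] by auto
    obtain A' B' a' b' C' D' where K: "A' \<in> carrier_mat r v1" "B' \<in> carrier_mat r r" "a' \<in> carrier_mat r 1"
      "b' \<in> carrier_mat 1 v1" "C' \<in> carrier_mat v3 r" "D' \<in> carrier_mat r v3"
      "B' * A' - A' * (- (z MD i * z MC i)) + a' * b' = 0\<^sub>m r v1"
      "observable A' b' (- (z MD i * z MC i))" "controllable A' a' B'"
      "B' + D' * C' = 0\<^sub>m r r" "C' * D' = - z MBplus j + lam i \<cdot>\<^sub>m 1\<^sub>m v3"
      using H(2) unfolding r_def by blast
    define z' :: point where "z' = (\<lambda>K k. if k = i then (case K of MA \<Rightarrow> A' | MBminus \<Rightarrow> - (z MD i * z MC i) | MBplus \<Rightarrow> B'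
        | Ma \<Rightarrow> a' | Mb \<Rightarrow> b' | _ \<Rightarrow> 0\<^sub>m 0 0) else if k = j then (case K of MC \<Rightarrow> C' | MD \<Rightarrow> D' | _ \<Rightarrow> 0\<^sub>m 0 0) else z K k)"
    have zi: "z' MA i = A'" "z' MBminus i = - (z MD i * z MC i)" "z' MBplus i = B'" "z' Ma i = a'" "z' Mb i = b'"
      and zj: "z' MC j = C'" "z' MD j = D'" and zo: "\<And>K k. k \<noteq> i \<Longrightarrow> k \<noteq> j \<Longrightarrow> z' K k = z K k"
      using ij by (simp_all add: z'_def)
    have elX: "elts Q' ! i = XPoint" "elts Q' ! j = Arrow" using el X Arrow by simp_all
    have vds: "vdim Q' (prv Q' i) = v1" "vdim Q' j = v3" "vdim Q' (prv Q' j) = r"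
      using vd hi ij f(2) by (simp_all add: nx pj v1_def v3_def flip: h_def)
    have DC: "- (z MD i * z MC i) \<in> carrier_mat v1 v1" using ca by simp
    have "triangle_conditions Q' z' i"
      using triangle_conditions_iff[of z' i Q'] K DC by (simp add: zi f(2) vds)
    then have T: "triangle_conditions Q' z' k" if "k < L" "elts Q' ! k = XPoint" for k
      using other_triangle[of k z'] zo that elX by (cases "k = i"; cases "k = j") auto
    have S: "z' K k \<in> carrier_mat (fst (shape Q' K k)) (snd (shape Q' K k))" for K k
    proof -
      consider "k = i" | "k = j" | "k \<noteq> i" "k \<noteq> j" by blast
      then show ?thesis
      proof cases
        case 1
        then show ?thesis using K DC i by (cases K) (simp_all add: z'_def shape_def len' elX f(2) vds)
      next
        case 2
        then show ?thesis using K j ij by (cases K) (simp_all add: z'_def shape_def len' elX f(2) vds)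
      next
        case 3
        then show ?thesis using Mtilde_carrier[OF M, of K k] by (simp add: zo other_shape)
      qed
    qed
    \<comment> \<open>The parameter moves to the segment behind the arrow.\<close>
    define lam' where "lam' k = (if k = i then 0 else if k = j then lam j + lam i else lam k)" for k
    have tail: "tail_moment Q' z' k = tail_moment Q z k" if "k \<noteq> j" for k
      using other_tail[of k z'] zo that elX Arrow by (cases "k = i") (auto simp: tail_moment_def zi)
    have mom': "head_moment Q' z' k + tail_moment Q' z' (nxt Q k) = lam' k \<cdot>\<^sub>m 1\<^sub>m (vdim Q' k)" if k: "k < L" for k
    proof -
      consider "k = i" | "k = j" | "k \<noteq> i" "k \<noteq> j" by blast
      then show ?thesis
      proof cases
        case 1
        have B'e: "B' = - (D' * C')" by (rule mat_add_eq_zero[OF K(2) mult_carrier_mat[OF K(6,5)] K(10)])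
        have "- B' + - (D' * C') = 0\<^sub>m r r" unfolding B'e using K(5,6) by (intro eq_matI) (auto simp del: index_mult_mat(1))
        then show ?thesis
          using 1 by (simp add: head_moment_def tail_moment_def elX zi zj lam'_def f(2) flip: j_def) (rule eq_matI, auto)
      next
        case 2
        have "nxt Q j \<noteq> j" using nxt_j[OF j(1)] ij by auto
        then have t: "tail_moment Q' z' (nxt Q k) = tail_moment Q z (nxt Q j)" using tail 2 by simp
        have hd: "head_moment Q' z' k = head_moment Q z j + lam i \<cdot>\<^sub>m 1\<^sub>m v3"
          using 2 K(11) X by (simp add: head_moment_def elX zj)
        have "tail_moment Q z (nxt Q j) \<in> carrier_mat v3 v3"
          using tc[OF nxt_less_len[of j Q, folded L_def, OF j(1)]] prv_nxt[of j Q] j by (simp add: v3_def L_def)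
        then show ?thesis unfolding t hd
          using mat_add_shift_left(1)[OF hc[OF j(1)] _ mom[OF j(1)]] 2 ij vd[of j] by (simp add: lam'_def v3_def)
      next
        case 3
        then have "nxt Q k \<noteq> j" using nxt_j k by blast
        then show ?thesis using 3 other_head[of k z'] zo tail mom[OF k] vd by (simp add: lam'_def)
      qed
    qed
    have "z' \<in> fibre Q' lam'"
      unfolding fibre_def Mtilde_def using S T mom' by (simp add: moment_map_split len' nx)
    moreover have "lam = (\<lambda>_. 0) \<longrightarrow> lam' = (\<lambda>_. 0)" by (auto simp: lam'_def)
    ultimately show ?thesis using f(1) by blast
  next
    case XPoint
    then have X: "elts Q ! j = Arrow" using ne by (cases "elts Q ! j") (auto simp: j_def)
    note ca = arrow_carrier[OF M j(1)[unfolded L_def] X, unfolded pj, folded v2_def v3_def]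
    note cx = triangle_carrier[OF M i[unfolded L_def] XPoint, folded h_def v1_def v2_def]
    note px = triangle_parts[OF M i[unfolded L_def] XPoint, folded h_def v1_def v2_def]
    have m: "- z MBplus i + - (z MD j * z MC j) = lam i \<cdot>\<^sub>m 1\<^sub>m v2"
      using mom[OF i] XPoint X by (simp add: head_moment_def tail_moment_def v2_def flip: j_def)
    note H = transition_by_kernel[OF ca cx(1,2,3,4,5) px m]
    have f: "originates_from_brane Q'" "vdim Q' i = r" using fin[OF H(1)] by auto
    obtain A' B' a' b' C' D' where K: "A' \<in> carrier_mat v3 r" "B' \<in> carrier_mat r r" "a' \<in> carrier_mat v3 1"
      "b' \<in> carrier_mat 1 r" "C' \<in> carrier_mat r v1" "D' \<in> carrier_mat v1 r"
      "(- (z MC j * z MD j)) * A' - A' * B' + a' * b' = 0\<^sub>m v3 r"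
      "observable A' b' B'" "controllable A' a' (- (z MC j * z MD j))"
      "C' * D' + B' = 0\<^sub>m r r" "- (D' * C') = z MBminus i + lam i \<cdot>\<^sub>m 1\<^sub>m v1"
      using H(2) unfolding r_def by blast
    define z' :: point where "z' = (\<lambda>K k. if k = j then (case K of MA \<Rightarrow> A' | MBminus \<Rightarrow> B' | MBplus \<Rightarrow> - (z MC j * z MD j)
        | Ma \<Rightarrow> a' | Mb \<Rightarrow> b' | _ \<Rightarrow> 0\<^sub>m 0 0) else if k = i then (case K of MC \<Rightarrow> C' | MD \<Rightarrow> D' | _ \<Rightarrow> 0\<^sub>m 0 0) else z K k)"
    have zj: "z' MA j = A'" "z' MBplus j = - (z MC j * z MD j)" "z' MBminus j = B'" "z' Ma j = a'" "z' Mb j = b'"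
      and zi: "z' MC i = C'" "z' MD i = D'" and zo: "\<And>K k. k \<noteq> i \<Longrightarrow> k \<noteq> j \<Longrightarrow> z' K k = z K k"
      using ij by (simp_all add: z'_def)
    have elX: "elts Q' ! i = Arrow" "elts Q' ! j = XPoint" using el X XPoint by simp_all
    have vds: "vdim Q' (prv Q' i) = v1" "vdim Q' j = v3" "vdim Q' (prv Q' j) = r"
      using vd hi ij f(2) by (simp_all add: nx pj v1_def v3_def flip: h_def)
    have CD: "- (z MC j * z MD j) \<in> carrier_mat v3 v3" using ca by simp
    have "triangle_conditions Q' z' j"
      using triangle_conditions_iff[of z' j Q'] K CD by (simp add: zj f(2) vds)
    then have T: "triangle_conditions Q' z' k" if "k < L" "elts Q' ! k = XPoint" for k
      using other_triangle[of k z'] zo that elX by (cases "k = i"; cases "k = j") auto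
    have S: "z' K k \<in> carrier_mat (fst (shape Q' K k)) (snd (shape Q' K k))" for K k
    proof -
      consider "k = i" | "k = j" | "k \<noteq> i" "k \<noteq> j" by blast
      then show ?thesis
      proof cases
        case 1
        then show ?thesis using K i ij by (cases K) (simp_all add: z'_def shape_def len' elX f(2) vds)
      next
        case 2
        then show ?thesis using K CD j ij by (cases K) (simp_all add: z'_def shape_def len' elX f(2) vds)
      next
        case 3
        then show ?thesis using Mtilde_carrier[OF M, of K k] by (simp add: zo other_shape)
      qed
    qed
    \<comment> \<open>The parameter moves to the segment before the arrow.\<close>
    define lam' where "lam' k = (if k = i then 0 else if k = h then lam h + lam i else lam k)" for k
    have head: "head_moment Q' z' k = head_moment Q z k" if "k \<noteq> i" for k
      using other_head[of k z'] zo that elX X by (cases "k = j") (auto simp: head_moment_def zj)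
    have mom': "head_moment Q' z' k + tail_moment Q' z' (nxt Q k) = lam' k \<cdot>\<^sub>m 1\<^sub>m (vdim Q' k)" if k: "k < L" for k
    proof -
      consider "k = i" | "k = h" | "k \<noteq> i" "k \<noteq> h" by blast
      then show ?thesis
      proof cases
        case 1
        then show ?thesis
          using K(10) by (simp add: head_moment_def tail_moment_def elX zi zj lam'_def f(2) flip: j_def) (rule eq_matI, auto)
      next
        case 2
        have t: "tail_moment Q' z' (nxt Q k) = tail_moment Q z i + lam i \<cdot>\<^sub>m 1\<^sub>m v1"
          using 2 K(11) XPoint by (simp add: tail_moment_def elX zi nh)
        have tci: "tail_moment Q z i \<in> carrier_mat v1 v1" using tc[OF i] by (simp add: v1_def h_def)
        have "head_moment Q z h + tail_moment Q z i = lam h \<cdot>\<^sub>m 1\<^sub>m v1" using mom[OF j(2)] by (simp add: nh v1_def)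
        then show ?thesis unfolding t
          using mat_add_shift_left(2)[OF hc[OF j(2), folded v1_def] tci] head[OF hi] 2 hi vd[OF hi] by (simp add: lam'_def v1_def)
      next
        case 3
        then have "nxt Q k \<noteq> j" "nxt Q k \<noteq> i" using nxt_j nxt_i k by blast+
        then show ?thesis using 3 head[of k] zo other_tail[of "nxt Q k" z'] mom[OF k] vd by (simp add: lam'_def)
      qed
    qed
    have "z' \<in> fibre Q' lam'"
      unfolding fibre_def Mtilde_def using S T mom' by (simp add: moment_map_split len' nx)
    moreover have "lam = (\<lambda>_. 0) \<longrightarrow> lam' = (\<lambda>_. 0)" by (auto simp: lam'_def)
    ultimately show ?thesis using f(1) by blast
  qed
qed

lemma hw_equivalent_fibre:
  assumes "hw_equivalent Q U" "is_bow Q" "originates_from_brane Q" "fibre Q lam \<noteq> {}"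
  shows "originates_from_brane U \<and> (\<exists>lam'. fibre U lam' \<noteq> {} \<and> (lam = (\<lambda>_. 0) \<longrightarrow> lam' = (\<lambda>_. 0)))"
proof -
  have "is_bow U \<and> originates_from_brane U \<and> (\<exists>lam'. fibre U lam' \<noteq> {} \<and> (lam = (\<lambda>_. 0) \<longrightarrow> lam' = (\<lambda>_. 0)))"
    using assms(1) unfolding hw_equivalent_def
  proof (induction rule: rtranclp_induct)
    case base then show ?case using assms by blast
  next
    case (step Y Z)
    then obtain lam1 z where 1: "z \<in> fibre Y lam1" "lam = (\<lambda>_. 0) \<longrightarrow> lam1 = (\<lambda>_. 0)" by blast
    show ?case using hw_transition_fibre[OF _ _ 1(1) step.hyps(2)] hw_transition_sym(2)[OF _ step.hyps(2)] step.IH 1(2) by blast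
  qed
  then show ?thesis by blast
qed

section \<open>An explicit point for a decomposable diagram\<close>

lemma sum_single:
  fixes f :: "nat \<Rightarrow> 'a :: comm_monoid_add"
  assumes "\<And>t. t < n \<Longrightarrow> t \<noteq> k \<Longrightarrow> f t = 0"
  shows "(\<Sum>t\<in>{0..<n}. f t) = (if k < n then f k else 0)"
proof (cases "k < n")
  case True
  then have "(\<Sum>t\<in>{0..<n}. f t) = f k" using assms by (subst sum.remove[of _ k]) auto
  then show ?thesis using True by simp
qed (use assms in auto)

text \<open>
  The space at a segment has a basis of a vectors on which everything acts trivially, followed by
  b vectors that a nilpotent Jordan block shifts.
\<close>

definition shift :: "nat \<Rightarrow> nat \<Rightarrow> complex mat" where
  "shift a b = mat (a + b) (a + b) (\<lambda>(r, s). if a \<le> s \<and> r = s + 1 then 1 else 0)"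

text \<open>
  At an arrow the second parts have the same size b. The matrix \<open>std_C\<close> identifies
  them, and \<open>std_D\<close> is the negative shift, so that C D and D C are negative shifts.
\<close>

definition std_C :: "nat \<Rightarrow> nat \<Rightarrow> nat \<Rightarrow> complex mat" where
  "std_C a a' b = mat (a' + b) (a + b) (\<lambda>(r, s). if a' \<le> r \<and> a \<le> s \<and> r + a = s + a' then 1 else 0)"

definition std_D :: "nat \<Rightarrow> nat \<Rightarrow> nat \<Rightarrow> complex mat" where
  "std_D a a' b = mat (a + b) (a' + b) (\<lambda>(r, s). if a \<le> r \<and> a' \<le> s \<and> r + a' = s + a + 1 then - 1 else 0)"

lemma std_CD: "std_C a a' b * std_D a a' b = - shift a' b"
proof (rule eq_matI)
  fix r s assume "r < dim_row (- shift a' b)" "s < dim_col (- shift a' b)"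
  then have rs: "r < a' + b" "s < a' + b" by (auto simp: shift_def)
  have "(std_C a a' b * std_D a a' b) $$ (r, s) =
     (\<Sum>t\<in>{0..<a + b}. (if a' \<le> r \<and> a \<le> t \<and> r + a = t + a' then 1 else 0) * (if a \<le> t \<and> a' \<le> s \<and> t + a' = s + a + 1 then - 1 else 0))"
    using rs by (simp add: std_C_def std_D_def scalar_prod_def)
  also have "\<dots> = (if r + a - a' < a + b then (if a' \<le> r \<and> a \<le> r + a - a' \<and> r + a = (r + a - a') + a' then 1 else 0)
      * (if a \<le> r + a - a' \<and> a' \<le> s \<and> (r + a - a') + a' = s + a + 1 then - 1 else 0) else 0)"
    by (rule sum_single) auto
  also have "\<dots> = (- shift a' b) $$ (r, s)" using rs by (auto simp: shift_def)
  finally show "(std_C a a' b * std_D a a' b) $$ (r, s) = (- shift a' b) $$ (r, s)" .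
qed (auto simp: std_C_def std_D_def shift_def)

lemma std_DC: "std_D a a' b * std_C a a' b = - shift a b"
proof (rule eq_matI)
  fix r s assume "r < dim_row (- shift a b)" "s < dim_col (- shift a b)"
  then have rs: "r < a + b" "s < a + b" by (auto simp: shift_def)
  have "(std_D a a' b * std_C a a' b) $$ (r, s) =
     (\<Sum>t\<in>{0..<a' + b}. (if a \<le> r \<and> a' \<le> t \<and> r + a' = t + a + 1 then - 1 else 0) * (if a' \<le> t \<and> a \<le> s \<and> t + a = s + a' then 1 else 0))"
    using rs by (simp add: std_C_def std_D_def scalar_prod_def)
  also have "\<dots> = (if s + a' - a < a' + b then (if a \<le> r \<and> a' \<le> s + a' - a \<and> r + a' = (s + a' - a) + a + 1 then - 1 else 0)
     * (if a' \<le> s + a' - a \<and> a \<le> s \<and> (s + a' - a) + a = s + a' then 1 else 0) else 0)"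
    by (rule sum_single) auto
  also have "\<dots> = (- shift a b) $$ (r, s)" using rs by (auto simp: shift_def)
  finally show "(std_D a a' b * std_C a a' b) $$ (r, s) = (- shift a b) $$ (r, s)" .
qed (auto simp: std_C_def std_D_def shift_def)

text \<open>
  At an x-point the first parts have the same size a and are identified. On the second parts, of
  sizes m and p, the matrix is the inclusion of the last m basis vectors if m \<le> p, and the
  projection that kills all but the first p basis vectors if m > p; truncated subtraction makes
  one formula serve both cases. The entries of \<open>std_a\<close> and \<open>std_b\<close> mark
  the generator that is missing from the image, respectively the functional that detects the
  kernel. They are never both nonzero.
\<close>

definition std_A :: "nat \<Rightarrow> nat \<Rightarrow> nat \<Rightarrow> complex mat" where
  "std_A a m p = mat (a + p) (a + m)
     (\<lambda>(r, s). if r < a \<or> s < a then (if r = s then 1 else 0) else if r = s + (p - m) then 1 else 0)"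

definition std_a :: "nat \<Rightarrow> nat \<Rightarrow> nat \<Rightarrow> complex mat" where
  "std_a a m p = mat (a + p) 1 (\<lambda>(r, s). if r = a \<and> m \<le> p then 1 else 0)"

definition std_b :: "nat \<Rightarrow> nat \<Rightarrow> nat \<Rightarrow> complex mat" where
  "std_b a m p = mat 1 (a + m) (\<lambda>(r, s). if s + 1 = a + m \<and> p < m then 1 else 0)"

lemma std_dims [simp]:
  "dim_row (shift a b) = a + b" "dim_col (shift a b) = a + b"
  "dim_row (std_A a m p) = a + p" "dim_col (std_A a m p) = a + m"
  "dim_row (std_a a m p) = a + p" "dim_col (std_a a m p) = 1"
  "dim_row (std_b a m p) = 1" "dim_col (std_b a m p) = a + m"
  "dim_row (std_C a a' b) = a' + b" "dim_col (std_C a a' b) = a + b"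
  "dim_row (std_D a a' b) = a + b" "dim_col (std_D a a' b) = a' + b"
  by (simp_all add: shift_def std_A_def std_a_def std_b_def std_C_def std_D_def)

lemma std_triangle_relation:
  "shift a p * std_A a m p - std_A a m p * shift a m + std_a a m p * std_b a m p = 0\<^sub>m (a + p) (a + m)"
proof (rule eq_matI)
  fix r s assume "r < dim_row (0\<^sub>m (a + p) (a + m) :: complex mat)" "s < dim_col (0\<^sub>m (a + p) (a + m) :: complex mat)"
  then have rs: "r < a + p" "s < a + m" by auto
  have 1: "(shift a p * std_A a m p) $$ (r, s) = (if a \<le> s \<and> r = s + (p - m) + 1 then 1 else 0)"
  proof -
    have "(shift a p * std_A a m p) $$ (r, s) = (\<Sum>t\<in>{0..<a + p}. (if a \<le> t \<and> r = t + 1 then 1 else 0) *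
        (if t < a \<or> s < a then (if t = s then 1 else 0) else if t = s + (p - m) then 1 else 0))"
      using rs by (simp add: shift_def std_A_def scalar_prod_def)
    also have "\<dots> = (if r - 1 < a + p then (if a \<le> r - 1 \<and> r = (r - 1) + 1 then 1 else 0) *
        (if r - 1 < a \<or> s < a then (if r - 1 = s then 1 else 0) else if r - 1 = s + (p - m) then 1 else 0) else 0)"
      by (rule sum_single) auto
    also have "\<dots> = (if a \<le> s \<and> r = s + (p - m) + 1 then 1 else 0)" using rs by auto
    finally show ?thesis .
  qed
  have 2: "(std_A a m p * shift a m) $$ (r, s) = (if a \<le> s \<and> r = s + (p - m) + 1 then 1 else 0)"
  proof -
    have "(std_A a m p * shift a m) $$ (r, s) = (\<Sum>t\<in>{0..<a + m}.
        (if r < a \<or> t < a then (if r = t then 1 else 0) else if r = t + (p - m) then 1 else 0) * (if a \<le> s \<and> t = s + 1 then 1 else 0))"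
      using rs by (simp add: shift_def std_A_def scalar_prod_def)
    also have "\<dots> = (if s + 1 < a + m then (if r < a \<or> s + 1 < a then (if r = s + 1 then 1 else 0) else if r = s + 1 + (p - m) then 1 else 0)
         * (if a \<le> s \<and> s + 1 = s + 1 then 1 else 0) else 0)"
      by (rule sum_single) auto
    also have "\<dots> = (if a \<le> s \<and> r = s + (p - m) + 1 then 1 else 0)" using rs by auto
    finally show ?thesis .
  qed
  have 3: "(std_a a m p * std_b a m p) $$ (r, s) = 0"
    using rs by (simp add: std_a_def std_b_def scalar_prod_def)
  show "(shift a p * std_A a m p - std_A a m p * shift a m + std_a a m p * std_b a m p) $$ (r, s) = 0\<^sub>m (a + p) (a + m) $$ (r, s)"
    using rs 1 2 3 by (simp del: index_mult_mat(1))
qed auto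

text \<open>
  If m > p, the vector vanishes in its last coordinate by b, and the eigenvector equation for the
  shift carries this down to the other coordinates.
\<close>

lemma std_observable: "observable (std_A a m p) (std_b a m p) (shift a m)"
  unfolding observable_def std_dims
proof (intro allI ballI impI)
  fix c U assume U: "U \<in> carrier_mat (a + m) 1"
    and z: "shift a m * U = c \<cdot>\<^sub>m U \<and> std_A a m p * U = 0\<^sub>m (a + p) 1 \<and> std_b a m p * U = 0\<^sub>m 1 1"
  define u where "u s = U $$ (s, 0)" for s
  have AU: "(\<Sum>t\<in>{0..<a + m}. (if r < a \<or> t < a then (if r = t then 1 else 0) else if r = t + (p - m) then 1 else 0) * u t) = 0"
    if "r < a + p" for r
  proof -
    have "(std_A a m p * U) $$ (r, 0) = 0" using z that by simp
    then show ?thesis using that U by (simp add: std_A_def scalar_prod_def u_def)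
  qed
  have low: "u s = 0" if "s < a" for s
  proof -
    have "(\<Sum>t\<in>{0..<a + m}. (if s < a \<or> t < a then (if s = t then 1 else 0) else if s = t + (p - m) then 1 else 0) * u t)
      = (if s < a + m then (if s < a \<or> s < a then (if s = s then 1 else 0) else if s = s + (p - m) then 1 else 0) * u s else 0)"
      by (rule sum_single) (use that in auto)
    then show ?thesis using AU[of s] that by simp
  qed
  have high: "u s = 0" if "a \<le> s" "s < a + m" "s + (p - m) < a + p" for s
  proof -
    have "(\<Sum>t\<in>{0..<a + m}. (if s + (p - m) < a \<or> t < a then (if s + (p - m) = t then 1 else 0) else if s + (p - m) = t + (p - m) then 1 else 0) * u t)
      = (if s < a + m then (if s + (p - m) < a \<or> s < a then (if s + (p - m) = s then 1 else 0) else if s + (p - m) = s + (p - m) then 1 else 0) * u s else 0)"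
      by (rule sum_single) (use that in auto)
    then show ?thesis using AU[of "s + (p - m)"] that by simp
  qed
  have "u s = 0" if "s < a + m" for s
  proof (cases "s < a \<or> m \<le> p")
    case True then show ?thesis using low high[of s] that by (cases "s < a") auto
  next
    case False
    then have pm: "p < m" "a \<le> s" by auto
    have last: "u (a + m - 1) = 0"
    proof -
      have "(std_b a m p * U) $$ (0, 0) = 0" using z by simp
      then have "(\<Sum>t\<in>{0..<a + m}. (if t + 1 = a + m \<and> p < m then 1 else 0) * u t) = 0"
        using U by (simp add: std_b_def scalar_prod_def u_def)
      moreover have "(\<Sum>t\<in>{0..<a + m}. (if t + 1 = a + m \<and> p < m then 1 else 0) * u t)
        = (if a + m - 1 < a + m then (if a + m - 1 + 1 = a + m \<and> p < m then 1 else 0) * u (a + m - 1) else 0)"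
        by (rule sum_single) auto
      ultimately show ?thesis using pm by simp
    qed
    have step: "u t = c * u (t + 1)" if "a \<le> t" "t + 1 < a + m" for t
    proof -
      have "(shift a m * U) $$ (t + 1, 0) = c * u (t + 1)" using z that U by (simp add: u_def)
      moreover have "(shift a m * U) $$ (t + 1, 0) = (\<Sum>s\<in>{0..<a + m}. (if a \<le> s \<and> t + 1 = s + 1 then 1 else 0) * u s)"
        using that U by (simp add: shift_def scalar_prod_def u_def)
      moreover have "\<dots> = (if t < a + m then (if a \<le> t \<and> t + 1 = t + 1 then 1 else 0) * u t else 0)"
        by (rule sum_single) auto
      ultimately show ?thesis using that by simp
    qed
    have "u (a + m - 1 - k) = 0" if "k < m" for k
      using that
    proof (induction k)
      case 0 then show ?case using last by simp
    next
      case (Suc k)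
      then have "u (a + m - 1 - Suc k) = c * u (a + m - 1 - Suc k + 1)" by (intro step) auto
      moreover have "a + m - 1 - Suc k + 1 = a + m - 1 - k" using Suc.prems by simp
      ultimately show ?case using Suc by simp
    qed
    from this[of "a + m - 1 - s"] show ?thesis using pm that by simp
  qed
  then show "U = 0\<^sub>m (a + m) 1" using U by (intro eq_matI) (auto simp: u_def)
qed

text \<open>
  If m \<le> p, the row vanishes in the first coordinate of the second part by a, and the
  eigenvector equation for the shift carries this up to the other coordinates.
\<close>

lemma std_controllable: "controllable (std_A a m p) (std_a a m p) (shift a p)"
  unfolding controllable_def std_dims
proof (intro allI ballI impI)
  fix c Y assume Y: "Y \<in> carrier_mat 1 (a + p)"
    and z: "Y * shift a p = c \<cdot>\<^sub>m Y \<and> Y * std_A a m p = 0\<^sub>m 1 (a + m) \<and> Y * std_a a m p = 0\<^sub>m 1 1"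
  define y where "y s = Y $$ (0, s)" for s
  have YA: "(\<Sum>r\<in>{0..<a + p}. y r * (if r < a \<or> s < a then (if r = s then 1 else 0) else if r = s + (p - m) then 1 else 0)) = 0"
    if "s < a + m" for s
  proof -
    have "(Y * std_A a m p) $$ (0, s) = 0" using z that by simp
    then show ?thesis using that Y by (simp add: std_A_def scalar_prod_def y_def)
  qed
  have low: "y s = 0" if "s < a" for s
  proof -
    have "(\<Sum>r\<in>{0..<a + p}. y r * (if r < a \<or> s < a then (if r = s then 1 else 0) else if r = s + (p - m) then 1 else 0))
      = (if s < a + p then y s * (if s < a \<or> s < a then (if s = s then 1 else 0) else if s = s + (p - m) then 1 else 0) else 0)"
      by (rule sum_single) (use that in auto)
    then show ?thesis using YA[of s] that by simp
  qed
  have "y s = 0" if s: "s < a + p" for s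
  proof (cases "s < a")
    case True then show ?thesis by (rule low)
  next
    case False
    then have as: "a \<le> s" by simp
    show ?thesis
    proof (cases "m \<le> p")
      case mp: False
      then have pm: "p - m = 0" by simp
      have "(\<Sum>r\<in>{0..<a + p}. y r * (if r < a \<or> s < a then (if r = s then 1 else 0) else if r = s + (p - m) then 1 else 0))
        = (if s < a + p then y s * (if s < a \<or> s < a then (if s = s then 1 else 0) else if s = s + (p - m) then 1 else 0) else 0)"
        by (rule sum_single) (auto simp: pm)
      then show ?thesis using YA[of s] s as mp by simp
    next
      case True
      have first: "y a = 0" if "0 < p"
      proof -
        have "(Y * std_a a m p) $$ (0, 0) = 0" using z by simp
        then have "(\<Sum>r\<in>{0..<a + p}. y r * (if r = a \<and> m \<le> p then 1 else 0)) = 0"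
          using Y by (simp add: std_a_def scalar_prod_def y_def)
        moreover have "(\<Sum>r\<in>{0..<a + p}. y r * (if r = a \<and> m \<le> p then 1 else 0))
          = (if a < a + p then y a * (if a = a \<and> m \<le> p then 1 else 0) else 0)"
          by (rule sum_single) auto
        ultimately show ?thesis using that True by simp
      qed
      have step: "y (t + 1) = c * y t" if "a \<le> t" "t + 1 < a + p" for t
      proof -
        have "(Y * shift a p) $$ (0, t) = c * y t" using z that Y by (simp add: y_def)
        moreover have "(Y * shift a p) $$ (0, t) = (\<Sum>r\<in>{0..<a + p}. y r * (if a \<le> t \<and> r = t + 1 then 1 else 0))"
          using that Y by (simp add: shift_def scalar_prod_def y_def)
        moreover have "\<dots> = (if t + 1 < a + p then y (t + 1) * (if a \<le> t \<and> t + 1 = t + 1 then 1 else 0) else 0)"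
          by (rule sum_single) auto
        ultimately show ?thesis using that by simp
      qed
      have "y (a + k) = 0" if "k < p" for k
        using that
      proof (induction k)
        case 0 then show ?case using first by simp
      next
        case (Suc k)
        then show ?case using step[of "a + k"] by simp
      qed
      from this[of "s - a"] show ?thesis using s as by simp
    qed
  qed
  then show "Y = 0\<^sub>m 1 (a + p)" using Y by (intro eq_matI) (auto simp: y_def)
qed

text \<open>
  The contributions of the two neighbours of a segment are the shift and its negative.
\<close>

lemma decomposable_fibre:
  assumes Q: "is_bow Q" and dec: "decomposable Q"
  shows "originates_from_brane Q" "fibre Q (\<lambda>_. 0) \<noteq> {}"
proof -
  obtain \<alpha> \<beta> :: "nat \<Rightarrow> nat" where dims: "\<And>k. k < len Q \<Longrightarrow> dims Q ! k = int (\<alpha> k + \<beta> k)"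
    and x: "\<And>k. k < len Q \<Longrightarrow> elts Q ! k = XPoint \<Longrightarrow> \<alpha> (prv Q k) = \<alpha> k"
    and ar: "\<And>k. k < len Q \<Longrightarrow> elts Q ! k = Arrow \<Longrightarrow> \<beta> (prv Q k) = \<beta> k"
    using dec unfolding decomposable_def by blast
  show "originates_from_brane Q" using dims by (simp add: originates_from_brane_def)
  have vd: "vdim Q k = \<alpha> k + \<beta> k" if "k < len Q" for k using dims[OF that] by (simp add: vdim_def)
  define z :: point where "z K k = (if k < len Q then (let h = prv Q k in
     case (elts Q ! k, K) of
       (Arrow, MC) \<Rightarrow> std_C (\<alpha> h) (\<alpha> k) (\<beta> k)
     | (Arrow, MD) \<Rightarrow> std_D (\<alpha> h) (\<alpha> k) (\<beta> k)
     | (XPoint, MA) \<Rightarrow> std_A (\<alpha> k) (\<beta> h) (\<beta> k)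
     | (XPoint, MBminus) \<Rightarrow> shift (\<alpha> k) (\<beta> h)
     | (XPoint, MBplus) \<Rightarrow> shift (\<alpha> k) (\<beta> k)
     | (XPoint, Ma) \<Rightarrow> std_a (\<alpha> k) (\<beta> h) (\<beta> k)
     | (XPoint, Mb) \<Rightarrow> std_b (\<alpha> k) (\<beta> h) (\<beta> k)
     | _ \<Rightarrow> 0\<^sub>m 0 0) else 0\<^sub>m 0 0)" for K k
  have S: "z K k \<in> carrier_mat (fst (shape Q K k)) (snd (shape Q K k))" for K k
  proof (cases "k < len Q")
    case k: True
    note h = prv_less_len[OF k]
    show ?thesis
      using k vd[OF k] vd[OF h] x[OF k] ar[OF k]
      by (cases "elts Q ! k"; cases K) (auto simp: z_def shape_def intro!: carrier_matI)
  qed (simp add: z_def shape_def)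
  have T: "triangle_conditions Q z k" if k: "k < len Q" and X: "elts Q ! k = XPoint" for k
  proof -
    note h = prv_less_len[OF k]
    have zs: "z MA k = std_A (\<alpha> k) (\<beta> (prv Q k)) (\<beta> k)" "z MBminus k = shift (\<alpha> k) (\<beta> (prv Q k))"
      "z MBplus k = shift (\<alpha> k) (\<beta> k)" "z Ma k = std_a (\<alpha> k) (\<beta> (prv Q k)) (\<beta> k)"
      "z Mb k = std_b (\<alpha> k) (\<beta> (prv Q k)) (\<beta> k)"
      using k X by (simp_all add: z_def)
    have c: "z MA k \<in> carrier_mat (vdim Q k) (vdim Q (prv Q k))"
      "z MBminus k \<in> carrier_mat (vdim Q (prv Q k)) (vdim Q (prv Q k))"
      "z MBplus k \<in> carrier_mat (vdim Q k) (vdim Q k)" "z Ma k \<in> carrier_mat (vdim Q k) 1"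
      "z Mb k \<in> carrier_mat 1 (vdim Q (prv Q k))"
      unfolding zs vd[OF k] vd[OF h] x[OF k X] by (auto intro!: carrier_matI)
    show ?thesis unfolding triangle_conditions_iff[of z k Q, OF c]
      unfolding zs vd[OF k] vd[OF h] x[OF k X]
      using std_triangle_relation std_observable std_controllable by blast
  qed
  have hd: "head_moment Q z k = - shift (\<alpha> k) (\<beta> k)" if k: "k < len Q" for k
    using k std_CD by (cases "elts Q ! k") (simp_all add: head_moment_def z_def)
  have tl: "tail_moment Q z k = shift (\<alpha> (prv Q k)) (\<beta> (prv Q k))" if k: "k < len Q" for k
    using k x[OF k] ar[OF k] std_DC by (cases "elts Q ! k") (simp_all add: tail_moment_def z_def)
  have "z \<in> fibre Q (\<lambda>_. 0)"
    unfolding fibre_def Mtilde_def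
  proof (intro CollectI conjI allI impI)
    show "z K k \<in> carrier_mat (fst (shape Q K k)) (snd (shape Q K k))" for K k by (rule S)
    show "triangle_conditions Q z k" if "k < len Q" "elts Q ! k = XPoint" for k by (rule T[OF that])
    fix k assume k: "k < len Q"
    have "moment_map Q z k = - shift (\<alpha> k) (\<beta> k) + shift (\<alpha> k) (\<beta> k)"
      unfolding moment_map_split hd[OF k] tl[OF nxt_less_len[OF k]] prv_nxt[OF k] ..
    also have "\<dots> = 0 \<cdot>\<^sub>m 1\<^sub>m (vdim Q k)" unfolding vd[OF k] by (rule eq_matI) auto
    finally show "moment_map Q z k = 0 \<cdot>\<^sub>m 1\<^sub>m (vdim Q k)" .
  qed
  then show "fibre Q (\<lambda>_. 0) \<noteq> {}" by blast
qed

section \<open>Points of the quotient\<close>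

lemma gauge_inverse:
  assumes g: "g \<in> gauge_group Q" and i: "i < len Q"
  shows "g i \<in> carrier_mat (vdim Q i) (vdim Q i)" "gauge_inv Q g i \<in> carrier_mat (vdim Q i) (vdim Q i)"
    "g i * gauge_inv Q g i = 1\<^sub>m (vdim Q i)" "gauge_inv Q g i * g i = 1\<^sub>m (vdim Q i)"
proof -
  let ?R = "ring_mat TYPE(complex) (vdim Q i) ()"
  interpret R: ring ?R by (rule ring_mat)
  have u: "g i \<in> Units ?R" using g i by (simp add: gauge_group_def)
  show "g i \<in> carrier_mat (vdim Q i) (vdim Q i)" using R.Units_closed[OF u] by (simp add: ring_mat_simps)
  show "gauge_inv Q g i \<in> carrier_mat (vdim Q i) (vdim Q i)"
    using R.Units_inv_closed[OF u] by (simp add: ring_mat_simps gauge_inv_def)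
  show "g i * gauge_inv Q g i = 1\<^sub>m (vdim Q i)" using R.Units_r_inv[OF u] by (simp add: ring_mat_simps gauge_inv_def)
  show "gauge_inv Q g i * g i = 1\<^sub>m (vdim Q i)" using R.Units_l_inv[OF u] by (simp add: ring_mat_simps gauge_inv_def)
qed

lemma triangle_base_change:
  fixes A Bm Bp a b g h g' h' :: "complex mat"
  assumes A: "A \<in> carrier_mat p m" and Bm: "Bm \<in> carrier_mat m m" and Bp: "Bp \<in> carrier_mat p p"
    and a: "a \<in> carrier_mat p 1" and b: "b \<in> carrier_mat 1 m"
    and g: "g \<in> carrier_mat p p" "g' \<in> carrier_mat p p" "g * g' = 1\<^sub>m p" "g' * g = 1\<^sub>m p"
    and h: "h \<in> carrier_mat m m" "h' \<in> carrier_mat m m" "h * h' = 1\<^sub>m m" "h' * h = 1\<^sub>m m"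
    and rel: "Bp * A - A * Bm + a * b = 0\<^sub>m p m"
    and obs: "observable A b Bm" and con: "controllable A a Bp"
  shows "(g * Bp * g') * (g * A * h') - (g * A * h') * (h * Bm * h') + (g * a) * (b * h') = 0\<^sub>m p m"
    and "observable (g * A * h') (b * h') (h * Bm * h')" and "controllable (g * A * h') (g * a) (g * Bp * g')"
proof -
  have d [simp]: "dim_row A = p" "dim_col A = m" "dim_row Bm = m" "dim_col Bm = m" "dim_row Bp = p" "dim_col Bp = p"
    "dim_row a = p" "dim_col a = 1" "dim_row b = 1" "dim_col b = m" "dim_row g = p" "dim_col g = p"
    "dim_row g' = p" "dim_col g' = p" "dim_row h = m" "dim_col h = m" "dim_row h' = m" "dim_col h' = m"
    using assms by auto
  have cg: "g' * (g * X) = X" "g * (g' * X) = X" if "dim_row X = p" for X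
    using that g(3,4) by (simp_all flip: mat_assoc)
  have ch: "h' * (h * X) = X" "h * (h' * X) = X" if "dim_row X = m" for X
    using that h(3,4) by (simp_all flip: mat_assoc)
  show "(g * Bp * g') * (g * A * h') - (g * A * h') * (h * Bm * h') + (g * a) * (b * h') = 0\<^sub>m p m"
  proof -
    have t: "(g * Bp * g') * (g * A * h') = g * (Bp * A) * h'" "(g * A * h') * (h * Bm * h') = g * (A * Bm) * h'"
      "(g * a) * (b * h') = g * (a * b) * h'" by (simp_all add: mat_assoc cg ch)
    have "Bp * A - A * Bm + a * b = Bp * A + - (A * Bm) + a * b" by (rule eq_matI) (auto simp del: index_mult_mat(1))
    then have "g * (Bp * A + - (A * Bm) + a * b) * h' = g * 0\<^sub>m p m * h'" using rel by simp
    then have z: "g * (Bp * A) * h' + - (g * (A * Bm) * h') + g * (a * b) * h' = 0\<^sub>m p m" by (simp add: mat_expand)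
    have "g * (Bp * A) * h' - g * (A * Bm) * h' + g * (a * b) * h' = g * (Bp * A) * h' + - (g * (A * Bm) * h') + g * (a * b) * h'"
      by (rule eq_matI) (auto simp del: index_mult_mat(1))
    then show ?thesis unfolding t using z by simp
  qed
  show "observable (g * A * h') (b * h') (h * Bm * h')"
    unfolding observable_def
  proof (intro allI ballI impI)
    fix c U assume U: "U \<in> carrier_mat (dim_row (h * Bm * h')) 1"
      and z: "h * Bm * h' * U = c \<cdot>\<^sub>m U \<and> g * A * h' * U = 0\<^sub>m (dim_row (g * A * h')) 1 \<and> b * h' * U = 0\<^sub>m (dim_row (b * h')) 1"
    have dU [simp]: "dim_row U = m" "dim_col U = 1" using U by auto
    have "h' * (h * Bm * h' * U) = h' * (c \<cdot>\<^sub>m U)" using z by simp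
    then have 1: "Bm * (h' * U) = c \<cdot>\<^sub>m (h' * U)" by (simp add: mat_expand ch)
    have "g' * (g * A * h' * U) = g' * 0\<^sub>m p 1" using z by simp
    then have 2: "A * (h' * U) = 0\<^sub>m p 1" by (simp add: mat_expand cg)
    have 3: "b * (h' * U) = 0\<^sub>m 1 1" using z by (simp add: mat_expand)
    have "h' * U \<in> carrier_mat m 1" by (rule carrier_matI) simp_all
    then have "h' * U = 0\<^sub>m m 1" using obs[unfolded observable_def, rule_format, of "h' * U" c] 1 2 3 by simp
    then have "h * (h' * U) = h * 0\<^sub>m m 1" by simp
    then show "U = 0\<^sub>m (dim_row (h * Bm * h')) 1" by (simp add: ch)
  qed
  show "controllable (g * A * h') (g * a) (g * Bp * g')"
    unfolding controllable_def
  proof (intro allI ballI impI)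
    fix c Y assume Y: "Y \<in> carrier_mat 1 (dim_row (g * Bp * g'))"
      and z: "Y * (g * Bp * g') = c \<cdot>\<^sub>m Y \<and> Y * (g * A * h') = 0\<^sub>m 1 (dim_col (g * A * h')) \<and> Y * (g * a) = 0\<^sub>m 1 (dim_col (g * a))"
    have dY [simp]: "dim_row Y = 1" "dim_col Y = p" using Y by auto
    have "Y * (g * Bp * g') * g = c \<cdot>\<^sub>m Y * g" using z by simp
    then have 1: "(Y * g) * Bp = c \<cdot>\<^sub>m (Y * g)" by (simp add: mat_expand g(4))
    have "Y * (g * A * h') * h = 0\<^sub>m 1 m * h" using z by simp
    then have 2: "(Y * g) * A = 0\<^sub>m 1 m" by (simp add: mat_expand h(4))
    have 3: "(Y * g) * a = 0\<^sub>m 1 1" using z by (simp add: mat_expand)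
    have "Y * g \<in> carrier_mat 1 p" by (rule carrier_matI) simp_all
    then have "Y * g = 0\<^sub>m 1 p" using con[unfolded controllable_def, rule_format, of "Y * g" c] 1 2 3 by simp
    then have "(Y * g) * g' = 0\<^sub>m 1 p * g'" by simp
    then show "Y = 0\<^sub>m 1 (dim_row (g * Bp * g'))" by (simp add: mat_expand g(3))
  qed
qed

text \<open>
  Both moments are conjugated by the element of the group at their segment.
\<close>

lemma zero_fibre_gauge_invariant:
  assumes g: "g \<in> gauge_group Q" and z: "z \<in> fibre Q (\<lambda>_. 0)"
  shows "base_change Q g z \<in> fibre Q (\<lambda>_. 0)"
proof -
  define G where "G = g"
  define H where "H = gauge_inv Q g"
  have G: "G i \<in> carrier_mat (vdim Q i) (vdim Q i)" "H i \<in> carrier_mat (vdim Q i) (vdim Q i)"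
    "G i * H i = 1\<^sub>m (vdim Q i)" "H i * G i = 1\<^sub>m (vdim Q i)" if "i < len Q" for i
    using gauge_inverse[OF g that] by (simp_all add: G_def H_def)
  have M: "z \<in> Mtilde Q" and mom: "\<And>k. k < len Q \<Longrightarrow> head_moment Q z k + tail_moment Q z (nxt Q k) = 0 \<cdot>\<^sub>m 1\<^sub>m (vdim Q k)"
    using z by (auto simp: fibre_def moment_map_split)
  define y where "y = base_change Q g z"
  have yA: "y MC k = G k * z MC k * H (prv Q k)" "y MD k = G (prv Q k) * z MD k * H k"
    if "k < len Q" "elts Q ! k = Arrow" for k
    using that by (simp_all add: y_def base_change_def Let_def G_def H_def)
  have yX: "y MA k = G k * z MA k * H (prv Q k)" "y MBminus k = G (prv Q k) * z MBminus k * H (prv Q k)"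
    "y MBplus k = G k * z MBplus k * H k" "y Ma k = G k * z Ma k" "y Mb k = z Mb k * H (prv Q k)"
    if "k < len Q" "elts Q ! k = XPoint" for k
    using that by (simp_all add: y_def base_change_def Let_def G_def H_def)
  have yX': "y MA k \<in> carrier_mat (vdim Q k) (vdim Q (prv Q k))"
    "y MBminus k \<in> carrier_mat (vdim Q (prv Q k)) (vdim Q (prv Q k))"
    "y MBplus k \<in> carrier_mat (vdim Q k) (vdim Q k)" "y Ma k \<in> carrier_mat (vdim Q k) 1"
    "y Mb k \<in> carrier_mat 1 (vdim Q (prv Q k))" if k: "k < len Q" and X: "elts Q ! k = XPoint" for k
    unfolding yX[OF k X] using triangle_carrier[OF M k X] G[OF k] G[OF prv_less_len[OF k]]
    by (auto intro!: mult_carrier_mat)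
  have yA': "y MC k \<in> carrier_mat (vdim Q k) (vdim Q (prv Q k))" "y MD k \<in> carrier_mat (vdim Q (prv Q k)) (vdim Q k)"
    if k: "k < len Q" and X: "elts Q ! k = Arrow" for k
    unfolding yA[OF k X] using arrow_carrier[OF M k X] G[OF k] G[OF prv_less_len[OF k]]
    by (auto intro!: mult_carrier_mat)
  have S: "y K k \<in> carrier_mat (fst (shape Q K k)) (snd (shape Q K k))" for K k
  proof (cases "k < len Q")
    case k: True
    have same: "y K k = z K k" if "shape Q K k = (0, 0) \<and> (elts Q ! k = Arrow \<and> K \<noteq> MC \<and> K \<noteq> MD \<or> elts Q ! k = XPoint \<and> (K = MC \<or> K = MD))"
      using that k by (cases K) (auto simp: y_def base_change_def Let_def)
    show ?thesis
    proof (cases "elts Q ! k")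
      case Arrow
      then show ?thesis using yA'[OF k Arrow] same Mtilde_carrier[OF M, of K k] k
        by (cases K) (simp_all add: shape_def)
    next
      case XPoint
      then show ?thesis using yX'[OF k XPoint] same Mtilde_carrier[OF M, of K k] k
        by (cases K) (simp_all add: shape_def)
    qed
  next
    case False
    then show ?thesis using Mtilde_carrier[OF M, of K k] by (simp add: y_def base_change_def)
  qed
  have T: "triangle_conditions Q y k" if k: "k < len Q" and X: "elts Q ! k = XPoint" for k
    unfolding triangle_conditions_iff[of y k Q, OF yX'[OF k X]]
    unfolding yX[OF k X]
    using triangle_base_change[OF triangle_carrier[OF M k X] G[OF k] G[OF prv_less_len[OF k]] triangle_parts[OF M k X]]
    by blast
  have hd: "head_moment Q y k = G k * head_moment Q z k * H k" if k: "k < len Q" for k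
  proof (cases "elts Q ! k")
    case Arrow
    note c = arrow_carrier[OF M k Arrow] G[OF k] G[OF prv_less_len[OF k]]
    have "(G k * z MC k * H (prv Q k)) * (G (prv Q k) * z MD k * H k) = G k * z MC k * ((H (prv Q k) * G (prv Q k)) * (z MD k * H k))"
      using c(1-4,7-8) by (simp add: mat_assoc)
    also have "\<dots> = G k * (z MC k * z MD k) * H k" unfolding c(10) using c(1-4) by (simp add: mat_assoc)
    finally show ?thesis using Arrow by (simp add: head_moment_def yA[OF k Arrow])
  next
    case XPoint
    then show ?thesis using triangle_carrier[OF M k XPoint] G[OF k] by (simp add: head_moment_def yX[OF k XPoint])
  qed
  have tl: "tail_moment Q y k = G (prv Q k) * tail_moment Q z k * H (prv Q k)" if k: "k < len Q" for k
  proof (cases "elts Q ! k")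
    case Arrow
    note c = arrow_carrier[OF M k Arrow] G[OF k] G[OF prv_less_len[OF k]]
    have "(G (prv Q k) * z MD k * H k) * (G k * z MC k * H (prv Q k)) = G (prv Q k) * z MD k * ((H k * G k) * (z MC k * H (prv Q k)))"
      using c(1-4,7-8) by (simp add: mat_assoc)
    also have "\<dots> = G (prv Q k) * (z MD k * z MC k) * H (prv Q k)" unfolding c(6) using c(1-2,7-8) by (simp add: mat_assoc)
    finally show ?thesis using Arrow c by (simp add: tail_moment_def yA[OF k Arrow])
  next
    case XPoint
    then show ?thesis by (simp add: tail_moment_def yX[OF k XPoint])
  qed
  have "y \<in> fibre Q (\<lambda>_. 0)"
    unfolding fibre_def Mtilde_def
  proof (intro CollectI conjI allI impI)
    show "y K k \<in> carrier_mat (fst (shape Q K k)) (snd (shape Q K k))" for K k by (rule S)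
    show "triangle_conditions Q y k" if "k < len Q" "elts Q ! k = XPoint" for k by (rule T[OF that])
    fix k assume k: "k < len Q"
    note n = nxt_less_len[OF k]
    have hc: "head_moment Q z k \<in> carrier_mat (vdim Q k) (vdim Q k)" by (rule head_moment_carrier[OF M k])
    have tc: "tail_moment Q z (nxt Q k) \<in> carrier_mat (vdim Q k) (vdim Q k)"
      using tail_moment_carrier[OF M n] by (simp add: prv_nxt[OF k])
    have "moment_map Q y k = G k * head_moment Q z k * H k + G k * tail_moment Q z (nxt Q k) * H k"
      unfolding moment_map_split hd[OF k] tl[OF n] prv_nxt[OF k] ..
    also have "\<dots> = G k * (head_moment Q z k + tail_moment Q z (nxt Q k)) * H k"
      using hc tc G(1,2)[OF k] by (simp add: mat_expand)
    also have "\<dots> = G k * (0 \<cdot>\<^sub>m 1\<^sub>m (vdim Q k)) * H k" unfolding mom[OF k] ..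
    also have "\<dots> = 0 \<cdot>\<^sub>m (G k * H k)" using G(1,2)[OF k] by (simp add: mat_expand)
    finally show "moment_map Q y k = 0 \<cdot>\<^sub>m 1\<^sub>m (vdim Q k)" unfolding G(3)[OF k] .
  qed
  then show ?thesis by (simp add: y_def)
qed

lemma regular_fun_add:
  assumes f: "f \<in> regular_fun Q X" and h: "h \<in> regular_fun Q X"
  shows "(\<lambda>z. f z + h z) \<in> regular_fun Q X"
  unfolding regular_fun_def
proof (intro CollectI conjI allI impI ballI)
  show "f z + h z = 0" if "z \<notin> X" for z using f h that by (simp add: regular_fun_def)
  fix z assume z: "z \<in> X"
  obtain p1 q1 where 1: "p1 \<in> poly_fun Q" "q1 \<in> poly_fun Q" "q1 z \<noteq> 0" "\<forall>y\<in>X. q1 y \<noteq> 0 \<longrightarrow> f y = p1 y / q1 y"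
    using f z unfolding regular_fun_def by blast
  obtain p2 q2 where 2: "p2 \<in> poly_fun Q" "q2 \<in> poly_fun Q" "q2 z \<noteq> 0" "\<forall>y\<in>X. q2 y \<noteq> 0 \<longrightarrow> h y = p2 y / q2 y"
    using h z unfolding regular_fun_def by blast
  show "\<exists>p\<in>poly_fun Q. \<exists>q\<in>poly_fun Q. q z \<noteq> 0 \<and> (\<forall>y\<in>X. q y \<noteq> 0 \<longrightarrow> f y + h y = p y / q y)"
  proof (rule bexI[of _ "\<lambda>z. p1 z * q2 z + p2 z * q1 z"], rule bexI[of _ "\<lambda>z. q1 z * q2 z"], intro conjI ballI impI)
    show "(\<lambda>z. p1 z * q2 z + p2 z * q1 z) \<in> poly_fun Q"
      by (rule poly_fun.add[OF poly_fun.mult[OF 1(1) 2(2)] poly_fun.mult[OF 2(1) 1(2)]])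
    show "(\<lambda>z. q1 z * q2 z) \<in> poly_fun Q" by (rule poly_fun.mult[OF 1(2) 2(2)])
    show "q1 z * q2 z \<noteq> 0" using 1 2 by simp
    show "f y + h y = (p1 y * q2 y + p2 y * q1 y) / (q1 y * q2 y)" if "y \<in> X" "q1 y * q2 y \<noteq> 0" for y
    proof -
      have "q1 y \<noteq> 0" "q2 y \<noteq> 0" using that(2) by simp_all
      then show ?thesis using 1(4) 2(4) that(1) by (simp add: add_frac_eq)
    qed
  qed
qed

lemma regular_fun_mult:
  assumes f: "f \<in> regular_fun Q X" and h: "h \<in> regular_fun Q X"
  shows "(\<lambda>z. f z * h z) \<in> regular_fun Q X"
  unfolding regular_fun_def
proof (intro CollectI conjI allI impI ballI)
  show "f z * h z = 0" if "z \<notin> X" for z using f h that by (simp add: regular_fun_def)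
  fix z assume z: "z \<in> X"
  obtain p1 q1 where 1: "p1 \<in> poly_fun Q" "q1 \<in> poly_fun Q" "q1 z \<noteq> 0" "\<forall>y\<in>X. q1 y \<noteq> 0 \<longrightarrow> f y = p1 y / q1 y"
    using f z unfolding regular_fun_def by blast
  obtain p2 q2 where 2: "p2 \<in> poly_fun Q" "q2 \<in> poly_fun Q" "q2 z \<noteq> 0" "\<forall>y\<in>X. q2 y \<noteq> 0 \<longrightarrow> h y = p2 y / q2 y"
    using h z unfolding regular_fun_def by blast
  show "\<exists>p\<in>poly_fun Q. \<exists>q\<in>poly_fun Q. q z \<noteq> 0 \<and> (\<forall>y\<in>X. q y \<noteq> 0 \<longrightarrow> f y * h y = p y / q y)"
  proof (rule bexI[of _ "\<lambda>z. p1 z * p2 z"], rule bexI[of _ "\<lambda>z. q1 z * q2 z"], intro conjI ballI impI)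
    show "(\<lambda>z. p1 z * p2 z) \<in> poly_fun Q" by (rule poly_fun.mult[OF 1(1) 2(1)])
    show "(\<lambda>z. q1 z * q2 z) \<in> poly_fun Q" by (rule poly_fun.mult[OF 1(2) 2(2)])
    show "q1 z * q2 z \<noteq> 0" using 1 2 by simp
    show "f y * h y = (p1 y * p2 y) / (q1 y * q2 y)" if "y \<in> X" "q1 y * q2 y \<noteq> 0" for y
    proof -
      have "q1 y \<noteq> 0" "q2 y \<noteq> 0" using that(2) by simp_all
      then show ?thesis using 1(4) 2(4) that(1) by simp
    qed
  qed
qed

lemma regular_fun_const:
  "(\<lambda>z. if z \<in> X then c else 0) \<in> regular_fun Q X"
proof -
  have "\<forall>z\<in>X. \<exists>p\<in>poly_fun Q. \<exists>q\<in>poly_fun Q.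
      q z \<noteq> 0 \<and> (\<forall>y\<in>X. q y \<noteq> 0 \<longrightarrow> (if y \<in> X then c else 0) = p y / q y)"
    by (intro ballI bexI[of _ "\<lambda>_. c"] bexI[of _ "\<lambda>_. 1"] poly_fun.const) simp
  then show ?thesis by (simp add: regular_fun_def)
qed

text \<open>
  For an empty fibre the only function is 0. For a point z0 of the fibre, the functions that
  vanish at z0 form a prime ideal. For trivial stability it does not contain the constant function
  1 of degree 1, which is extended by 0 outside the fibre and is invariant since the fibre is.
\<close>

lemma Proj_nonempty_iff:
  "Proj (semi_invariants Q X th) \<noteq> {} \<Longrightarrow> X \<noteq> {}"
  "\<lbrakk>z0 \<in> X; \<And>g z. g \<in> gauge_group Q \<Longrightarrow> z \<in> X \<Longrightarrow> base_change Q g z \<in> X\<rbrakk> \<Longrightarrow> Proj (semi_invariants Q X (\<lambda>_. 0)) \<noteq> {}"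
proof -
  assume "Proj (semi_invariants Q X th) \<noteq> {}"
  then obtain P where P: "P \<in> Proj (semi_invariants Q X th)" by blast
  show "X \<noteq> {}"
  proof
    assume X: "X = {}"
    have "semi_invariants Q X th k \<subseteq> {\<lambda>_. 0}" for k unfolding X by (auto simp: semi_invariants_def regular_fun_def)
    moreover have "(\<lambda>_. 0) \<in> P k" for k using P by (simp add: Proj_def)
    ultimately have "semi_invariants Q X th k \<subseteq> P k" for k by blast
    then show False using P by (simp add: Proj_def)
  qed
next
  assume z0: "z0 \<in> X" and inv: "\<And>g z. g \<in> gauge_group Q \<Longrightarrow> z \<in> X \<Longrightarrow> base_change Q g z \<in> X"
  define R where "R = semi_invariants Q X (\<lambda>_. 0)"
  have ch: "character Q (\<lambda>_. 0) g = 1" for g by (simp add: character_def)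
  have R: "f \<in> R k \<longleftrightarrow> f \<in> regular_fun Q X \<and> (\<forall>g\<in>gauge_group Q. \<forall>z\<in>X. f (base_change Q g z) = f z)" for f k
    by (simp add: R_def semi_invariants_def ch)
  have add: "(\<lambda>z. f z + h z) \<in> R k" if "f \<in> R k" "h \<in> R k" for f h k
    using that regular_fun_add unfolding R by simp
  have mult: "(\<lambda>z. f z * h z) \<in> R m" if "f \<in> R k" "h \<in> R l" for f h k l m
    using that regular_fun_mult unfolding R by simp
  have cst: "(\<lambda>z. if z \<in> X then c else 0) \<in> R k" for c k
    using regular_fun_const inv unfolding R by simp
  have zero: "(\<lambda>_. 0) \<in> R k" for k using cst[of 0 k] by simp
  define P where "P k = {f \<in> R k. f z0 = 0}" for k
  have "P \<in> Proj R"
    unfolding Proj_def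
  proof (intro CollectI conjI allI ballI impI)
    show "P k \<subseteq> R k" for k by (auto simp: P_def)
    show "(\<lambda>_. 0) \<in> P k" for k using zero by (simp add: P_def)
    show "(\<lambda>z. f z + h z) \<in> P k" if "f \<in> P k" "h \<in> P k" for f h k using that add by (simp add: P_def)
    show "(\<lambda>z. f z * h z) \<in> P (k + l)" if "f \<in> R k" "h \<in> P l" for f h k l
      using that mult[of f k h l "k + l"] by (simp add: P_def)
    show "f \<in> P k \<or> h \<in> P l" if "f \<in> R k" "h \<in> R l" "(\<lambda>z. f z * h z) \<in> P (k + l)" for f h k l
      using that by (auto simp: P_def)
    have "(\<lambda>z. if z \<in> X then 1 else 0) \<in> R 1 - P 1" using cst[of 1 1] z0 by (simp add: P_def)
    then show "\<exists>k>0. \<not> R k \<subseteq> P k" by (intro exI[of _ 1]) auto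
  qed
  then show "Proj (semi_invariants Q X (\<lambda>_. 0)) \<noteq> {}" unfolding R_def by blast
qed

section \<open>The equivalences\<close>

lemma bow_variety_nonempty_imp:
  assumes "bow_variety Q lam th \<noteq> {}"
  shows "originates_from_brane Q" "\<exists>lam'. fibre Q lam' \<noteq> {}"
proof -
  have nn: "\<not> (\<exists>i<len Q. dims Q ! i < 0)" 
  proof
    assume "\<exists>i<len Q. dims Q ! i < 0"
    then have "bow_variety Q lam th = {}" by (simp add: bow_variety_def)
    then show False using assms by simp
  qed
  then show "originates_from_brane Q" unfolding originates_from_brane_def by (meson not_less)
  have "Proj (semi_invariants Q (moment_fibre Q lam) th) \<noteq> {}" using assms nn by (simp add: bow_variety_def)
  then have "moment_fibre Q lam \<noteq> {}" by (rule Proj_nonempty_iff(1))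
  then show "\<exists>lam'. fibre Q lam' \<noteq> {}" unfolding moment_fibre_eq_fibre by blast
qed

lemma bow_variety_zero_nonempty:
  assumes "originates_from_brane Q" "fibre Q (\<lambda>_. 0) \<noteq> {}"
  shows "bow_variety Q (\<lambda>_. 0) (\<lambda>_. 0) \<noteq> {}"
proof -
  have e: "moment_fibre Q (\<lambda>_. 0) = fibre Q (\<lambda>_. 0)" unfolding moment_fibre_eq_fibre by simp
  obtain z where "z \<in> fibre Q (\<lambda>_. 0)" using assms(2) by blast
  then have "Proj (semi_invariants Q (moment_fibre Q (\<lambda>_. 0)) (\<lambda>_. 0)) \<noteq> {}"
    unfolding e by (rule Proj_nonempty_iff(2)) (rule zero_fibre_gauge_invariant)
  moreover have "\<not> (\<exists>i<len Q. dims Q ! i < 0)" using assms(1) by (auto simp: originates_from_brane_def not_less)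
  ultimately show ?thesis by (simp add: bow_variety_def)
qed

lemma bow_variety_imp_always_originates:
  assumes Q: "is_bow Q" and ne: "bow_variety Q lam th \<noteq> {}"
  shows "always_originates Q"
proof -
  obtain lam' where "fibre Q lam' \<noteq> {}" using bow_variety_nonempty_imp(2)[OF ne] by blast
  then show ?thesis
    unfolding always_originates_def using hw_equivalent_fibre[OF _ Q bow_variety_nonempty_imp(1)[OF ne]] by blast
qed

lemma always_originates_imp_bow_variety:
  assumes Q: "is_bow Q" and c: "always_originates Q"
  shows "bow_variety Q (\<lambda>_. 0) (\<lambda>_. 0) \<noteq> {}"
proof -
  obtain U where U: "hw_equivalent Q U" "decomposable U" using always_originates_decomposable[OF Q c] by blast
  note bk = hw_equivalent_sym[OF Q U(1)]
  note D = decomposable_fibre[OF bk(2) U(2)]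
  obtain lam' where "fibre Q lam' \<noteq> {}" "lam' = (\<lambda>_. 0)"
    using hw_equivalent_fibre[OF bk D] by blast
  moreover have "originates_from_brane Q" using c by (simp add: always_originates_def hw_equivalent_def)
  ultimately show ?thesis using bow_variety_zero_nonempty by blast
qed

lemma always_originates_iff_stratum_condition:
  assumes Q: "is_bow Q"
  shows "always_originates Q \<longleftrightarrow> stratum_condition Q"
proof
  assume c: "always_originates Q"
  show "stratum_condition Q" unfolding stratum_condition_def
  proof (intro allI impI)
    fix U assume U: "hw_equivalent Q U \<and> separated U"
    then obtain U' V where U': "bow_subdiagram U' U" "same_jumps U' U" "always_originates U'" "hw_equivalent U' V" "balanced V"
      using always_originates_subdiagram[OF Q c] by blast
    then have "is_bow U'" by (simp add: bow_subdiagram_def)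
    then have "supersymmetric U'" using always_originates_iff_supersymmetric U'(3) by blast
    then show "\<exists>U'. bow_subdiagram U' U \<and> supersymmetric U' \<and> same_jumps U' U \<and> (\<exists>V. hw_equivalent U' V \<and> balanced V)"
      using U' by blast
  qed
next
  assume S: "stratum_condition Q"
  show "always_originates Q"
  proof (rule always_originates_of_subdiagrams[OF Q])
    fix U assume U: "hw_equivalent Q U" "separated U"
    then obtain U' where U': "bow_subdiagram U' U" "supersymmetric U'" "same_jumps U' U"
      using S unfolding stratum_condition_def by blast
    then have "is_bow U'" by (simp add: bow_subdiagram_def)
    then have "always_originates U'" using always_originates_iff_supersymmetric U'(2) by blast
    then show "\<exists>U'. bow_subdiagram U' U \<and> same_jumps U' U \<and> always_originates U'" using U' by blast
  qed
qed

theorem theorem5p1: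
  fixes Q :: bow
  assumes "is_bow Q"
  shows "(bow_variety Q (\<lambda>_. 0) (\<lambda>_. 0) \<noteq> {} \<longleftrightarrow>
            (\<exists>lam th. bow_variety Q lam th \<noteq> {})) \<and>
         (bow_variety Q (\<lambda>_. 0) (\<lambda>_. 0) \<noteq> {} \<longleftrightarrow>
            (\<forall>U. hw_equivalent Q U \<longrightarrow> originates_from_brane U)) \<and>
         (bow_variety Q (\<lambda>_. 0) (\<lambda>_. 0) \<noteq> {} \<longleftrightarrow>
            (\<forall>U. hw_equivalent Q U \<and> separated U \<longrightarrow> susy_inequalities U)) \<and>
         (bow_variety Q (\<lambda>_. 0) (\<lambda>_. 0) \<noteq> {} \<longleftrightarrow> supersymmetric Q) \<and>
         (bow_variety Q (\<lambda>_. 0) (\<lambda>_. 0) \<noteq> {} \<longleftrightarrow> stratum_condition Q)"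
proof -
  have b: "(\<exists>lam th. bow_variety Q lam th \<noteq> {}) \<longleftrightarrow> always_originates Q"
    and a: "bow_variety Q (\<lambda>_. 0) (\<lambda>_. 0) \<noteq> {} \<longleftrightarrow> always_originates Q"
    using bow_variety_imp_always_originates[OF assms] always_originates_imp_bow_variety[OF assms] by blast+
  show ?thesis
    unfolding a b always_originates_def[symmetric]
      always_originates_iff_susy_inequalities[OF assms, symmetric]
      always_originates_iff_supersymmetric[OF assms, symmetric]
      always_originates_iff_stratum_condition[OF assms, symmetric]
    by blast
qed

end
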